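(* Let $k\ge 0$ and $n\ge k$ ($n\geq 1$) be integers, let $\lambda\in\mathcal P_n^{(k)}$ be a $k$-strict partition whose Young diagram fits in the $(n-k)\times(n+k)$ rectangle, and let $\chi=(\chi_1,\ldots,\chi_{n-k})$ be its characteristic index. Then the double Schubert polynomial of the corresponding $k$-Grassmannian element $w_\lambda^{(k)}$ is $$\mathfrak C_{w_\lambda^{(k)}}=\sum_{I\subset D(\lambda)}\mathrm{Pf}\left[{}_k\vartheta_{\lambda_1+a_1^I}^{(\chi_1)}\cdots{}_k\vartheta_{\lambda_{n-k}+a_{n-k}^I}^{(\chi_{n-k})}\right],$$ where $I$ runs over all subsets of $D(\lambda)$ and $a_s^I=\#\{j\mid (s,j)\in I\}-\#\{i\mid (i,s)\in I\}$.
   Context: **Group.** $W_\infty$ is the group (under composition) of permutations $w$ of $\{1,2,\ldots\}\cup\{\bar1,\bar2,\ldots\}$, where $\bar i=-i$, with $w(\bar i)=\overline{w(i)}$ for all $i$ and $w(i)\ne i$ for only finitely many $i$. It is a Coxeter group with generators $s_0=(1,\bar1)$ and $s_i=(i,i+1)(\bar i,\overline{i+1})$ for $i\ge1$; $\ell$ is the length. $W_n=\{w\in W_\infty\mid w(i)=i\ \forall i>n\}$, with elements written in one-line notation $w(1)\cdots w(n)$. **Ring and operators.** $x,z,t$ are infinite sequences of variables. $Q_r(x)$ is defined by $\sum_{r\ge0}Q_r(x)u^r=\prod_{i\ge1}\frac{1+x_iu}{1-x_iu}$, $\Gamma=\mathbb Z[Q_1(x),Q_2(x),\ldots]$, and $\mathcal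 R_\infty=\Gamma[t_1,t_2,\ldots,z_1,z_2,\ldots]$. For $i\ge1$, $s_i^z$ is the ring automorphism of $\mathcal R_\infty$ exchanging $z_i,z_{i+1}$ and fixing the other $z_j$, all $t_j$ and all $Q_r(x)$; $s_0^z$ is the ring automorphism fixing all $t_j$ and all $z_j$ with $j\ge2$, with $s_0^z(z_1)=-z_1$ and $\sum_r s_0^z(Q_r(x))u^r=\frac{1+z_1u}{1-z_1u}\prod_{i\ge1}\frac{1+x_iu}{1-x_iu}$. Let $\omega$ be the ring automorphism with $\omega(t_i)=-z_i$, $\omega(z_i)=-t_i$, $\omega(Q_r(x))=Q_r(x)$, and put $s_i^t=\omega s_i^z\omega$ $(i\ge0)$. Put $\alpha_0=2t_1$, $\alpha_i=t_{i+1}-t_i$ $(i\ge1)$, and $\partial_if=\frac{f-s_i^zf}{\omega(\alpha_i)}$, $\delta_if=\frac{f-s_i^tf}{\alpha_i}$. **Double Schubert polynomials.** $\{\mathfrak C_w=\mathfrak C_w(z,t;x)\mid w\in W_\infty\}$ is the unique $\mathbb Z[t]$-basis of $\mathcal R_\infty$ such that for all $i\ge0$: $\partial_i\mathfrak C_w=\mathfrak C_{ws_i}$ if $\ell(ws_i)<\ell(w)$ and $0$ otherwise; $\delta_i\mathfrak C_w=\mathfrak C_{s_iw}$ if $\ell(s_iw)<\ell(w)$ and $0$ otherwise; and $\mathfrak C_w$ has no constant term except $\mathfrak C_e=1$. **$k$-strict partitions.** A partition is $k$-strict if no part greater than $k$ is repeated. $\mathcal P_n^{(k)}$ is the set of $k$-strict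 partitions with Young diagram inside the $(n-k)\times(n+k)$ rectangle; $\lambda\in\mathcal P_n^{(k)}$ is written $(\lambda_1,\ldots,\lambda_{n-k})$ with zeros allowed. $W_\infty^{(k)}=\{w\in W_\infty\mid \ell(w)<\ell(ws_i)\ \forall i\ge0,\ i\ne k\}$ and $W_n^{(k)}=W_n\cap W_\infty^{(k)}$. Elements of $W_n^{(k)}$ have one-line form $w=v_1\cdots v_k|\overline{\zeta_1}\cdots\overline{\zeta_s}u_1\cdots u_{n-k-s}$ with $0<v_1<\cdots<v_k$, $\zeta_1>\cdots>\zeta_s>0$, $0<u_1<\cdots<u_{n-k-s}$. There is a bijection $\mathcal P_n^{(k)}\to W_n^{(k)}$, $\lambda\mapsto w_\lambda^{(k)}$, whose inverse sends $w$ to $\lambda$ with $\lambda_i=\zeta_i+k$ for $1\le i\le s$ and $\lambda_{s+j}=\#\{p\mid v_p>u_j\}$ for $1\le j\le n-k-s$. For $w=w_\lambda^{(k)}$, the characteristic index is $\chi=(\zeta_1-1,\ldots,\zeta_s-1,-u_1,\ldots,-u_{n-k-s})\in\mathbb Z^{n-k}$, and $D(\lambda)=\{(i,j)\mid 1\le i<j\le n-k,\ \chi_i+\chi_j<0\}$. **Theta polynomials.** For $l\ge0$, $\sum_{r\ge0}{}_k\vartheta_r^{(l)}u^r=\prod_{i\ge1}\frac{1+x_iu}{1-x_iu}\prod_{i=1}^k(1+z_iu)\prod_{i=1}^l(1-t_iu)$ and $\sum_{r\ge0}{}_k\vartheta_r^{(-l)}u^r=\prod_{i\ge1}\frac{1+x_iu}{1-x_iu}\prod_{i=1}^k(1+z_iu)\prod_{i=1}^l\frac1{1+t_iu}$;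 ${}_k\vartheta_r^{(l)}=0$ for $r<0$. **Multi Schur-Pfaffian.** For sequences of variables $c^{(i)}=(c_r^{(i)})_{r\in\mathbb Z}$, $1\le i\le m$: $\mathrm{Pf}[c_r^{(1)}]=c_r^{(1)}$; $\mathrm{Pf}[c_{r_1}^{(1)}c_{r_2}^{(2)}]=c_{r_1}^{(1)}c_{r_2}^{(2)}+2\sum_{s=1}^{r_2}(-1)^sc_{r_1+s}^{(1)}c_{r_2-s}^{(2)}$; for even $m\ge4$, $\mathrm{Pf}[c_{r_1}^{(1)}\cdots c_{r_m}^{(m)}]=\sum_{s=2}^m(-1)^s\mathrm{Pf}[c_{r_1}^{(1)}c_{r_s}^{(s)}]\,\mathrm{Pf}[c_{r_2}^{(2)}\cdots\widehat{c_{r_s}^{(s)}}\cdots c_{r_m}^{(m)}]$; for odd $m\ge3$, $\mathrm{Pf}[c_{r_1}^{(1)}\cdots c_{r_m}^{(m)}]=\sum_{s=1}^m(-1)^{s-1}c_{r_s}^{(s)}\mathrm{Pf}[c_{r_1}^{(1)}\cdots\widehat{c_{r_s}^{(s)}}\cdots c_{r_m}^{(m)}]$. The empty Pfaffian ($m=0$) is $1$. $\mathrm{Pf}[{}_k\vartheta_{r_1}^{(l_1)}\cdots{}_k\vartheta_{r_m}^{(l_m)}]$ is obtained by first expanding $\mathrm{Pf}[c_{r_1}^{(1)}\cdots c_{r_m}^{(m)}]$ and then substituting ${}_k\vartheta_s^{(l_i)}$ for $c_s^{(i)}$ for all $i$ and all $s\in\mathbb Z$. *)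

theory Defs
  imports
    "HOL-Library.Multiset" "HOL-Library.FuncSet"
    "HOL-Computational_Algebra.Formal_Power_Series"
    "HOL-Combinatorics.Permutations"
begin

section \<open>Formal power series in an arbitrary set of variables\<close>

text \<open>A monomial in the variables \<open>'v\<close> is a multiset of variables, so that the product of monomials
  is the sum of multisets. A power series is an arbitrary integer-valued function on monomials.\<close>

typedef 'v mps = "UNIV :: ('v multiset \<Rightarrow> int) set"
  morphisms mps_coeff Abs_mps by simp

lemma coeff_Abs_mps [simp]: "mps_coeff (Abs_mps f) m = f m"
  by (simp add: Abs_mps_inverse)

lemma mps_eqI: "(\<And>m. mps_coeff f m = mps_coeff g m) \<Longrightarrow> f = g"
  by (simp add: mps_coeff_inject[symmetric] fun_eq_iff)

lemma finite_fixed_size: "finite A \<Longrightarrow> finite {m. set_mset m \<subseteq> A \<and> size m = n}"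
proof -
  assume "finite A"
  have "{m. set_mset m \<subseteq> A \<and> size m = n} \<subseteq> mset ` {xs. set xs \<subseteq> A \<and> length xs = n}"
  proof
    fix m assume m: "m \<in> {m. set_mset m \<subseteq> A \<and> size m = n}"
    obtain xs where "mset xs = m" using ex_mset by blast
    with m show "m \<in> mset ` {xs. set xs \<subseteq> A \<and> length xs = n}" by (force simp: image_iff)
  qed
  thus ?thesis using finite_lists_length_eq[OF \<open>finite A\<close>] finite_surj by blast
qed

lemma finite_submultisets: "finite {a. a \<subseteq># (m :: 'v multiset)}"
proof -
  have "{a. a \<subseteq># m} \<subseteq> (\<Union>n\<le>size m. {a. set_mset a \<subseteq> set_mset m \<and> size a = n})"
    by (auto dest: set_mset_mono size_mset_mono)
  moreover have "finite \<dots>" by (intro finite_UN_I finite_fixed_size) simp_all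
  ultimately show ?thesis using finite_subset by blast
qed

lemma finite_splits: "finite {(a, b). a + b = (m :: 'v multiset)}"
proof -
  have "{(a, b). a + b = m} \<subseteq> {a. a \<subseteq># m} \<times> {a. a \<subseteq># m}"
    by auto
  thus ?thesis by (rule finite_subset) (intro finite_cartesian_product finite_submultisets)
qed

instantiation mps :: (type) comm_ring_1
begin

definition "0 = Abs_mps (\<lambda>_. 0)"
definition "1 = Abs_mps (\<lambda>m. if m = {#} then 1 else 0)"
definition "f + g = Abs_mps (\<lambda>m. mps_coeff f m + mps_coeff g m)"
definition "- f = Abs_mps (\<lambda>m. - mps_coeff f m)"
definition "f - g = Abs_mps (\<lambda>m. mps_coeff f m - mps_coeff g m)" for f g :: "'a mps"
definition "f * g = Abs_mps (\<lambda>m. \<Sum>(a, b) \<in> {(a, b). a + b = m}. mps_coeff f a * mps_coeff g b)"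

instance
proof
  fix f g h :: "'a mps"
  show "f * g * h = f * (g * h)"
  proof (rule mps_eqI)
    fix m :: "'a multiset"
    have "mps_coeff (f * g * h) m =
      (\<Sum>p\<in>{(a, b). a + b = m}. \<Sum>q\<in>{(a, b). a + b = fst p}. mps_coeff f (fst q) * mps_coeff g (snd q) * mps_coeff h (snd p))"
      by (simp add: times_mps_def case_prod_beta sum_distrib_right)
    also have "\<dots> = (\<Sum>(p, q)\<in>Sigma {(a, b). a + b = m} (\<lambda>p. {(a, b). a + b = fst p}). mps_coeff f (fst q) * mps_coeff g (snd q) * mps_coeff h (snd p))"
      by (rule sum.Sigma) (auto intro: finite_splits)
    also have "\<dots> = (\<Sum>(p, q)\<in>Sigma {(a, b). a + b = m} (\<lambda>p. {(a, b). a + b = snd p}). mps_coeff f (fst p) * (mps_coeff g (fst q) * mps_coeff h (snd q)))"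
      by (rule sum.reindex_bij_witness[where
            i = "\<lambda>(p, q). ((fst p + fst q, snd q), (fst p, fst q))" and
            j = "\<lambda>(p, q). ((fst q, snd q + snd p), (snd q, snd p))"])
         (auto simp: algebra_simps)
    also have "\<dots> = (\<Sum>p\<in>{(a, b). a + b = m}. \<Sum>q\<in>{(a, b). a + b = snd p}. mps_coeff f (fst p) * (mps_coeff g (fst q) * mps_coeff h (snd q)))"
      by (rule sum.Sigma[symmetric]) (auto intro: finite_splits)
    also have "\<dots> = mps_coeff (f * (g * h)) m"
      by (simp add: times_mps_def case_prod_beta sum_distrib_left)
    finally show "mps_coeff (f * g * h) m = mps_coeff (f * (g * h)) m" .
  qed
  show "f * g = g * f"
  proof (rule mps_eqI)
    fix m :: "'a multiset"
    show "mps_coeff (f * g) m = mps_coeff (g * f) m"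
      unfolding times_mps_def coeff_Abs_mps
      by (rule sum.reindex_bij_witness[where i = prod.swap and j = prod.swap])
         (auto simp: ac_simps)
  qed
  show "1 * f = f"
  proof (rule mps_eqI)
    fix m :: "'a multiset"
    have "mps_coeff (1 * f) m = (\<Sum>p\<in>{(a, b). a + b = m}. if p = ({#}, m) then mps_coeff f m else 0)"
      unfolding times_mps_def one_mps_def coeff_Abs_mps
      by (rule sum.cong) (auto split: if_splits)
    thus "mps_coeff (1 * f) m = mps_coeff f m" by (simp add: finite_splits)
  qed
  show "(f + g) * h = f * h + g * h"
    by (rule mps_eqI)
       (simp add: times_mps_def plus_mps_def case_prod_beta sum.distrib algebra_simps)
  show "(0 :: 'a mps) \<noteq> 1"
    by (auto simp: zero_mps_def one_mps_def Abs_mps_inject dest: fun_cong[of _ _ "{#}"])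
qed (auto intro!: mps_eqI simp: plus_mps_def zero_mps_def uminus_mps_def minus_mps_def)

end

definition Var :: "'v \<Rightarrow> 'v mps"
  where "Var v = Abs_mps (\<lambda>m. if m = {#v#} then 1 else 0)"

lemma coeff_simps [simp]:
  "mps_coeff 0 m = 0" "mps_coeff 1 m = (if m = {#} then 1 else 0)"
  "mps_coeff (f + g) m = mps_coeff f m + mps_coeff g m" "mps_coeff (- f) m = - mps_coeff f m"
  "mps_coeff (f - g) m = mps_coeff f m - mps_coeff g m"
  by (simp_all add: zero_mps_def one_mps_def plus_mps_def uminus_mps_def minus_mps_def)

lemma coeff_times: "mps_coeff (f * g) m = (\<Sum>(a, b) \<in> {(a, b). a + b = m}. mps_coeff f a * mps_coeff g b)"
  by (simp add: times_mps_def)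

lemma coeff_sum: "mps_coeff (sum F A) m = (\<Sum>i\<in>A. mps_coeff (F i) m)"
  by (induction A rule: infinite_finite_induct) auto

lemma coeff_Var_times: "mps_coeff (Var v * g) m = (if v \<in># m then mps_coeff g (m - {#v#}) else 0)"
proof -
  have "mps_coeff (Var v * g) m = (\<Sum>p\<in>{(a, b). a + b = m}. if p = ({#v#}, m - {#v#}) then mps_coeff g (m - {#v#}) else 0)"
    unfolding coeff_times Var_def coeff_Abs_mps by (rule sum.cong) (auto split: if_splits)
  also have "\<dots> = (if v \<in># m then mps_coeff g (m - {#v#}) else 0)"
    by (simp add: finite_splits)
  finally show ?thesis .
qed

text \<open>Coefficientwise (eventually constant) convergence of a sequence of power series.\<close>

definition converges_to :: "(nat \<Rightarrow> 'v mps) \<Rightarrow> 'v mps \<Rightarrow> bool"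
  where "converges_to s f \<longleftrightarrow> (\<forall>m. \<forall>\<^sub>F N in sequentially. mps_coeff (s N) m = mps_coeff f m)"

lemma converges_to_unique: "converges_to s f \<Longrightarrow> converges_to s g \<Longrightarrow> f = g"
proof (rule mps_eqI)
  fix m assume "converges_to s f" "converges_to s g"
  hence "\<forall>\<^sub>F N in sequentially. mps_coeff (s N) m = mps_coeff f m \<and> mps_coeff (s N) m = mps_coeff g m"
    by (auto simp: converges_to_def intro: eventually_conj)
  then obtain N where "mps_coeff (s N) m = mps_coeff f m \<and> mps_coeff (s N) m = mps_coeff g m"
    using eventually_happens'[OF sequentially_bot] by blast
  thus "mps_coeff f m = mps_coeff g m" by auto
qed

lemma converges_to_const: "converges_to (\<lambda>_. f) f"
  by (simp add: converges_to_def)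

lemma converges_to_mult:
  assumes "converges_to s f" "converges_to r g"
  shows "converges_to (\<lambda>N. s N * r N) (f * g)"
  unfolding converges_to_def
proof
  fix m
  have "\<forall>\<^sub>F N in sequentially. \<forall>p\<in>{(a, b). a + b = m}.
    mps_coeff (s N) (fst p) * mps_coeff (r N) (snd p) = mps_coeff f (fst p) * mps_coeff g (snd p)"
  proof (rule eventually_ball_finite[OF finite_splits], rule ballI)
    fix p
    show "\<forall>\<^sub>F N in sequentially. mps_coeff (s N) (fst p) * mps_coeff (r N) (snd p) = mps_coeff f (fst p) * mps_coeff g (snd p)"
    proof -
      have "\<forall>\<^sub>F N in sequentially. mps_coeff (s N) (fst p) = mps_coeff f (fst p)"
           "\<forall>\<^sub>F N in sequentially. mps_coeff (r N) (snd p) = mps_coeff g (snd p)"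
        using assms by (auto simp: converges_to_def)
      thus ?thesis by eventually_elim simp
    qed
  qed
  thus "\<forall>\<^sub>F N in sequentially. mps_coeff (s N * r N) m = mps_coeff (f * g) m"
    unfolding coeff_times case_prod_beta
    by eventually_elim (rule sum.cong, auto)
qed

lemma converges_to_sum:
  assumes "finite A" "\<And>i. i \<in> A \<Longrightarrow> converges_to (s i) (f i)"
  shows "converges_to (\<lambda>N. \<Sum>i\<in>A. s i N) (\<Sum>i\<in>A. f i)"
  unfolding converges_to_def
proof
  fix m
  have "\<forall>\<^sub>F N in sequentially. \<forall>i\<in>A. mps_coeff (s i N) m = mps_coeff (f i) m"
    using assms by (intro eventually_ball_finite) (auto simp: converges_to_def)
  thus "\<forall>\<^sub>F N in sequentially. mps_coeff (\<Sum>i\<in>A. s i N) m = mps_coeff (\<Sum>i\<in>A. f i) m"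
    unfolding coeff_sum by eventually_elim (rule sum.cong, auto)
qed

text \<open>\<open>mps_subst \<sigma> \<epsilon>\<close> substitutes \<open>\<epsilon> v * Var (\<sigma> v)\<close> for each variable \<open>v\<close>; this makes sense on
  power series if the fibres of \<open>\<sigma>\<close> are finite.\<close>

definition mps_subst :: "('v \<Rightarrow> 'v) \<Rightarrow> ('v \<Rightarrow> int) \<Rightarrow> 'v mps \<Rightarrow> 'v mps"
  where "mps_subst \<sigma> \<epsilon> f =
    Abs_mps (\<lambda>m. \<Sum>m' | image_mset \<sigma> m' = m. prod_mset (image_mset \<epsilon> m') * mps_coeff f m')"

definition finite_fibres :: "('v \<Rightarrow> 'v) \<Rightarrow> bool"
  where "finite_fibres \<sigma> \<longleftrightarrow> (\<forall>v. finite {u. \<sigma> u = v})"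

lemma finite_image_mset_fibre:
  assumes "finite_fibres \<sigma>"
  shows "finite {m'. image_mset \<sigma> m' = m}"
proof -
  have "{m'. image_mset \<sigma> m' = m} \<subseteq> {m'. set_mset m' \<subseteq> (\<Union>v\<in>set_mset m. {u. \<sigma> u = v}) \<and> size m' = size m}"
    by auto
  moreover have "finite \<dots>"
    using assms by (intro finite_fixed_size) (auto simp: finite_fibres_def)
  ultimately show ?thesis using finite_subset by blast
qed

context
  fixes \<sigma> :: "'v \<Rightarrow> 'v" and \<epsilon> :: "'v \<Rightarrow> int"
  assumes fin: "finite_fibres \<sigma>"
begin

lemma subst_mult: "mps_subst \<sigma> \<epsilon> (f * g) = mps_subst \<sigma> \<epsilon> f * mps_subst \<sigma> \<epsilon> g"
proof (rule mps_eqI)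
  fix m
  let ?e = "\<lambda>a. prod_mset (image_mset \<epsilon> a)"
  have "mps_coeff (mps_subst \<sigma> \<epsilon> (f * g)) m =
    (\<Sum>m'\<in>{m'. image_mset \<sigma> m' = m}. \<Sum>p\<in>{(a, b). a + b = m'}. (?e (fst p) * mps_coeff f (fst p)) * (?e (snd p) * mps_coeff g (snd p)))"
    unfolding mps_subst_def coeff_Abs_mps coeff_times case_prod_beta sum_distrib_left
    by (intro sum.cong) auto
  also have "\<dots> = (\<Sum>(m', p)\<in>Sigma {m'. image_mset \<sigma> m' = m} (\<lambda>m'. {(a, b). a + b = m'}).
      (?e (fst p) * mps_coeff f (fst p)) * (?e (snd p) * mps_coeff g (snd p)))"
    by (rule sum.Sigma) (auto intro: finite_splits finite_image_mset_fibre[OF fin])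
  also have "\<dots> = (\<Sum>(q, p)\<in>Sigma {(a, b). a + b = m} (\<lambda>q. {a. image_mset \<sigma> a = fst q} \<times> {b. image_mset \<sigma> b = snd q}).
      (?e (fst p) * mps_coeff f (fst p)) * (?e (snd p) * mps_coeff g (snd p)))"
    by (rule sum.reindex_bij_witness[where
            i = "\<lambda>(q, p). (fst p + snd p, p)" and
            j = "\<lambda>(m', p). ((image_mset \<sigma> (fst p), image_mset \<sigma> (snd p)), p)"]) auto
  also have "\<dots> = (\<Sum>q\<in>{(a, b). a + b = m}. \<Sum>p\<in>{a. image_mset \<sigma> a = fst q} \<times> {b. image_mset \<sigma> b = snd q}.
      (?e (fst p) * mps_coeff f (fst p)) * (?e (snd p) * mps_coeff g (snd p)))"
    by (rule sum.Sigma[symmetric]) (auto intro: finite_splits finite_image_mset_fibre[OF fin])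
  also have "\<dots> = mps_coeff (mps_subst \<sigma> \<epsilon> f * mps_subst \<sigma> \<epsilon> g) m"
    unfolding coeff_times mps_subst_def coeff_Abs_mps case_prod_beta sum_product sum.cartesian_product
    by simp
  finally show "mps_coeff (mps_subst \<sigma> \<epsilon> (f * g)) m = mps_coeff (mps_subst \<sigma> \<epsilon> f * mps_subst \<sigma> \<epsilon> g) m" .
qed

lemma subst_add: "mps_subst \<sigma> \<epsilon> (f + g) = mps_subst \<sigma> \<epsilon> f + mps_subst \<sigma> \<epsilon> g"
  by (rule mps_eqI) (simp add: mps_subst_def algebra_simps sum.distrib)

lemma subst_one: "mps_subst \<sigma> \<epsilon> 1 = 1"
proof (rule mps_eqI)
  fix m :: "'v multiset"
  have "mps_coeff (mps_subst \<sigma> \<epsilon> 1) m = (\<Sum>m'\<in>{m'. image_mset \<sigma> m' = m}. if m' = {#} then 1 else 0)"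
    unfolding mps_subst_def coeff_Abs_mps by (rule sum.cong) auto
  thus "mps_coeff (mps_subst \<sigma> \<epsilon> 1) m = mps_coeff 1 m" by (auto simp: finite_image_mset_fibre[OF fin])
qed

lemma subst_Var: "mps_subst \<sigma> \<epsilon> (Var v) = of_int (\<epsilon> v) * Var (\<sigma> v)"
proof (rule mps_eqI)
  fix m :: "'v multiset"
  have of_int: "mps_coeff (of_int c * f) m = c * mps_coeff f m" for c f
    by (induction c rule: int_induct[where k = 0]) (simp_all add: algebra_simps)
  have "mps_coeff (mps_subst \<sigma> \<epsilon> (Var v)) m = (\<Sum>m'\<in>{m'. image_mset \<sigma> m' = m}. if m' = {#v#} then \<epsilon> v else 0)"
    unfolding mps_subst_def coeff_Abs_mps Var_def by (rule sum.cong) auto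
  thus "mps_coeff (mps_subst \<sigma> \<epsilon> (Var v)) m = mps_coeff (of_int (\<epsilon> v) * Var (\<sigma> v)) m"
    by (auto simp: finite_image_mset_fibre[OF fin] of_int Var_def)
qed

lemma subst_converges_to:
  assumes "converges_to s f"
  shows "converges_to (\<lambda>N. mps_subst \<sigma> \<epsilon> (s N)) (mps_subst \<sigma> \<epsilon> f)"
  unfolding converges_to_def
proof
  fix m
  have "\<forall>\<^sub>F N in sequentially. \<forall>m'\<in>{m'. image_mset \<sigma> m' = m}. mps_coeff (s N) m' = mps_coeff f m'"
    using assms by (intro eventually_ball_finite finite_image_mset_fibre[OF fin]) (auto simp: converges_to_def)
  thus "\<forall>\<^sub>F N in sequentially. mps_coeff (mps_subst \<sigma> \<epsilon> (s N)) m = mps_coeff (mps_subst \<sigma> \<epsilon> f) m"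
    unfolding mps_subst_def coeff_Abs_mps by eventually_elim (rule sum.cong, auto)
qed

end


section \<open>The ring \<open>\<R>\<^sub>\<infinity>\<close>\<close>

text \<open>Variables are numbered from 1; \<open>VX 0\<close>, \<open>VZ 0\<close>, \<open>VT 0\<close> do not occur in the ring.\<close>

datatype var = VX nat | VZ nat | VT nat

abbreviation xv :: "nat \<Rightarrow> var mps" where "xv i \<equiv> Var (VX i)"
abbreviation zv :: "nat \<Rightarrow> var mps" where "zv i \<equiv> Var (VZ i)"
abbreviation tv :: "nat \<Rightarrow> var mps" where "tv i \<equiv> Var (VT i)"

text \<open>\<open>lin_fps a\<close> is \<open>1 + a u\<close> and \<open>geom_fps a\<close> is \<open>1 / (1 - a u)\<close>, where \<open>u = fps_X\<close>.\<close>

definition lin_fps :: "'a::comm_ring_1 \<Rightarrow> 'a fps"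
  where "lin_fps a = 1 + fps_const a * fps_X"

definition geom_fps :: "'a::comm_ring_1 \<Rightarrow> 'a fps"
  where "geom_fps a = Abs_fps (\<lambda>j. a ^ j)"

lemma fps_nth_lin: "fps_nth (lin_fps a) n = (if n = 0 then 1 else if n = 1 then a else 0)"
  by (cases n) (auto simp: lin_fps_def fps_X_def)

lemma geom_eq: "geom_fps a = 1 + fps_const a * (fps_X * geom_fps a)"
proof (rule fps_ext)
  fix n show "fps_nth (geom_fps a) n = fps_nth (1 + fps_const a * (fps_X * geom_fps a)) n"
    by (cases n) (simp_all add: geom_fps_def)
qed

lemma lin_minus_geom: "lin_fps (- a) * geom_fps a = 1"
proof -
  have "lin_fps (- a) * geom_fps a = geom_fps a - fps_const a * (fps_X * geom_fps a)"
    by (simp add: lin_fps_def algebra_simps flip: fps_const_neg)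
  thus ?thesis using geom_eq[of a] by (metis add_diff_cancel_right')
qed

lemma lin_geom: "lin_fps a * geom_fps a = 1 + fps_const a * (fps_X * geom_fps a + fps_X * geom_fps a)"
  using geom_eq[of a] by (simp add: lin_fps_def algebra_simps)

definition Q_trunc :: "nat \<Rightarrow> var mps fps"
  where "Q_trunc N = (\<Prod>i=1..N. lin_fps (xv i) * geom_fps (xv i))"

text \<open>The infinite product over all \<open>i \<ge> 1\<close>, as the coefficientwise limit of the finite products; the
  limit exists by \<open>Q_converges\<close>.\<close>

definition Q_gen :: "var mps fps"
  where "Q_gen = Abs_fps (\<lambda>r. THE q. converges_to (\<lambda>N. fps_nth (Q_trunc N) r) q)"

definition Qr :: "nat \<Rightarrow> var mps"
  where "Qr r = fps_nth Q_gen r"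

lemma Q_trunc_Suc: "Q_trunc (Suc N) = Q_trunc N * (lin_fps (xv (Suc N)) * geom_fps (xv (Suc N)))"
  by (simp add: Q_trunc_def)

lemma coeff_Q_trunc_Suc:
  assumes "VX (Suc N) \<notin># m"
  shows "mps_coeff (fps_nth (Q_trunc (Suc N)) r) m = mps_coeff (fps_nth (Q_trunc N) r) m"
proof -
  let ?G = "fps_X * geom_fps (xv (Suc N)) + fps_X * geom_fps (xv (Suc N))"
  have "Q_trunc (Suc N) = Q_trunc N + fps_const (xv (Suc N)) * (Q_trunc N * ?G)"
    unfolding Q_trunc_Suc lin_geom by (simp add: algebra_simps)
  hence "fps_nth (Q_trunc (Suc N)) r = fps_nth (Q_trunc N) r + xv (Suc N) * fps_nth (Q_trunc N * ?G) r"
    by simp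
  thus ?thesis using assms by (simp add: coeff_Var_times)
qed

lemma Q_converges: "converges_to (\<lambda>N. fps_nth (Q_trunc N) r) (Qr r)"
proof -
  have "\<exists>B. \<forall>N\<ge>B. mps_coeff (fps_nth (Q_trunc N) r) m = mps_coeff (fps_nth (Q_trunc B) r) m" for m
  proof -
    have "finite (VX -` set_mset m)" by (intro finite_vimageI) (auto simp: inj_def)
    then obtain B where B: "\<And>i. VX i \<in># m \<Longrightarrow> i < B"
      by (auto simp: finite_nat_set_iff_bounded)
    have "mps_coeff (fps_nth (Q_trunc N) r) m = mps_coeff (fps_nth (Q_trunc B) r) m" if "N \<ge> B" for N
      using that
    proof (induction N rule: dec_induct)
      case (step N)
      have "VX (Suc N) \<notin># m" using B[of "Suc N"] step by auto
      thus ?case using step by (simp add: coeff_Q_trunc_Suc)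
    qed simp
    thus ?thesis by blast
  qed
  then obtain B where B: "\<And>m N. N \<ge> B m \<Longrightarrow> mps_coeff (fps_nth (Q_trunc N) r) m = mps_coeff (fps_nth (Q_trunc (B m)) r) m"
    by metis
  have "converges_to (\<lambda>N. fps_nth (Q_trunc N) r) (Abs_mps (\<lambda>m. mps_coeff (fps_nth (Q_trunc (B m)) r) m))"
    unfolding converges_to_def eventually_sequentially coeff_Abs_mps using B by blast
  moreover from this have "Qr r = Abs_mps (\<lambda>m. mps_coeff (fps_nth (Q_trunc (B m)) r) m)"
    unfolding Qr_def Q_gen_def fps_nth_Abs_fps
    by (intro the_equality) (auto dest: converges_to_unique)
  ultimately show ?thesis by simp
qed

lemma Q_trunc_0: "fps_nth (Q_trunc N) 0 = 1"
  by (induction N) (simp_all add: Q_trunc_Suc lin_fps_def geom_fps_def, simp add: Q_trunc_def)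

lemma Q_0: "Qr 0 = 1"
  using Q_converges[of 0] converges_to_const[of 1] converges_to_unique by (simp add: Q_trunc_0)

inductive_set subring_gen :: "'a::comm_ring_1 set \<Rightarrow> 'a set" for S where
  base: "f \<in> S \<Longrightarrow> f \<in> subring_gen S"
| one: "1 \<in> subring_gen S"
| uminus: "f \<in> subring_gen S \<Longrightarrow> - f \<in> subring_gen S"
| add: "f \<in> subring_gen S \<Longrightarrow> g \<in> subring_gen S \<Longrightarrow> f + g \<in> subring_gen S"
| mult: "f \<in> subring_gen S \<Longrightarrow> g \<in> subring_gen S \<Longrightarrow> f * g \<in> subring_gen S"

definition Gamma :: "var mps set"
  where "Gamma = subring_gen {Qr r | r. r \<ge> 1}"

definition Rinf :: "var mps set"
  where "Rinf = subring_gen (Gamma \<union> {tv i | i. i \<ge> 1} \<union> {zv i | i. i \<ge> 1})"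

definition Zt :: "var mps set"
  where "Zt = subring_gen {tv i | i. i \<ge> 1}"

lemma subring_gen_zero: "0 \<in> subring_gen S"
  using subring_gen.add[OF subring_gen.one subring_gen.uminus[OF subring_gen.one]] by simp

lemma subring_gen_diff: "f \<in> subring_gen S \<Longrightarrow> g \<in> subring_gen S \<Longrightarrow> f - g \<in> subring_gen S"
  using subring_gen.add[OF _ subring_gen.uminus] by fastforce

lemma subring_gen_sum: "(\<And>i. i \<in> A \<Longrightarrow> F i \<in> subring_gen S) \<Longrightarrow> sum F A \<in> subring_gen S"
  by (induction A rule: infinite_finite_induct) (auto intro: subring_gen_zero subring_gen.add)

lemma subring_gen_power: "f \<in> subring_gen S \<Longrightarrow> f ^ n \<in> subring_gen S"
  by (induction n) (auto intro: subring_gen.one subring_gen.mult)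

lemma Rinf_ops:
  "1 \<in> Rinf" "0 \<in> Rinf" "f \<in> Rinf \<Longrightarrow> - f \<in> Rinf"
  "f \<in> Rinf \<Longrightarrow> g \<in> Rinf \<Longrightarrow> f + g \<in> Rinf" "f \<in> Rinf \<Longrightarrow> g \<in> Rinf \<Longrightarrow> f - g \<in> Rinf"
  "f \<in> Rinf \<Longrightarrow> g \<in> Rinf \<Longrightarrow> f * g \<in> Rinf" "f \<in> Rinf \<Longrightarrow> f ^ n \<in> Rinf"
  "(\<And>i. i \<in> A \<Longrightarrow> F i \<in> Rinf) \<Longrightarrow> sum F A \<in> Rinf"
  unfolding Rinf_def
  by (auto intro: subring_gen.intros subring_gen_zero subring_gen_diff subring_gen_power subring_gen_sum)

lemma Rinf_gens: "i \<ge> 1 \<Longrightarrow> tv i \<in> Rinf" "i \<ge> 1 \<Longrightarrow> zv i \<in> Rinf" "Qr r \<in> Rinf"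
proof -
  show "Qr r \<in> Rinf"
    by (cases "r = 0") (auto simp: Q_0 Rinf_def Gamma_def intro!: subring_gen.one subring_gen.base)
qed (auto simp: Rinf_def intro!: subring_gen.base)

lemma Rinf_induct [consumes 1, case_names t z Qr one uminus add mult]:
  assumes "f \<in> Rinf"
    and t: "\<And>i. i \<ge> 1 \<Longrightarrow> P (tv i)" and z: "\<And>i. i \<ge> 1 \<Longrightarrow> P (zv i)" and q: "\<And>r. r \<ge> 1 \<Longrightarrow> P (Qr r)"
    and one: "P 1" and um: "\<And>f. f \<in> Rinf \<Longrightarrow> P f \<Longrightarrow> P (- f)"
    and ad: "\<And>f g. f \<in> Rinf \<Longrightarrow> g \<in> Rinf \<Longrightarrow> P f \<Longrightarrow> P g \<Longrightarrow> P (f + g)"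
    and mu: "\<And>f g. f \<in> Rinf \<Longrightarrow> g \<in> Rinf \<Longrightarrow> P f \<Longrightarrow> P g \<Longrightarrow> P (f * g)"
  shows "P f"
proof -
  have G: "g \<in> Rinf \<and> P g" if "g \<in> Gamma" for g
    using that unfolding Gamma_def
    by induction (auto intro: Rinf_ops Rinf_gens q one um ad mu)
  show ?thesis using assms(1)[unfolded Rinf_def]
  proof induction
    case (base f) thus ?case using G t z by auto
  qed (use one um ad mu in \<open>auto simp: Rinf_def\<close>)
qed

definition ring_aut :: "'a::comm_ring_1 set \<Rightarrow> ('a \<Rightarrow> 'a) set"
  where "ring_aut R = {\<phi> \<in> extensional R. bij_betw \<phi> R R \<and> \<phi> 1 = 1 \<and>
    (\<forall>f\<in>R. \<forall>g\<in>R. \<phi> (f + g) = \<phi> f + \<phi> g \<and> \<phi> (f * g) = \<phi> f * \<phi> g)}"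

text \<open>The automorphisms are described by their values on the generators, as usual; that exactly one
  automorphism fits each description is \<open>sz_0_aut\<close>, \<open>sz_Suc_aut\<close>, \<open>omega_aut\<close> with \<open>ring_aut_unique\<close>.\<close>

definition sz :: "nat \<Rightarrow> var mps \<Rightarrow> var mps"
  where "sz i = (if i = 0
    then (THE \<phi>. \<phi> \<in> ring_aut Rinf \<and> (\<forall>j\<ge>1. \<phi> (tv j) = tv j) \<and> (\<forall>j\<ge>2. \<phi> (zv j) = zv j) \<and>
      \<phi> (zv 1) = - zv 1 \<and> Abs_fps (\<lambda>r. \<phi> (Qr r)) = lin_fps (zv 1) * geom_fps (zv 1) * Q_gen)
    else (THE \<phi>. \<phi> \<in> ring_aut Rinf \<and> (\<forall>j\<ge>1. \<phi> (tv j) = tv j) \<and>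
      (\<forall>j\<ge>1. \<phi> (zv j) = zv (transpose i (i + 1) j)) \<and> (\<forall>r. \<phi> (Qr r) = Qr r)))"

definition omega :: "var mps \<Rightarrow> var mps"
  where "omega = (THE \<phi>. \<phi> \<in> ring_aut Rinf \<and> (\<forall>j\<ge>1. \<phi> (tv j) = - zv j) \<and>
    (\<forall>j\<ge>1. \<phi> (zv j) = - tv j) \<and> (\<forall>r. \<phi> (Qr r) = Qr r))"

definition st :: "nat \<Rightarrow> var mps \<Rightarrow> var mps"
  where "st i f = omega (sz i (omega f))"

definition alpha :: "nat \<Rightarrow> var mps"
  where "alpha i = (if i = 0 then 2 * tv 1 else tv (i + 1) - tv i)"

text \<open>The exact quotient \<open>f / g\<close>. For the divided differences it exists and is unique by
  \<open>del_op_well_defined\<close> and \<open>alpha_nonzerodivisor\<close>.\<close>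

definition Rinf_quot :: "var mps \<Rightarrow> var mps \<Rightarrow> var mps"
  where "Rinf_quot f g = (THE h. h \<in> Rinf \<and> g * h = f)"

definition del_op :: "nat \<Rightarrow> var mps \<Rightarrow> var mps"
  where "del_op i f = Rinf_quot (f - sz i f) (omega (alpha i))"

definition delta_op :: "nat \<Rightarrow> var mps \<Rightarrow> var mps"
  where "delta_op i f = Rinf_quot (f - st i f) (alpha i)"

subsection \<open>The automorphisms are well defined\<close>

lemma ring_aut_Rinf:
  assumes "\<phi> \<in> ring_aut Rinf"
  shows "\<phi> 1 = 1" "f \<in> Rinf \<Longrightarrow> g \<in> Rinf \<Longrightarrow> \<phi> (f + g) = \<phi> f + \<phi> g"
    "f \<in> Rinf \<Longrightarrow> g \<in> Rinf \<Longrightarrow> \<phi> (f * g) = \<phi> f * \<phi> g"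
    "f \<in> Rinf \<Longrightarrow> \<phi> f \<in> Rinf" "f \<in> Rinf \<Longrightarrow> \<phi> (- f) = - \<phi> f"
    "f \<in> Rinf \<Longrightarrow> g \<in> Rinf \<Longrightarrow> \<phi> (f - g) = \<phi> f - \<phi> g"
proof -
  show a: "\<phi> 1 = 1" "f \<in> Rinf \<Longrightarrow> g \<in> Rinf \<Longrightarrow> \<phi> (f + g) = \<phi> f + \<phi> g"
    "f \<in> Rinf \<Longrightarrow> g \<in> Rinf \<Longrightarrow> \<phi> (f * g) = \<phi> f * \<phi> g" for f g
    using assms by (auto simp: ring_aut_def)
  show "f \<in> Rinf \<Longrightarrow> \<phi> f \<in> Rinf"
    using assms by (auto simp: ring_aut_def bij_betw_def)
  have "\<phi> 0 = 0" using a(2)[OF Rinf_ops(2) Rinf_ops(2)] by simp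
  thus b: "f \<in> Rinf \<Longrightarrow> \<phi> (- f) = - \<phi> f" for f
    using a(2)[OF _ Rinf_ops(3), of f f] by (simp add: add_eq_0_iff)
  show "f \<in> Rinf \<Longrightarrow> g \<in> Rinf \<Longrightarrow> \<phi> (f - g) = \<phi> f - \<phi> g"
    using a(2)[OF _ Rinf_ops(3), of f g] b[of g] by simp
qed

lemma ring_aut_unique:
  assumes "\<phi> \<in> ring_aut Rinf" "\<psi> \<in> ring_aut Rinf"
    and "\<And>j. j \<ge> 1 \<Longrightarrow> \<phi> (tv j) = \<psi> (tv j)" "\<And>j. j \<ge> 1 \<Longrightarrow> \<phi> (zv j) = \<psi> (zv j)"
      "\<And>r. \<phi> (Qr r) = \<psi> (Qr r)"
  shows "\<phi> = \<psi>"
proof (rule extensionalityI)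
  show "\<phi> \<in> extensional Rinf" "\<psi> \<in> extensional Rinf" using assms by (auto simp: ring_aut_def)
  show "\<phi> f = \<psi> f" if "f \<in> Rinf" for f
    using that by (induction rule: Rinf_induct)
      (use assms in \<open>simp_all add: ring_aut_Rinf[OF assms(1)] ring_aut_Rinf[OF assms(2)]\<close>)
qed

context
  fixes \<sigma> :: "var \<Rightarrow> var" and \<epsilon> :: "var \<Rightarrow> int"
  assumes fin: "finite_fibres \<sigma>"
begin

abbreviation (input) "subst_fps f \<equiv> Abs_fps (\<lambda>n. mps_subst \<sigma> \<epsilon> (fps_nth f n))"

lemma subst_zero: "mps_subst \<sigma> \<epsilon> 0 = 0"
  using subst_add[OF fin, of \<epsilon> 0 0] by simp

lemma subst_uminus: "mps_subst \<sigma> \<epsilon> (- f) = - mps_subst \<sigma> \<epsilon> f"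
  using subst_add[OF fin, of \<epsilon> f "- f"] by (simp add: subst_zero add_eq_0_iff)

lemma subst_sum: "mps_subst \<sigma> \<epsilon> (sum F A) = (\<Sum>i\<in>A. mps_subst \<sigma> \<epsilon> (F i))"
  by (induction A rule: infinite_finite_induct) (simp_all add: subst_zero subst_add[OF fin])

lemma subst_power: "mps_subst \<sigma> \<epsilon> (f ^ n) = mps_subst \<sigma> \<epsilon> f ^ n"
  by (induction n) (simp_all add: subst_one[OF fin] subst_mult[OF fin])

lemma subst_fps_mult: "subst_fps (f * g) = subst_fps f * subst_fps g"
  by (rule fps_ext) (simp add: fps_mult_nth subst_sum subst_mult[OF fin])

lemma subst_fps_lin: "subst_fps (lin_fps a) = lin_fps (mps_subst \<sigma> \<epsilon> a)"
proof (rule fps_ext)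
  fix n show "fps_nth (subst_fps (lin_fps a)) n = fps_nth (lin_fps (mps_subst \<sigma> \<epsilon> a)) n"
    by (cases n) (simp_all add: lin_fps_def subst_zero subst_one[OF fin] fps_X_def)
qed

lemma subst_fps_geom: "subst_fps (geom_fps a) = geom_fps (mps_subst \<sigma> \<epsilon> a)"
  by (rule fps_ext) (simp add: geom_fps_def subst_power)

lemma subst_fps_one: "subst_fps 1 = 1"
  by (rule fps_ext) (simp add: subst_one[OF fin] subst_zero)

lemma subst_Q:
  assumes "\<And>i. i \<ge> 1 \<Longrightarrow> mps_subst \<sigma> \<epsilon> (xv i) = xv i"
  shows "mps_subst \<sigma> \<epsilon> (Qr r) = Qr r"
proof -
  have eq: "subst_fps (Q_trunc N) = Q_trunc N" for N
  proof (induction N)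
    case 0 thus ?case using subst_fps_one by (simp add: Q_trunc_def)
  next
    case (Suc N) thus ?case
      unfolding Q_trunc_Suc subst_fps_mult subst_fps_lin subst_fps_geom using assms by simp
  qed
  have "mps_subst \<sigma> \<epsilon> (fps_nth (Q_trunc N) r) = fps_nth (Q_trunc N) r" for N
    using arg_cong[OF eq[of N], of "\<lambda>f. fps_nth f r"] by simp
  hence "converges_to (\<lambda>N. fps_nth (Q_trunc N) r) (mps_subst \<sigma> \<epsilon> (Qr r))"
    using subst_converges_to[OF fin Q_converges[of r], of \<epsilon>] by simp
  thus ?thesis using Q_converges converges_to_unique by blast
qed

lemma subst_ring_aut:
  assumes mem: "\<And>i. i \<ge> 1 \<Longrightarrow> mps_subst \<sigma> \<epsilon> (tv i) \<in> Rinf" "\<And>i. i \<ge> 1 \<Longrightarrow> mps_subst \<sigma> \<epsilon> (zv i) \<in> Rinf" "\<And>r. mps_subst \<sigma> \<epsilon> (Qr r) \<in> Rinf"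
    and invol: "\<And>i. i \<ge> 1 \<Longrightarrow> mps_subst \<sigma> \<epsilon> (mps_subst \<sigma> \<epsilon> (tv i)) = tv i" "\<And>i. i \<ge> 1 \<Longrightarrow> mps_subst \<sigma> \<epsilon> (mps_subst \<sigma> \<epsilon> (zv i)) = zv i"
      "\<And>r. mps_subst \<sigma> \<epsilon> (mps_subst \<sigma> \<epsilon> (Qr r)) = Qr r"
  shows "restrict (mps_subst \<sigma> \<epsilon>) Rinf \<in> ring_aut Rinf"
proof -
  have m: "mps_subst \<sigma> \<epsilon> f \<in> Rinf" if "f \<in> Rinf" for f
    using that by (induction rule: Rinf_induct)
      (auto simp: subst_one[OF fin] subst_add[OF fin] subst_mult[OF fin] subst_uminus intro: mem Rinf_ops)
  have i: "mps_subst \<sigma> \<epsilon> (mps_subst \<sigma> \<epsilon> f) = f" if "f \<in> Rinf" for f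
    using that by (induction rule: Rinf_induct)
      (auto simp: subst_one[OF fin] subst_add[OF fin] subst_mult[OF fin] subst_uminus intro: invol)
  have "bij_betw (mps_subst \<sigma> \<epsilon>) Rinf Rinf"
    by (rule bij_betwI[where g = "mps_subst \<sigma> \<epsilon>"]) (auto intro: m i)
  thus ?thesis
    by (auto simp: ring_aut_def bij_betw_restrict_eq Rinf_ops subst_one[OF fin] subst_add[OF fin] subst_mult[OF fin])
qed

end

lemma finite_fibresI:
  assumes "\<And>u. u \<in> F (\<sigma> u)" "\<And>v. finite (F v)"
  shows "finite_fibres \<sigma>"
  unfolding finite_fibres_def
proof
  fix v show "finite {u. \<sigma> u = v}"
    by (rule finite_subset[OF _ assms(2)[of v]]) (use assms(1) in auto)
qed

lemma omega_aut:
  "omega \<in> ring_aut Rinf \<and> (\<forall>j\<ge>1. omega (tv j) = - zv j) \<and>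
   (\<forall>j\<ge>1. omega (zv j) = - tv j) \<and> (\<forall>r. omega (Qr r) = Qr r)"
proof -
  define \<sigma> where "\<sigma> = (\<lambda>v. case v of VX i \<Rightarrow> VX i | VZ i \<Rightarrow> VT i | VT i \<Rightarrow> VZ i)"
  define \<epsilon> :: "var \<Rightarrow> int" where "\<epsilon> = (\<lambda>v. case v of VX i \<Rightarrow> 1 | VZ i \<Rightarrow> -1 | VT i \<Rightarrow> -1)"
  have fin: "finite_fibres \<sigma>"
    by (rule finite_fibresI[where F = "\<lambda>v. {\<sigma> v}"]) (simp_all add: \<sigma>_def split: var.splits)
  have v: "mps_subst \<sigma> \<epsilon> (xv i) = xv i" "mps_subst \<sigma> \<epsilon> (zv i) = - tv i" "mps_subst \<sigma> \<epsilon> (tv i) = - zv i" for i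
    unfolding subst_Var[OF fin] by (simp_all add: \<sigma>_def \<epsilon>_def)
  have q: "mps_subst \<sigma> \<epsilon> (Qr r) = Qr r" for r by (rule subst_Q[OF fin]) (rule v)
  have a: "restrict (mps_subst \<sigma> \<epsilon>) Rinf \<in> ring_aut Rinf"
    by (rule subst_ring_aut[OF fin]) (simp_all add: v q subst_uminus[OF fin] Rinf_ops Rinf_gens)
  show ?thesis unfolding omega_def
  proof (rule theI[of _ "restrict (mps_subst \<sigma> \<epsilon>) Rinf"])
    show "restrict (mps_subst \<sigma> \<epsilon>) Rinf \<in> ring_aut Rinf \<and>
      (\<forall>j\<ge>1. restrict (mps_subst \<sigma> \<epsilon>) Rinf (tv j) = - zv j) \<and>
      (\<forall>j\<ge>1. restrict (mps_subst \<sigma> \<epsilon>) Rinf (zv j) = - tv j) \<and> (\<forall>r. restrict (mps_subst \<sigma> \<epsilon>) Rinf (Qr r) = Qr r)"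
      using a by (simp add: v q Rinf_gens)
  next
    fix \<phi> assume "\<phi> \<in> ring_aut Rinf \<and> (\<forall>j\<ge>1. \<phi> (tv j) = - zv j) \<and> (\<forall>j\<ge>1. \<phi> (zv j) = - tv j) \<and> (\<forall>r. \<phi> (Qr r) = Qr r)"
    thus "\<phi> = restrict (mps_subst \<sigma> \<epsilon>) Rinf"
      by (intro ring_aut_unique a) (simp_all add: v q Rinf_gens)
  qed
qed

lemma sz_Suc_aut:
  assumes "i \<ge> 1"
  shows "sz i \<in> ring_aut Rinf \<and> (\<forall>j\<ge>1. sz i (tv j) = tv j) \<and>
      (\<forall>j\<ge>1. sz i (zv j) = zv (transpose i (i + 1) j)) \<and> (\<forall>r. sz i (Qr r) = Qr r)"
proof -
  define \<sigma> where "\<sigma> = (\<lambda>v. case v of VX j \<Rightarrow> VX j | VZ j \<Rightarrow> VZ (transpose i (i + 1) j) | VT j \<Rightarrow> VT j)"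
  define \<epsilon> :: "var \<Rightarrow> int" where "\<epsilon> = (\<lambda>v. 1)"
  have fin: "finite_fibres \<sigma>"
    by (rule finite_fibresI[where F = "\<lambda>v. {\<sigma> v}"]) (simp_all add: \<sigma>_def split: var.splits)
  have v: "mps_subst \<sigma> \<epsilon> (xv j) = xv j" "mps_subst \<sigma> \<epsilon> (zv j) = zv (transpose i (i + 1) j)" "mps_subst \<sigma> \<epsilon> (tv j) = tv j" for j
    unfolding subst_Var[OF fin] by (simp_all add: \<sigma>_def \<epsilon>_def)
  have q: "mps_subst \<sigma> \<epsilon> (Qr r) = Qr r" for r by (rule subst_Q[OF fin]) (rule v)
  have "transpose i (i + 1) j \<ge> 1" if "j \<ge> 1" for j
    using that assms by (auto simp: transpose_def)
  hence a: "restrict (mps_subst \<sigma> \<epsilon>) Rinf \<in> ring_aut Rinf"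
    by (intro subst_ring_aut[OF fin]) (simp_all add: v q subst_uminus[OF fin] Rinf_ops Rinf_gens)
  have sz: "sz i = (THE \<phi>. \<phi> \<in> ring_aut Rinf \<and> (\<forall>j\<ge>1. \<phi> (tv j) = tv j) \<and>
      (\<forall>j\<ge>1. \<phi> (zv j) = zv (transpose i (i + 1) j)) \<and> (\<forall>r. \<phi> (Qr r) = Qr r))"
    using assms by (simp add: sz_def)
  show ?thesis unfolding sz
  proof (rule theI[of _ "restrict (mps_subst \<sigma> \<epsilon>) Rinf"])
    show "restrict (mps_subst \<sigma> \<epsilon>) Rinf \<in> ring_aut Rinf \<and>
      (\<forall>j\<ge>1. restrict (mps_subst \<sigma> \<epsilon>) Rinf (tv j) = tv j) \<and>
      (\<forall>j\<ge>1. restrict (mps_subst \<sigma> \<epsilon>) Rinf (zv j) = zv (transpose i (i + 1) j)) \<and>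
      (\<forall>r. restrict (mps_subst \<sigma> \<epsilon>) Rinf (Qr r) = Qr r)"
      using a by (simp add: v q Rinf_gens)
  next
    fix \<phi> assume "\<phi> \<in> ring_aut Rinf \<and> (\<forall>j\<ge>1. \<phi> (tv j) = tv j) \<and>
      (\<forall>j\<ge>1. \<phi> (zv j) = zv (transpose i (i + 1) j)) \<and> (\<forall>r. \<phi> (Qr r) = Qr r)"
    thus "\<phi> = restrict (mps_subst \<sigma> \<epsilon>) Rinf"
      by (intro ring_aut_unique a) (simp_all add: v q Rinf_gens)
  qed
qed

lemma fps_coeffs_Rinf_mult:
  "(\<And>n. fps_nth f n \<in> Rinf) \<Longrightarrow> (\<And>n. fps_nth g n \<in> Rinf) \<Longrightarrow> fps_nth (f * g) n \<in> Rinf"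
  by (auto simp: fps_mult_nth intro!: Rinf_ops)

lemma sz_0_aut:
  "sz 0 \<in> ring_aut Rinf \<and> (\<forall>j\<ge>1. sz 0 (tv j) = tv j) \<and> (\<forall>j\<ge>2. sz 0 (zv j) = zv j) \<and>
      sz 0 (zv 1) = - zv 1 \<and> Abs_fps (\<lambda>r. sz 0 (Qr r)) = lin_fps (zv 1) * geom_fps (zv 1) * Q_gen"
proof -
  define \<sigma> where "\<sigma> = (\<lambda>v. case v of VX j \<Rightarrow> if j = 0 then VX 0 else if j = 1 then VZ 1 else VX (j - 1)
    | VZ j \<Rightarrow> VZ j | VT j \<Rightarrow> VT j)"
  define \<epsilon> :: "var \<Rightarrow> int" where "\<epsilon> = (\<lambda>v. if v = VZ 1 then -1 else 1)"
  let ?S = "mps_subst \<sigma> \<epsilon>"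
  have fin: "finite_fibres \<sigma>"
    by (rule finite_fibresI[where F = "\<lambda>v. {v, VX 0, VX 1} \<union> (case v of VX j \<Rightarrow> {VX (Suc j)} | _ \<Rightarrow> {})"])
       (simp_all add: \<sigma>_def split: var.splits)
  have v: "?S (xv (Suc 0)) = zv 1" "j \<ge> 1 \<Longrightarrow> ?S (xv (Suc j)) = xv j" "?S (zv (Suc 0)) = - zv 1"
    "j \<ge> 2 \<Longrightarrow> ?S (zv j) = zv j" "?S (tv j) = tv j" for j
    unfolding subst_Var[OF fin] by (simp_all add: \<sigma>_def \<epsilon>_def)
  let ?C = "lin_fps (zv 1) * geom_fps (zv 1)"
  have "Abs_fps (\<lambda>n. ?S (fps_nth (Q_trunc (Suc N)) n)) = ?C * Q_trunc N" for N
  proof (induction N)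
    case 0
    have "Q_trunc (Suc 0) = lin_fps (xv (Suc 0)) * geom_fps (xv (Suc 0))" "Q_trunc 0 = 1"
      by (simp_all add: Q_trunc_def)
    thus ?case
      by (simp only: subst_fps_mult[OF fin] subst_fps_lin[OF fin] subst_fps_geom[OF fin] v mult_1_right)
  next
    case (Suc N)
    have "?S (xv (Suc (Suc N))) = xv (Suc N)" by (rule v) simp
    hence "Abs_fps (\<lambda>n. ?S (fps_nth (Q_trunc (Suc (Suc N))) n)) =
        ?C * Q_trunc N * (lin_fps (xv (Suc N)) * geom_fps (xv (Suc N)))"
      by (simp only: Q_trunc_Suc[of "Suc N"] subst_fps_mult[OF fin] subst_fps_lin[OF fin]
          subst_fps_geom[OF fin] Suc)
    thus ?case by (simp only: Q_trunc_Suc[of N] mult.assoc)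
  qed
  from arg_cong[OF this, where f = "\<lambda>f. fps_nth f _"]
  have tr: "?S (fps_nth (Q_trunc (Suc N)) r) = fps_nth (?C * Q_trunc N) r" for N r
    by (simp only: fps_nth_Abs_fps)
  have q: "?S (Qr r) = fps_nth (?C * Q_gen) r" for r
  proof -
    have "converges_to (\<lambda>N. fps_nth (?C * Q_trunc N) r) (fps_nth (?C * Q_gen) r)"
      unfolding fps_mult_nth[of ?C]
      by (intro converges_to_sum converges_to_mult converges_to_const Q_converges[unfolded Qr_def]) simp
    moreover have "converges_to (\<lambda>N. ?S (fps_nth (Q_trunc (Suc N)) r)) (?S (Qr r))"
    proof (rule subst_converges_to[OF fin])
      have "\<forall>\<^sub>F N in sequentially. mps_coeff (fps_nth (Q_trunc N) r) m = mps_coeff (Qr r) m" for m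
        using Q_converges[of r] by (simp add: converges_to_def)
      thus "converges_to (\<lambda>N. fps_nth (Q_trunc (Suc N)) r) (Qr r)"
        unfolding converges_to_def by (subst eventually_sequentially_Suc) blast
    qed
    ultimately show ?thesis unfolding tr using converges_to_unique by blast
  qed
  have Sgen: "Abs_fps (\<lambda>r. ?S (fps_nth Q_gen r)) = ?C * Q_gen"
    by (rule fps_ext) (use q in \<open>simp add: Qr_def\<close>)
  have "lin_fps (- zv 1) * geom_fps (- zv 1) * (?C * Q_gen) =
      (lin_fps (- zv 1) * geom_fps (zv 1)) * (lin_fps (- (- zv 1)) * geom_fps (- zv 1)) * Q_gen"
    by (simp add: ac_simps)
  also have "\<dots> = Q_gen" by (simp only: lin_minus_geom) simp
  finally have inv: "Abs_fps (\<lambda>r. ?S (fps_nth (?C * Q_gen) r)) = Q_gen"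
    by (simp add: subst_fps_mult[OF fin] subst_fps_lin[OF fin] subst_fps_geom[OF fin] Sgen v)
  have qq: "?S (?S (Qr r)) = Qr r" for r
    unfolding q using arg_cong[OF inv, of "\<lambda>f. fps_nth f r"] by (simp only: Qr_def fps_nth_Abs_fps)
  have "fps_nth (lin_fps (zv 1)) n \<in> Rinf" for n
    by (simp add: fps_nth_lin Rinf_ops Rinf_gens)
  moreover have "fps_nth (geom_fps (zv 1)) n \<in> Rinf" for n
    by (simp add: geom_fps_def Rinf_ops Rinf_gens)
  moreover have "fps_nth Q_gen n \<in> Rinf" for n
    using Rinf_gens(3) by (simp add: Qr_def)
  ultimately have qR: "?S (Qr r) \<in> Rinf" for r
    unfolding q by (intro fps_coeffs_Rinf_mult)
  have z: "?S (zv j) \<in> Rinf \<and> ?S (?S (zv j)) = zv j" if "j \<ge> 1" for j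
  proof (cases "j = 1")
    case True thus ?thesis by (simp add: v subst_uminus[OF fin] Rinf_ops Rinf_gens)
  next
    case False thus ?thesis using that by (simp add: v Rinf_ops Rinf_gens)
  qed
  have a: "restrict ?S Rinf \<in> ring_aut Rinf"
    by (rule subst_ring_aut[OF fin]) (simp_all add: v z qR qq Rinf_ops Rinf_gens)
  have sz: "sz 0 = (THE \<phi>. \<phi> \<in> ring_aut Rinf \<and> (\<forall>j\<ge>1. \<phi> (tv j) = tv j) \<and> (\<forall>j\<ge>2. \<phi> (zv j) = zv j) \<and>
      \<phi> (zv 1) = - zv 1 \<and> Abs_fps (\<lambda>r. \<phi> (Qr r)) = lin_fps (zv 1) * geom_fps (zv 1) * Q_gen)"
    by (simp add: sz_def)
  show ?thesis unfolding sz
  proof (rule theI[of _ "restrict ?S Rinf"])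
    show "restrict ?S Rinf \<in> ring_aut Rinf \<and> (\<forall>j\<ge>1. restrict ?S Rinf (tv j) = tv j) \<and>
      (\<forall>j\<ge>2. restrict ?S Rinf (zv j) = zv j) \<and> restrict ?S Rinf (zv 1) = - zv 1 \<and>
      Abs_fps (\<lambda>r. restrict ?S Rinf (Qr r)) = lin_fps (zv 1) * geom_fps (zv 1) * Q_gen"
      using a Sgen by (simp add: v Rinf_gens flip: Qr_def)
  next
    fix \<phi> assume \<phi>: "\<phi> \<in> ring_aut Rinf \<and> (\<forall>j\<ge>1. \<phi> (tv j) = tv j) \<and> (\<forall>j\<ge>2. \<phi> (zv j) = zv j) \<and>
      \<phi> (zv 1) = - zv 1 \<and> Abs_fps (\<lambda>r. \<phi> (Qr r)) = lin_fps (zv 1) * geom_fps (zv 1) * Q_gen"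
    show "\<phi> = restrict ?S Rinf"
    proof (rule ring_aut_unique)
      show "\<phi> (Qr r) = restrict ?S Rinf (Qr r)" for r
      proof -
        have "Abs_fps (\<lambda>r. \<phi> (Qr r)) = lin_fps (zv 1) * geom_fps (zv 1) * Q_gen" using \<phi> by blast
        from arg_cong[OF this, of "\<lambda>f. fps_nth f r"]
        have "\<phi> (Qr r) = fps_nth (lin_fps (zv 1) * geom_fps (zv 1) * Q_gen) r" by (simp only: fps_nth_Abs_fps)
        thus ?thesis by (simp only: restrict_apply' Rinf_gens q)
      qed
      show "\<phi> (zv j) = restrict ?S Rinf (zv j)" if "j \<ge> 1" for j
        using \<phi> that by (cases "j = 1") (simp_all add: v Rinf_gens)
    qed (use \<phi> a in \<open>simp_all add: v Rinf_gens\<close>)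
  qed
qed


subsection \<open>The divided differences are well defined\<close>

lemma omega_omega: "f \<in> Rinf \<Longrightarrow> omega (omega f) = f"
proof (induction rule: Rinf_induct)
  case (t i) thus ?case using omega_aut ring_aut_Rinf(5)[of omega "zv i"] Rinf_gens by simp
next
  case (z i) thus ?case using omega_aut ring_aut_Rinf(5)[of omega "tv i"] Rinf_gens by simp
qed (use omega_aut in \<open>simp_all add: ring_aut_Rinf[of omega]\<close>)

lemma alpha_Rinf: "alpha i \<in> Rinf"
proof -
  have "2 \<in> Rinf" using Rinf_ops(4)[OF Rinf_ops(1) Rinf_ops(1)] by simp
  thus ?thesis by (simp add: alpha_def Rinf_ops Rinf_gens)
qed

lemma omega_alpha: "omega (alpha i) = (if i = 0 then - 2 * zv 1 else zv i - zv (i + 1))"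
proof -
  have "omega (tv 1 + tv 1) = - (2 * zv 1)"
    using omega_aut ring_aut_Rinf(2)[of omega "tv 1" "tv 1"] Rinf_gens by simp
  moreover have "i \<ge> 1 \<Longrightarrow> omega (tv (i + 1) - tv i) = zv i - zv (i + 1)"
    using omega_aut ring_aut_Rinf(6)[of omega "tv (i + 1)" "tv i"] Rinf_gens by simp
  ultimately show ?thesis by (auto simp: alpha_def simp flip: mult_2)
qed

lemma Var_diff_nonzerodivisor:
  assumes "v \<noteq> v'" "(Var v - Var v') * g = 0"
  shows "g = 0"
proof (rule mps_eqI)
  have "mps_coeff g m = 0" for m
  proof (induction "count m v'" arbitrary: m rule: less_induct)
    case less
    have "mps_coeff ((Var v - Var v') * g) (add_mset v m) = 0" using assms by simp
    hence eq: "mps_coeff g m = (if v' \<in># add_mset v m then mps_coeff g (add_mset v m - {#v'#}) else 0)"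
      by (simp add: left_diff_distrib coeff_Var_times)
    show ?case
    proof (cases "v' \<in># m")
      case True
      hence "count (add_mset v m - {#v'#}) v' < count m v'"
        using assms(1) by (simp add: count_greater_zero_iff)
      thus ?thesis using eq less by simp
    qed (use eq assms(1) in auto)
  qed
  thus "mps_coeff g m = mps_coeff 0 m" for m by simp
qed

lemma two_Var_nonzerodivisor:
  assumes "2 * Var v * g = 0"
  shows "g = 0"
proof (rule mps_eqI)
  fix m
  have "mps_coeff (Var v * g + Var v * g) (add_mset v m) = 0"
    using assms by (simp only: mult_2 distrib_right coeff_simps)
  hence "mps_coeff (Var v * g) (add_mset v m) = 0" by (simp only: coeff_simps)
  thus "mps_coeff g m = mps_coeff 0 m" by (simp add: coeff_Var_times)
qed

lemma alpha_nonzerodivisor: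
  "alpha i * g = 0 \<Longrightarrow> g = 0" "omega (alpha i) * g = 0 \<Longrightarrow> g = 0"
proof -
  show "alpha i * g = 0 \<Longrightarrow> g = 0"
    using two_Var_nonzerodivisor Var_diff_nonzerodivisor[of "VT (i + 1)" "VT i" g]
    by (auto simp: alpha_def split: if_splits)
  show "omega (alpha i) * g = 0 \<Longrightarrow> g = 0"
    using two_Var_nonzerodivisor[of "VZ 1"] Var_diff_nonzerodivisor[of "VZ i" "VZ (i + 1)" g]
    by (auto simp: omega_alpha split: if_splits)
qed

lemma Rinf_quot_eq:
  assumes "\<And>h. g * h = 0 \<Longrightarrow> h = 0" "h \<in> Rinf" "g * h = f"
  shows "Rinf_quot f g = h"
  unfolding Rinf_quot_def
proof (rule the_equality)
  fix h' assume "h' \<in> Rinf \<and> g * h' = f"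
  hence "g * (h' - h) = 0" using assms(3) by (simp add: right_diff_distrib)
  thus "h' = h" using assms(1) by fastforce
qed (use assms in auto)

lemma sz_ring_aut: "sz i \<in> ring_aut Rinf"
  using sz_0_aut sz_Suc_aut[of i] by (cases "i = 0") auto

lemma sz_divisible:
  assumes "f \<in> Rinf"
  shows "\<exists>h\<in>Rinf. omega (alpha i) * h = f - sz i f"
  using assms
proof (induction rule: Rinf_induct)
  case (t j)
  hence "sz i (tv j) = tv j" using sz_0_aut sz_Suc_aut[of i] by (cases "i = 0") auto
  thus ?case by (intro bexI[of _ 0]) (simp_all add: Rinf_ops)
next
  case (z j)
  show ?case
  proof (cases "i = 0")
    case True
    show ?thesis
    proof (cases "j = 1")
      case True
      thus ?thesis using \<open>i = 0\<close> sz_0_aut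
        by (intro bexI[of _ "- 1"]) (simp_all add: Rinf_ops omega_alpha)
    next
      case False
      hence "sz i (zv j) = zv j" using z \<open>i = 0\<close> sz_0_aut by simp
      thus ?thesis by (intro bexI[of _ 0]) (simp_all add: Rinf_ops)
    qed
  next
    case False
    hence eq: "sz i (zv j) = zv (transpose i (i + 1) j)" using z sz_Suc_aut[of i] by simp
    consider "j = i" | "j = i + 1" | "j \<noteq> i" "j \<noteq> i + 1" by blast
    thus ?thesis
    proof cases
      case 1
      thus ?thesis using eq False by (intro bexI[of _ 1]) (simp_all add: Rinf_ops omega_alpha)
    next
      case 2
      thus ?thesis using eq False by (intro bexI[of _ "- 1"]) (simp_all add: Rinf_ops omega_alpha)
    next
      case 3
      thus ?thesis using eq by (intro bexI[of _ 0]) (simp_all add: Rinf_ops)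
    qed
  qed
next
  case (Qr r)
  show ?case
  proof (cases "i = 0")
    case True
    let ?h = "fps_nth (fps_X * (geom_fps (zv 1) * Q_gen)) r"
    have "fps_nth (geom_fps (zv 1)) n \<in> Rinf" "fps_nth Q_gen n \<in> Rinf" for n
      using Rinf_gens(3)[of n] by (simp_all add: geom_fps_def Qr_def Rinf_ops Rinf_gens)
    hence h: "?h \<in> Rinf"
      by (intro fps_coeffs_Rinf_mult) (auto simp: fps_X_def Rinf_ops)
    have "lin_fps (zv 1) * geom_fps (zv 1) * Q_gen =
        Q_gen + fps_const (zv 1) * (fps_X * (geom_fps (zv 1) * Q_gen) + fps_X * (geom_fps (zv 1) * Q_gen))"
      unfolding lin_geom by (simp add: algebra_simps)
    moreover have "sz 0 (Qr r) = fps_nth (lin_fps (zv 1) * geom_fps (zv 1) * Q_gen) r"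
      using sz_0_aut by (metis fps_nth_Abs_fps)
    ultimately have "sz 0 (Qr r) = Qr r + zv 1 * (?h + ?h)"
      by (simp only: Qr_def fps_add_nth fps_mult_left_const_nth)
    thus ?thesis using True h
      by (intro bexI[of _ ?h]) (simp_all add: omega_alpha algebra_simps)
  next
    case False
    hence "sz i (Qr r) = Qr r" using sz_Suc_aut[of i] by simp
    thus ?thesis by (intro bexI[of _ 0]) (simp_all add: Rinf_ops)
  qed
next
  case one
  show ?case by (intro bexI[of _ 0]) (simp_all add: Rinf_ops ring_aut_Rinf(1)[OF sz_ring_aut])
next
  case (uminus f)
  then obtain h where "h \<in> Rinf" "omega (alpha i) * h = f - sz i f" by blast
  thus ?case using uminus
    by (intro bexI[of _ "- h"]) (simp_all add: Rinf_ops ring_aut_Rinf(5)[OF sz_ring_aut])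
next
  case (add f g)
  then obtain h h' where "h \<in> Rinf" "omega (alpha i) * h = f - sz i f"
    "h' \<in> Rinf" "omega (alpha i) * h' = g - sz i g" by blast
  thus ?case using add
    by (intro bexI[of _ "h + h'"]) (simp_all add: Rinf_ops ring_aut_Rinf(2)[OF sz_ring_aut] distrib_left)
next
  case (mult f g)
  then obtain h h' where h: "h \<in> Rinf" "omega (alpha i) * h = f - sz i f"
    "h' \<in> Rinf" "omega (alpha i) * h' = g - sz i g" by blast
  have "omega (alpha i) * (f * h' + h * sz i g) =
      f * (omega (alpha i) * h') + (omega (alpha i) * h) * sz i g"
    by (simp add: algebra_simps)
  also have "\<dots> = f * (g - sz i g) + (f - sz i f) * sz i g" by (simp only: h)
  also have "\<dots> = f * g - sz i (f * g)"
    using mult(1,2) ring_aut_Rinf(3)[OF sz_ring_aut, of f g i] by (simp add: algebra_simps)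
  finally show ?case using h mult
    by (intro bexI[of _ "f * h' + h * sz i g"]) (simp_all add: Rinf_ops ring_aut_Rinf(4)[OF sz_ring_aut])
qed

lemma del_op_well_defined:
  assumes "f \<in> Rinf"
  shows "del_op i f \<in> Rinf" "omega (alpha i) * del_op i f = f - sz i f"
proof -
  obtain h where h: "h \<in> Rinf" "omega (alpha i) * h = f - sz i f" using sz_divisible assms by blast
  hence "del_op i f = h"
    unfolding del_op_def by (intro Rinf_quot_eq) (rule alpha_nonzerodivisor)
  thus "del_op i f \<in> Rinf" "omega (alpha i) * del_op i f = f - sz i f" using h by auto
qed

lemma delta_op_well_defined:
  assumes "f \<in> Rinf"
  shows "delta_op i f \<in> Rinf" "alpha i * delta_op i f = f - st i f"
proof -
  have om: "omega \<in> ring_aut Rinf" using omega_aut by blast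
  note R = ring_aut_Rinf[OF om]
  obtain h where h: "h \<in> Rinf" "omega (alpha i) * h = omega f - sz i (omega f)"
    using sz_divisible[OF R(4)[OF assms]] by blast
  have "alpha i * omega h = omega (omega (alpha i) * h)"
    using R(3)[OF R(4)[OF alpha_Rinf] h(1)] by (simp only: omega_omega[OF alpha_Rinf])
  also have "\<dots> = f - st i f"
    unfolding h(2) st_def using assms R ring_aut_Rinf(4)[OF sz_ring_aut] by (simp add: omega_omega)
  finally have "alpha i * omega h = f - st i f" .
  moreover from this have "delta_op i f = omega h"
    unfolding delta_op_def by (intro Rinf_quot_eq R h) (rule alpha_nonzerodivisor)
  ultimately show "delta_op i f \<in> Rinf" "alpha i * delta_op i f = f - st i f" using h R by auto
qed

section \<open>Signed permutations\<close>

text \<open>The letter \<open>i\<close> with a bar is the integer \<open>- i\<close>. An element is a function on all integers which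
  fixes 0, and the product \<open>w v\<close> is \<open>w \<circ> v\<close>.\<close>

definition Winf :: "(int \<Rightarrow> int) set"
  where "Winf = {w. w permutes (UNIV - {0}) \<and> (\<forall>i. w (- i) = - w i) \<and> finite {i. w i \<noteq> i}}"

definition sgen :: "nat \<Rightarrow> int \<Rightarrow> int"
  where "sgen i = (if i = 0 then transpose 1 (- 1)
    else transpose (int i) (int i + 1) \<circ> transpose (- int i) (- (int i + 1)))"

definition cox_len :: "(int \<Rightarrow> int) \<Rightarrow> nat"
  where "cox_len w = (LEAST l. \<exists>is. length is = l \<and> w = foldr (\<lambda>i v. sgen i \<circ> v) is id)"

definition Wn :: "nat \<Rightarrow> (int \<Rightarrow> int) set"
  where "Wn n = {w \<in> Winf. \<forall>i > int n. w i = i}"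

definition W_grass :: "nat \<Rightarrow> (int \<Rightarrow> int) set"
  where "W_grass k = {w \<in> Winf. \<forall>i. i \<noteq> k \<longrightarrow> cox_len w < cox_len (w \<circ> sgen i)}"

definition Wn_grass :: "nat \<Rightarrow> nat \<Rightarrow> (int \<Rightarrow> int) set"
  where "Wn_grass k n = Wn n \<inter> W_grass k"

section \<open>Double Schubert polynomials\<close>

text \<open>The second conjunct says that \<open>(C w)\<close>, \<open>w \<in> Winf\<close>, is a basis over \<^term>\<open>Zt\<close>; the constant term
  of a power series is its coefficient at the empty monomial.\<close>

definition double_schubert :: "((int \<Rightarrow> int) \<Rightarrow> var mps) \<Rightarrow> bool"
  where "double_schubert C \<longleftrightarrow>
    (\<forall>w\<in>Winf. C w \<in> Rinf) \<and>
    (\<forall>f\<in>Rinf. \<exists>!c. (\<forall>w. c w \<in> Zt) \<and> {w. c w \<noteq> 0} \<subseteq> Winf \<and> finite {w. c w \<noteq> 0} \<and>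
       f = (\<Sum>w | c w \<noteq> 0. c w * C w)) \<and>
    (\<forall>w\<in>Winf. \<forall>i. del_op i (C w) = (if cox_len (w \<circ> sgen i) < cox_len w then C (w \<circ> sgen i) else 0)) \<and>
    (\<forall>w\<in>Winf. \<forall>i. delta_op i (C w) = (if cox_len (sgen i \<circ> w) < cox_len w then C (sgen i \<circ> w) else 0)) \<and>
    (\<forall>w\<in>Winf. w \<noteq> id \<longrightarrow> mps_coeff (C w) {#} = 0) \<and> C id = 1"

section \<open>\<open>k\<close>-strict partitions and \<open>k\<close>-Grassmannian elements\<close>

text \<open>A partition in the \<open>(n - k) \<times> (n + k)\<close> rectangle is the list of its \<open>n - k\<close> parts, zeros
  included; the part numbered \<open>i \<ge> 1\<close> is \<open>lam ! (i - 1)\<close>.\<close>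

definition kstrict_partitions :: "nat \<Rightarrow> nat \<Rightarrow> nat list set"
  where "kstrict_partitions k n = {lam. length lam = n - k \<and> sorted_wrt (\<ge>) lam \<and>
    (\<forall>p\<in>set lam. p \<le> n + k) \<and> (\<forall>p > k. count_list lam p \<le> 1)}"

text \<open>The one-line form of \<open>w\<close> in \<^term>\<open>Wn_grass k n\<close> has \<open>v\<^sub>p = w p\<close> for \<open>p \<le> k\<close>; the entries in
  positions \<open>k + 1, \<dots>, n\<close> are first the negative ones, \<open>- \<zeta>\<^sub>i\<close>, and then the positive ones, \<open>u\<^sub>j\<close>.\<close>

definition partition_of :: "nat \<Rightarrow> nat \<Rightarrow> (int \<Rightarrow> int) \<Rightarrow> nat list"
  where "partition_of k n w = map (\<lambda>i. if w (int i) < 0 then nat (- w (int i)) + k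
    else card {p \<in> {1..k}. w (int p) > w (int i)}) [k + 1..<n + 1]"

definition grass_elt :: "nat \<Rightarrow> nat \<Rightarrow> nat list \<Rightarrow> int \<Rightarrow> int"
  where "grass_elt k n lam = the_inv_into (Wn_grass k n) (partition_of k n) lam"

definition char_index :: "nat \<Rightarrow> nat \<Rightarrow> nat list \<Rightarrow> int list"
  where "char_index k n lam = (let w = grass_elt k n lam in
    map (\<lambda>i. if w (int i) < 0 then - w (int i) - 1 else - w (int i)) [k + 1..<n + 1])"

definition Dset :: "nat \<Rightarrow> nat \<Rightarrow> nat list \<Rightarrow> (nat \<times> nat) set"
  where "Dset k n lam = {(i, j). 1 \<le> i \<and> i < j \<and> j \<le> n - k \<and>
    char_index k n lam ! (i - 1) + char_index k n lam ! (j - 1) < 0}"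

definition shift_I :: "(nat \<times> nat) set \<Rightarrow> nat \<Rightarrow> int"
  where "shift_I I s = int (card {j. (s, j) \<in> I}) - int (card {i. (i, s) \<in> I})"

section \<open>Theta polynomials and multi Schur-Pfaffians\<close>

definition theta_gen :: "nat \<Rightarrow> int \<Rightarrow> var mps fps"
  where "theta_gen k l = Q_gen * (\<Prod>i=1..k. lin_fps (zv i)) *
    (if l \<ge> 0 then \<Prod>i=1..nat l. lin_fps (- tv i) else \<Prod>i=1..nat (- l). geom_fps (- tv i))"

definition theta :: "nat \<Rightarrow> int \<Rightarrow> int \<Rightarrow> var mps"
  where "theta k l r = (if r < 0 then 0 else fps_nth (theta_gen k l) (nat r))"

definition omit :: "nat \<Rightarrow> 'a list \<Rightarrow> 'a list"
  where "omit s xs = take (s - 1) xs @ drop s xs"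

lemma length_omit_less:
  "s \<in> {1..length xs} \<Longrightarrow> length (omit s xs) < length xs"
  "s \<in> {2..length xs} \<Longrightarrow> length (tl (omit s xs)) < length xs"
  by (auto simp: omit_def)

text \<open>The argument lists the pairs \<open>(c\<^sup>(\<^sup>i\<^sup>), r\<^sub>i)\<close>, the \<open>i\<close>-th sequence together with its subscript. The
  recursion is carried out over an arbitrary commutative ring; since every clause is an integral
  polynomial in the entries of the sequences (whose shape depends on the subscripts only), its value
  at given sequences is the expansion in formal variables followed by substitution; see also
  \<open>schur_pf_hom\<close> below.\<close>

function schur_pf :: "((int \<Rightarrow> 'a::comm_ring_1) \<times> int) list \<Rightarrow> 'a"
  where
    "schur_pf [] = 1"
  | "schur_pf [(c, r)] = c r"
  | "schur_pf [(c, r), (d, q)] = c r * d q + 2 * (\<Sum>s=1..q. (- 1) ^ nat s * c (r + s) * d (q - s))"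
  | "schur_pf (p1 # p2 # p3 # ps) = (let xs = p1 # p2 # p3 # ps; m = length xs in
      if even m
      then \<Sum>s=2..m. (- 1) ^ s * schur_pf [xs ! 0, xs ! (s - 1)] * schur_pf (tl (omit s xs))
      else \<Sum>s=1..m. (- 1) ^ (s - 1) * schur_pf [xs ! (s - 1)] * schur_pf (omit s xs))"
  by pat_completeness auto

termination
proof (relation "measure length", goal_cases)
  case 1 show ?case by simp
next
  case (2 p1 p2 p3 ps xs m s) show ?case by simp
next
  case (3 p1 p2 p3 ps xs m s)
  thus ?case using length_omit_less(2)[of s xs] by (simp only: in_measure)
next
  case (4 p1 p2 p3 ps xs m s) show ?case by simp
next
  case (5 p1 p2 p3 ps xs m s)
  thus ?case using length_omit_less(1)[of s xs] by (simp only: in_measure)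
qed

lemma omit_map: "omit s (map f xs) = map f (omit s xs)"
  by (simp add: omit_def take_map drop_map)

lemma schur_pf_hom:
  fixes h :: "'a::comm_ring_1 \<Rightarrow> 'b::comm_ring_1"
  assumes one: "h 1 = 1" and add: "\<And>a b. h (a + b) = h a + h b"
    and mult: "\<And>a b. h (a * b) = h a * h b"
  shows "schur_pf (map (\<lambda>p. (h \<circ> fst p, snd p)) xs) = h (schur_pf xs)"
proof -
  let ?f = "\<lambda>p. (h \<circ> fst p, snd p)"
  have zero: "h 0 = 0" using add[of 0 0] by simp
  have um: "h (- a) = - h a" for a using add[of a "- a"] zero by (simp add: add_eq_0_iff)
  have sm: "h (sum F A) = (\<Sum>i\<in>A. h (F i))" for F :: "'c \<Rightarrow> 'a" and A
    by (induction A rule: infinite_finite_induct) (simp_all add: zero add)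
  have pw: "h ((- 1) ^ j) = (- 1) ^ j" for j
    by (induction j) (simp_all add: one um mult)
  have two: "h 2 = 2" using add[of 1 1] one by simp
  show ?thesis
  proof (induction xs rule: schur_pf.induct)
    case 1 show ?case by (simp add: one)
  next
    case (2 c r) show ?case by simp
  next
    case (3 c r d q) show ?case by (simp add: add mult two sm pw)
  next
    case (4 p1 p2 p3 ps)
    define xs where "xs = p1 # p2 # p3 # ps"
    have m: "map ?f xs = ?f p1 # ?f p2 # ?f p3 # map ?f ps" by (simp add: xs_def)
    have pf: "schur_pf ys = (if even (length ys)
        then \<Sum>s=2..length ys. (- 1) ^ s * schur_pf [ys ! 0, ys ! (s - 1)] * schur_pf (tl (omit s ys))
        else \<Sum>s=1..length ys. (- 1) ^ (s - 1) * schur_pf [ys ! (s - 1)] * schur_pf (omit s ys))"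
      if "ys = q1 # q2 # q3 # qs" for ys q1 q2 q3 and qs :: "((int \<Rightarrow> 'c::comm_ring_1) \<times> int) list"
      unfolding that schur_pf.simps(4) Let_def by (rule refl)
    have n: "map ?f xs ! (s - 1) = ?f (xs ! (s - 1))" if "1 \<le> s" "s \<le> length xs" for s
      using that by (intro nth_map) simp
    have n0: "map ?f xs ! 0 = ?f (xs ! 0)" by (intro nth_map) (simp add: xs_def)
    note IH = 4[OF xs_def refl]
    have "schur_pf (map ?f xs) = h (schur_pf xs)"
    proof (cases "even (length xs)")
      case True
      have "schur_pf [map ?f xs ! 0, map ?f xs ! (s - 1)] = h (schur_pf [xs ! 0, xs ! (s - 1)])"
        "schur_pf (tl (omit s (map ?f xs))) = h (schur_pf (tl (omit s xs)))" if "s \<in> {2..length xs}" for s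
        using IH(1,2)[OF True that] n[of s] that n0
        by (simp_all only: omit_map list.map flip: map_tl) auto
      thus ?thesis
        unfolding pf[OF m] pf[OF xs_def] length_map if_P[OF True] sm mult pw
        by (intro sum.cong) auto
    next
      case False
      have "schur_pf [map ?f xs ! (s - 1)] = h (schur_pf [xs ! (s - 1)])"
        "schur_pf (omit s (map ?f xs)) = h (schur_pf (omit s xs))" if "s \<in> {1..length xs}" for s
        using IH(3,4)[OF False that] n[of s] that
        by (simp_all only: omit_map list.map) auto
      thus ?thesis
        unfolding pf[OF m] pf[OF xs_def] length_map if_not_P[OF False] sm mult pw
        by (intro sum.cong) auto
    qed
    thus ?case by (simp only: xs_def)
  qed
qed

end

theory Submission
  imports Defs
begin

text \<open>Let \<open>F w\<close> denote the right-hand side for \<open>w = w\<^sub>\<lambda>\<close>, and \<open>\<theta> l r\<close> the theta polynomial with upper index \<open>l\<close> and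
  subscript \<open>r\<close>. An element of the ring that is invariant under all reflections acting on \<open>t\<close> involves neither
  \<open>t\<close> nor \<open>x\<close>, hence it vanishes as soon as it vanishes at \<open>x = 0\<close>, \<open>z = t\<close>. By induction on the length,
  \<open>C w\<close> is therefore determined by its left divided differences together with its vanishing at this point
  for \<open>w \<noteq> id\<close>, which itself follows from the symmetry exchanging \<open>z\<close> and \<open>t\<close> and the condition on constant
  terms. It remains to see that \<open>F w\<close> behaves in the same way under \<open>\<delta>\<^sub>i\<close>. Since \<open>\<delta>\<^sub>i\<close> maps \<open>\<theta> l r\<close> to
  \<open>\<theta> (l - 1) (r - 1)\<close> if \<open>\<bar>l\<bar> = i\<close> and to 0 otherwise, at most two rows of the Pfaffians are affected. If
  \<open>s\<^sub>i w < w\<close>, the result is \<open>F (s\<^sub>i w)\<close>; when two rows are affected, the twisted Leibniz rule produces the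
  additional factor \<open>1 + R\<^sub>p\<^sub>q\<close>. Otherwise the result is 0: either two adjacent rows become equal, and the
  symmetries of the Pfaffian apply together with the quadratic relations among the \<open>\<theta> l r\<close>, or the last
  subscript becomes negative.\<close>

section \<open>Multi Schur-Pfaffians\<close>

text \<open>The entry \<open>schur_pf [(c, a), (d, b)]\<close> expands (1 - R) / (1 + R) applied to
  \<open>c a * d b\<close>, where R raises the first subscript and lowers the second. It is not
  antisymmetric in its two rows, so rows of a Pfaffian cannot simply be exchanged with a sign.
  Pfaffians are therefore taken along lists with an arbitrary array of entries, and exchanging
  neighbouring rows leaves a controlled defect (\<open>pf_swap\<close>). If both rows carry the same
  sequence c, that defect depends, up to sign, only on the sum of the two subscripts and is a
  coefficient of 2 c(-u) c(u); for theta polynomials the Q series cancels from this product. The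
  number of rows stays n - k, zero parts included, because passing from w to s_i w may create zero
  parts; for the identity, adding a zero row does not change a Pfaffian. The vanishing of F w at x =
  0, z = t comes from the first row alone: there theta with index chi_1 has subscripts at most k +
  chi_1, the first part equals k + chi_1 + 1, and raising operators never lower the first
  subscript.\<close>

definition remove_nth :: "nat \<Rightarrow> 'a list \<Rightarrow> 'a list"
  where "remove_nth s xs = take s xs @ drop (Suc s) xs"

lemma length_remove_nth [simp]: "s < length xs \<Longrightarrow> length (remove_nth s xs) = length xs - 1"
  by (simp add: remove_nth_def)

lemma remove_nth_Cons [simp]: "remove_nth 0 (x # xs) = xs" "remove_nth (Suc s) (x # xs) = x # remove_nth s xs"
  by (simp_all add: remove_nth_def)

lemma remove_nth_append:
  "remove_nth s (xs @ ys) = (if s < length xs then remove_nth s xs @ ys else xs @ remove_nth (s - length xs) ys)"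
  by (auto simp: remove_nth_def Suc_diff_le)

lemma set_remove_nth_subset: "set (remove_nth s xs) \<subseteq> set xs"
  by (auto simp: remove_nth_def dest: in_set_takeD in_set_dropD)

lemma map_remove_nth: "remove_nth s (map f xs) = map f (remove_nth s xs)"
  by (simp add: remove_nth_def take_map drop_map)

lemma nth_remove_nth:
  assumes "s < length xs" "t < length xs - 1"
  shows "remove_nth s xs ! t = (if t < s then xs ! t else xs ! Suc t)"
  using assms by (auto simp: remove_nth_def nth_append)

lemma set_remove_nth:
  assumes "distinct xs" "s < length xs"
  shows "set (remove_nth s xs) = set xs - {xs ! s}" "distinct (remove_nth s xs)"
proof -
  note eq = id_take_nth_drop[OF assms(2), symmetric]
  have "distinct (take s xs @ xs ! s # drop (Suc s) xs)" "set (take s xs @ xs ! s # drop (Suc s) xs) = set xs"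
    using assms(1) by (simp_all only: eq)
  thus "set (remove_nth s xs) = set xs - {xs ! s}" "distinct (remove_nth s xs)"
    by (auto simp: remove_nth_def)
qed

lemma remove_nth_remove_nth:
  assumes "s \<le> t" "Suc t < length xs"
  shows "remove_nth t (remove_nth s xs) = remove_nth s (remove_nth (Suc t) xs)"
proof (rule nth_equalityI)
  show "length (remove_nth t (remove_nth s xs)) = length (remove_nth s (remove_nth (Suc t) xs))"
    using assms by simp
  fix i assume "i < length (remove_nth t (remove_nth s xs))"
  thus "remove_nth t (remove_nth s xs) ! i = remove_nth s (remove_nth (Suc t) xs) ! i"
    using assms by (auto simp: nth_remove_nth)
qed

text \<open>Expansion along the first row of the Pfaffian of the triangular array
  \<open>P x y\<close>, with \<open>x\<close> before \<open>y\<close> in the list. No antisymmetry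
  of \<open>P\<close> is assumed. Lists of odd length give 0.\<close>

function pf :: "('b \<Rightarrow> 'b \<Rightarrow> 'a::comm_ring_1) \<Rightarrow> 'b list \<Rightarrow> 'a"
  where
    "pf P [] = 1"
  | "pf P (x # xs) = (\<Sum>s<length xs. (- 1) ^ s * P x (xs ! s) * pf P (remove_nth s xs))"
  by pat_completeness auto
termination by (relation "measure (length \<circ> snd)") (auto simp: remove_nth_def)

lemma pf_cong:
  assumes "\<And>x y. x \<in> set xs \<Longrightarrow> y \<in> set xs \<Longrightarrow> P x y = P' x y"
  shows "pf P xs = pf P' xs"
  using assms
proof (induction "length xs" arbitrary: xs rule: less_induct)
  case less
  show ?case
  proof (cases xs)
    case (Cons x ys)
    have "pf P (remove_nth s ys) = pf P' (remove_nth s ys)" if "s < length ys" for s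
      using that less Cons set_remove_nth_subset[of s ys] by (intro less(1)) auto
    thus ?thesis using less(2) Cons by (auto intro!: sum.cong)
  qed simp
qed

lemma pf_map: "pf P (map f xs) = pf (\<lambda>x y. P (f x) (f y)) xs"
proof (induction "length xs" arbitrary: xs rule: less_induct)
  case less
  show ?case
  proof (cases xs)
    case (Cons x ys)
    thus ?thesis using less by (auto intro!: sum.cong simp: map_remove_nth)
  qed simp
qed

text \<open>Every term of the full expansion contains exactly one entry in which \<open>p\<close> is
  paired with another index.\<close>

lemma pf_linear:
  assumes "distinct xs" "p \<in> set xs"
    and "\<And>i j. i \<in> set xs \<Longrightarrow> j \<in> set xs \<Longrightarrow> i \<noteq> p \<Longrightarrow> j \<noteq> p \<Longrightarrow> P i j = P1 i j \<and> P i j = P2 i j"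
    and "\<And>i. i \<in> set xs \<Longrightarrow> i \<noteq> p \<Longrightarrow> P i p = a * P1 i p + b * P2 i p \<and> P p i = a * P1 p i + b * P2 p i"
  shows "pf P xs = a * pf P1 xs + b * pf P2 xs"
  using assms
proof (induction "length xs" arbitrary: xs rule: less_induct)
  case less
  from less.prems obtain x ys where xs: "xs = x # ys" by (cases xs) auto
  note sr = set_remove_nth[of ys]
  have d: "distinct ys" "x \<notin> set ys" using less.prems xs by auto
  have "(- 1) ^ s * P x (ys ! s) * pf P (remove_nth s ys) =
      a * ((- 1) ^ s * P1 x (ys ! s) * pf P1 (remove_nth s ys)) + b * ((- 1) ^ s * P2 x (ys ! s) * pf P2 (remove_nth s ys))"
    if s: "s < length ys" for s
  proof (cases "x = p \<or> ys ! s = p")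
    case True
    have ne: "x \<noteq> ys ! s" using d s by auto
    have "P x (ys ! s) = a * P1 x (ys ! s) + b * P2 x (ys ! s)"
      using True less.prems(4)[of x] less.prems(4)[of "ys ! s"] ne s xs by auto
    moreover have "pf P (remove_nth s ys) = pf P1 (remove_nth s ys)" "pf P (remove_nth s ys) = pf P2 (remove_nth s ys)"
      using True sr[OF d(1) s] d xs less.prems(3) by (auto intro!: pf_cong)
    ultimately show ?thesis by (simp add: algebra_simps)
  next
    case False
    have "P x (ys ! s) = P1 x (ys ! s)" "P x (ys ! s) = P2 x (ys ! s)"
      using less.prems(3)[of x "ys ! s"] False xs s by auto
    moreover have "pf P (remove_nth s ys) = a * pf P1 (remove_nth s ys) + b * pf P2 (remove_nth s ys)"
    proof (rule less.hyps)
      show "length (remove_nth s ys) < length xs" using s xs by simp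
      show "P i j = P1 i j \<and> P i j = P2 i j"
        if "i \<in> set (remove_nth s ys)" "j \<in> set (remove_nth s ys)" "i \<noteq> p" "j \<noteq> p" for i j
        using that sr[OF d(1) s] xs by (intro less.prems(3)) auto
    qed (use less.prems False xs sr[OF d(1) s] in auto)
    ultimately show ?thesis by (simp add: algebra_simps)
  qed
  thus ?case by (simp add: xs sum.distrib sum_distrib_left)
qed

lemma pf_zero_row:
  assumes "distinct xs" "p \<in> set xs" "\<And>i. i \<in> set xs \<Longrightarrow> i \<noteq> p \<Longrightarrow> P i p = 0 \<and> P p i = 0"
  shows "pf P xs = 0"
  using pf_linear[of xs p P P P 0 0] assms by simp

lemma pf_two_rows:
  "pf P (a # b # ys) = P a b * pf P ys -
     (\<Sum>(s, t)\<in>{..<length ys} \<times> {..<length ys - 1}.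
        (- 1) ^ (s + t) * P a (ys ! s) * P b (remove_nth s ys ! t) * pf P (remove_nth t (remove_nth s ys)))"
proof -
  have "pf P (a # b # ys) = P a b * pf P ys -
     (\<Sum>s<length ys. (- 1) ^ s * P a (ys ! s) * pf P (b # remove_nth s ys))"
    by (simp add: sum.lessThan_Suc_shift algebra_simps sum_negf del: sum.lessThan_Suc)
  also have "(\<Sum>s<length ys. (- 1) ^ s * P a (ys ! s) * pf P (b # remove_nth s ys)) =
    (\<Sum>s<length ys. \<Sum>t<length ys - 1. (- 1) ^ (s + t) * P a (ys ! s) * P b (remove_nth s ys ! t) * pf P (remove_nth t (remove_nth s ys)))"
    by (intro sum.cong) (auto simp: sum_distrib_left power_add algebra_simps)
  finally show ?thesis by (simp add: sum.cartesian_product)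
qed

text \<open>Substitute for antisymmetry. In \<open>pf_two_rows\<close> the terms in which
  \<open>a\<close> and \<open>b\<close> have other partners cancel between the two orders; only the
  terms pairing \<open>a\<close> with \<open>b\<close> remain.\<close>

lemma pf_swap_first: "pf P (a # b # ys) + pf P (b # a # ys) = (P a b + P b a) * pf P ys"
proof -
  let ?n = "length ys"
  define F where "F = (\<lambda>a b (s, t). (- 1) ^ (s + t) * P a (ys ! s) * P b (remove_nth s ys ! t) * pf P (remove_nth t (remove_nth s ys)))"
  \<comment> \<open>A pair (s, t) selects two positions of \<open>ys\<close> in order, the second
    one counted after deletion of the first. \<open>h\<close> encodes the same two positions
    selected in the opposite order; the exponent s + t changes by one.\<close>
  define h where "h = (\<lambda>(s, t). if s \<le> t then (Suc t, s) else (t, s - 1 :: nat))"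
  let ?A = "{..<?n} \<times> {..<?n - 1}"
  have hh: "h (h x) = x" for x by (auto simp: h_def split: prod.splits if_splits)
  have hA: "h x \<in> ?A" if "x \<in> ?A" for x using that by (auto simp: h_def)
  have up: "F a b (s, t) = - F b a (Suc t, s)" if "s \<le> t" "Suc t < ?n" for s t a b
    using that remove_nth_remove_nth[OF that] by (simp add: F_def nth_remove_nth mult_ac add.commute[of t s])
  have "F a b x = - F b a (h x)" if "x \<in> ?A" for x
  proof (cases x)
    case (Pair s t)
    show ?thesis
    proof (cases "s \<le> t")
      case True thus ?thesis using that Pair up[of s t a b] by (auto simp: h_def)
    next
      case False
      hence "F b a (t, s - 1) = - F a b (s, t)" using up[of t "s - 1" b a] that Pair by auto
      thus ?thesis using False Pair by (auto simp: h_def)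
    qed
  qed
  hence "sum (F a b) ?A = (\<Sum>x\<in>?A. - F b a (h x))" by (rule sum.cong[OF refl])
  also have "\<dots> = (\<Sum>x\<in>?A. - F b a x)"
  proof (rule sum.reindex_bij_witness[where i = h and j = h])
    show "h x \<in> ?A" "h x \<in> ?A" if "x \<in> ?A" for x using that by (rule hA)+
  qed (simp_all add: hh)
  finally have "sum (F a b) ?A + sum (F b a) ?A = 0" by (simp add: sum_negf)
  thus ?thesis
    unfolding pf_two_rows by (simp add: F_def algebra_simps)
qed

lemma sum_lessThan_add: "sum f {..<a + b :: nat} = sum f {..<a} + (\<Sum>s<b. f (s + a))"
  by (induction b) (simp_all add: ac_simps)

text \<open>Induction by expanding along the first element of \<open>xs\<close>. If its partner lies
  outside {a, b}, the induction hypothesis applies to the remaining list; the terms with partner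
  \<open>a\<close> or \<open>b\<close> cancel.\<close>

lemma pf_swap: "pf P (xs @ a # b # ys) + pf P (xs @ b # a # ys) = (P a b + P b a) * pf P (xs @ ys)"
proof (induction "length xs + length ys" arbitrary: xs ys rule: less_induct)
  case less
  show ?case
  proof (cases xs)
    case Nil thus ?thesis using pf_swap_first by simp
  next
    case (Cons x zs)
    let ?k = "length zs"
    define G where "G = (\<lambda>L s. (- 1) ^ s * P x (L ! s) * pf P (remove_nth s L))"
    have split: "pf P (x # zs @ c # d # ys) = (\<Sum>s<?k. G (zs @ c # d # ys) s) +
        (G (zs @ c # d # ys) ?k + G (zs @ c # d # ys) (Suc ?k)) + (\<Sum>s<length ys. G (zs @ c # d # ys) (s + Suc (Suc ?k)))" for c d
      using sum_lessThan_add[of "G (zs @ c # d # ys)" "Suc (Suc ?k)" "length ys"] by (simp add: G_def algebra_simps)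
    have split2: "pf P (x # zs @ ys) = (\<Sum>s<?k. G (zs @ ys) s) + (\<Sum>s<length ys. G (zs @ ys) (s + ?k))"
      using sum_lessThan_add[of "G (zs @ ys)" ?k "length ys"] by (simp add: G_def)
    have 1: "G (zs @ a # b # ys) s + G (zs @ b # a # ys) s = (P a b + P b a) * G (zs @ ys) s" if "s < ?k" for s
    proof -
      have "pf P (remove_nth s zs @ a # b # ys) + pf P (remove_nth s zs @ b # a # ys) = (P a b + P b a) * pf P (remove_nth s zs @ ys)"
        using that Cons by (intro less) auto
      thus ?thesis using that
        by (simp add: G_def remove_nth_append nth_append) (simp add: mult.left_commute flip: distrib_left)
    qed
    have 2: "G (zs @ a # b # ys) (s + Suc (Suc ?k)) + G (zs @ b # a # ys) (s + Suc (Suc ?k)) = (P a b + P b a) * G (zs @ ys) (s + ?k)"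
      if "s < length ys" for s
    proof -
      have "pf P (zs @ a # b # remove_nth s ys) + pf P (zs @ b # a # remove_nth s ys) = (P a b + P b a) * pf P (zs @ remove_nth s ys)"
        using that Cons by (intro less) auto
      thus ?thesis using that
        by (simp add: G_def remove_nth_append nth_append) (simp add: mult.left_commute flip: distrib_left)
    qed
    have 3: "G (zs @ a # b # ys) ?k + G (zs @ a # b # ys) (Suc ?k) + (G (zs @ b # a # ys) ?k + G (zs @ b # a # ys) (Suc ?k)) = 0"
      by (simp add: G_def remove_nth_append nth_append algebra_simps)
    have "pf P (xs @ a # b # ys) + pf P (xs @ b # a # ys) = (\<Sum>s<?k. G (zs @ a # b # ys) s + G (zs @ b # a # ys) s) +
      (G (zs @ a # b # ys) ?k + G (zs @ a # b # ys) (Suc ?k) + (G (zs @ b # a # ys) ?k + G (zs @ b # a # ys) (Suc ?k))) +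
      (\<Sum>s<length ys. G (zs @ a # b # ys) (s + Suc (Suc ?k)) + G (zs @ b # a # ys) (s + Suc (Suc ?k)))"
      unfolding Cons append_Cons split sum.distrib by (simp add: algebra_simps)
    also have "\<dots> = (P a b + P b a) * pf P (xs @ ys)"
      unfolding 3 Cons append_Cons split2 distrib_left sum_distrib_left using 1 2 by simp
    finally show ?thesis .
  qed
qed

section \<open>Comparison with the defining recursion of \<open>schur_pf\<close>\<close>

lemma schur_pf_expand:
  assumes "length ys \<ge> 3"
  shows "schur_pf ys = (if even (length ys)
    then \<Sum>s<length (tl ys). (- 1) ^ s * schur_pf [hd ys, tl ys ! s] * schur_pf (remove_nth s (tl ys))
    else \<Sum>s<length ys. (- 1) ^ s * schur_pf [ys ! s] * schur_pf (remove_nth s ys))"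
proof -
  obtain p1 p2 p3 ps where ys: "ys = p1 # p2 # p3 # ps"
    using assms by (metis Suc_le_length_iff numeral_3_eq_3)
  have "schur_pf ys = (if even (length ys)
        then \<Sum>s=2..length ys. (- 1) ^ s * schur_pf [ys ! 0, ys ! (s - 1)] * schur_pf (tl (omit s ys))
        else \<Sum>s=1..length ys. (- 1) ^ (s - 1) * schur_pf [ys ! (s - 1)] * schur_pf (omit s ys))"
    unfolding ys schur_pf.simps(4) Let_def by (rule refl)
  moreover have "(\<Sum>s=2..length ys. (- 1) ^ s * schur_pf [ys ! 0, ys ! (s - 1)] * schur_pf (tl (omit s ys))) =
     (\<Sum>s<length (tl ys). (- 1) ^ s * schur_pf [hd ys, tl ys ! s] * schur_pf (remove_nth s (tl ys)))"
  proof (rule sum.reindex_bij_witness[where i = "\<lambda>s. s + 2" and j = "\<lambda>s. s - 2"])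
    fix a assume "a \<in> {2..length ys}"
    then obtain s where a: "a = Suc (Suc s)" by (auto dest!: le_Suc_ex)
    have *: "tl (omit (Suc (Suc s)) (q # qs)) = remove_nth s qs" for q and qs :: "((int \<Rightarrow> 'a) \<times> int) list"
      by (simp add: omit_def remove_nth_def)
    show "(- 1) ^ (a - 2) * schur_pf [hd ys, tl ys ! (a - 2)] * schur_pf (remove_nth (a - 2) (tl ys)) =
      (- 1) ^ a * schur_pf [ys ! 0, ys ! (a - 1)] * schur_pf (tl (omit a ys))"
      unfolding a ys * by (simp del: schur_pf.simps)
  qed (use ys in auto)
  moreover have "(\<Sum>s=1..length ys. (- 1) ^ (s - 1) * schur_pf [ys ! (s - 1)] * schur_pf (omit s ys)) =
     (\<Sum>s<length ys. (- 1) ^ s * schur_pf [ys ! s] * schur_pf (remove_nth s ys))"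
    by (rule sum.reindex_bij_witness[where i = "\<lambda>s. s + 1" and j = "\<lambda>s. s - 1"])
      (auto simp: omit_def remove_nth_def)
  ultimately show ?thesis by simp
qed

text \<open>Pfaffians of odd size are even-sized ones with an additional first row, whose index is 0.\<close>

definition pair_pf :: "(nat \<Rightarrow> int \<Rightarrow> 'a::comm_ring_1) \<Rightarrow> (nat \<Rightarrow> int) \<Rightarrow> nat \<Rightarrow> nat \<Rightarrow> 'a"
  where "pair_pf c b i j = (if i = 0 then c j (b j) else schur_pf [(c i, b i), (c j, b j)])"

lemma schur_pf_eq_pf:
  assumes "0 \<notin> set is"
  shows "schur_pf (map (\<lambda>i. (c i, b i)) is) = pf (pair_pf c b) (if even (length is) then is else 0 # is)"
  using assms
proof (induction "length is" arbitrary: "is" rule: less_induct)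
  case less
  let ?f = "\<lambda>i. (c i, b i)"
  have IH: "schur_pf (map ?f (remove_nth s js)) = pf (pair_pf c b) (if even (length (remove_nth s js)) then remove_nth s js else 0 # remove_nth s js)"
    if "s < length js" "length js \<le> length is" "set js \<subseteq> set is" for js s
    using that less.prems set_remove_nth_subset[of s js] by (intro less.hyps) auto
  consider "is = []" | i where "is = [i]" | i j where "is = [i, j]" | "length is \<ge> 3"
  proof -
    assume *: "is = [] \<Longrightarrow> thesis" "\<And>i. is = [i] \<Longrightarrow> thesis" "\<And>i j. is = [i, j] \<Longrightarrow> thesis" "3 \<le> length is \<Longrightarrow> thesis"
    show thesis
    proof (cases "length is \<ge> 3")
      case False
      hence "length is = 0 \<or> length is = Suc 0 \<or> length is = Suc (Suc 0)" by linarith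
      thus ?thesis using *(1-3) by (auto simp: length_Suc_conv)
    qed (use *(4) in simp)
  qed
  thus ?case
  proof cases
    case 1 thus ?thesis by simp
  next
    case 2 thus ?thesis by (simp add: pair_pf_def)
  next
    case 3 thus ?thesis using less.prems by (simp add: pair_pf_def del: schur_pf.simps(3))
  next
    case 4
    hence l: "length (map ?f is) \<ge> 3" by simp
    then obtain i js where "is": "is = i # js" by (cases "is") auto
    show ?thesis
    proof (cases "even (length is)")
      case True
      have "schur_pf (map ?f is) = (\<Sum>s<length js. (- 1) ^ s * schur_pf [?f i, map ?f js ! s] * schur_pf (map ?f (remove_nth s js)))"
        unfolding schur_pf_expand[OF l] using True by (simp add: "is" map_remove_nth)
      also have "\<dots> = (\<Sum>s<length js. (- 1) ^ s * pair_pf c b i (js ! s) * pf (pair_pf c b) (remove_nth s js))"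
        using True less.prems by (intro sum.cong refl arg_cong2[where f = "(*)"] IH[THEN trans]) (auto simp: "is" pair_pf_def)
      finally show ?thesis using True by (simp add: "is")
    next
      case False
      have "schur_pf (map ?f is) = (\<Sum>s<length is. (- 1) ^ s * schur_pf [map ?f is ! s] * schur_pf (map ?f (remove_nth s is)))"
        unfolding schur_pf_expand[OF l] using False by (simp add: map_remove_nth del: schur_pf.simps)
      also have "\<dots> = (\<Sum>s<length is. (- 1) ^ s * pair_pf c b 0 (is ! s) * pf (pair_pf c b) (remove_nth s is))"
        using False less.prems by (intro sum.cong refl arg_cong2[where f = "(*)"] IH[THEN trans]) (auto simp: pair_pf_def)
      finally show ?thesis using False by simp
    qed
  qed
qed

text \<open>The expansion reads only entries whose indices stand in list order. The array may
  therefore be redefined on and below the diagonal, which \<open>row_pf_eq_zero\<close> and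
  \<open>row_pf_append\<close> exploit.\<close>

lemma pf_cong_sorted:
  assumes "sorted_wrt R xs" "\<And>x y. x \<in> set xs \<Longrightarrow> y \<in> set xs \<Longrightarrow> R x y \<Longrightarrow> P x y = P' x y"
  shows "pf P xs = pf P' xs"
  using assms
proof (induction "length xs" arbitrary: xs rule: less_induct)
  case less
  show ?case
  proof (cases xs)
    case (Cons x ys)
    have "sorted_wrt R (remove_nth s ys)" if "s < length ys" for s
      using less.prems(1) Cons that
      by (auto simp: sorted_wrt_iff_nth_less[of _ "remove_nth s ys"] nth_remove_nth intro!: sorted_wrt_nth_less[of R ys])
    hence "pf P (remove_nth s ys) = pf P' (remove_nth s ys)" if "s < length ys" for s
      using that less.prems Cons set_remove_nth_subset[of s ys]
      by (intro less.hyps) (auto intro!: less.prems(2))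
    moreover have "P x (ys ! s) = P' x (ys ! s)" if "s < length ys" for s
      using less.prems Cons that by auto
    ultimately show ?thesis using Cons by (auto intro!: sum.cong)
  qed simp
qed

lemma pf_move:
  assumes "\<And>y. y \<in> set ys \<Longrightarrow> P y z + P z y = 0"
  shows "pf P (xs @ ys @ z # us) = (- 1) ^ length ys * pf P (xs @ z # ys @ us)"
  using assms
proof (induction ys arbitrary: xs)
  case (Cons y ys)
  have "pf P (xs @ (y # ys) @ z # us) = (- 1) ^ length ys * pf P ((xs @ [y]) @ z # ys @ us)"
    using Cons(1)[of "xs @ [y]"] Cons(2) by simp
  also have "pf P ((xs @ [y]) @ z # ys @ us) = - pf P (xs @ z # (y # ys) @ us)"
    using pf_swap[of P xs y z "ys @ us"] Cons(2)[of y] by (simp add: eq_neg_iff_add_eq_0)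
  finally show ?case by simp
qed simp

text \<open>With R the raising operator, the two-row Pfaffian is (1 - R) / (1 + R) applied to
  \<open>c a * d q\<close>, a finite expansion because \<open>d\<close> vanishes at negative
  subscripts. Applying 1 + R leaves 1 - R.\<close>

lemma schur_pf_pair_raise:
  assumes "\<And>r. r < 0 \<Longrightarrow> d r = 0"
  shows "schur_pf [(c, a), (d, q)] + schur_pf [(c, a + 1), (d, q - 1)] = c a * d q - c (a + 1) * d (q - 1)"
proof (cases "q \<ge> 1")
  case True
  have "(\<Sum>s=1..q. (- 1) ^ nat s * c (a + s) * d (q - s)) =
      - (c (a + 1) * d (q - 1)) + (\<Sum>s=2..q. (- 1) ^ nat s * c (a + s) * d (q - s))"
  proof -
    have "{1..q} = insert 1 {2..q}" using True by auto
    thus ?thesis by simp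
  qed
  also have "(\<Sum>s=2..q. (- 1) ^ nat s * c (a + s) * d (q - s)) =
      (\<Sum>s=1..q - 1. - ((- 1) ^ nat s * c (a + 1 + s) * d (q - 1 - s)))"
  proof (rule sum.reindex_bij_witness[where i = "\<lambda>s. s + 1" and j = "\<lambda>s. s - 1"])
    fix s :: int assume "s \<in> {2..q}"
    hence "nat s = Suc (nat (s - 1))" by auto
    hence "(- 1 :: 'a) ^ nat s = - ((- 1) ^ nat (s - 1))" by simp
    thus "- ((- 1) ^ nat (s - 1) * c (a + 1 + (s - 1)) * d (q - 1 - (s - 1))) = (- 1) ^ nat s * c (a + s) * d (q - s)"
      by simp
  qed auto
  finally have A: "(\<Sum>s=1..q. (- 1) ^ nat s * c (a + s) * d (q - s)) =
      - (c (a + 1) * d (q - 1)) - (\<Sum>s=1..q - 1. (- 1) ^ nat s * c (a + 1 + s) * d (q - 1 - s))"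
    by (simp only: sum_negf) simp
  show ?thesis unfolding schur_pf.simps A by (simp only: algebra_simps mult_2_right) simp
next
  case False
  thus ?thesis using assms[of "q - 1"] by simp
qed

text \<open>The defect left by \<open>pf_swap\<close> when the two exchanged rows carry the same
  sequence.\<close>

definition pair_sym :: "(int \<Rightarrow> 'a::comm_ring_1) \<Rightarrow> int \<Rightarrow> int \<Rightarrow> 'a"
  where "pair_sym c a b = schur_pf [(c, a), (c, b)] + schur_pf [(c, b), (c, a)]"

text \<open>By \<open>schur_pf_pair_raise\<close> the two orders of the rows contribute
  \<open>c a * c b - c (a + 1) * c (b - 1)\<close> and its negative.\<close>

lemma pair_sym_raise:
  assumes "\<And>r. r < 0 \<Longrightarrow> c r = 0"
  shows "pair_sym c (a + 1) (b - 1) = - pair_sym c a b"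
proof -
  have "pair_sym c a b + pair_sym c (a + 1) (b - 1) =
      (schur_pf [(c, a), (c, b)] + schur_pf [(c, a + 1), (c, b - 1)]) +
      (schur_pf [(c, b - 1), (c, a + 1)] + schur_pf [(c, b - 1 + 1), (c, a + 1 - 1)])"
    by (simp add: pair_sym_def del: schur_pf.simps)
  also have "\<dots> = 0"
    by (subst (1 2) schur_pf_pair_raise) (simp_all add: assms algebra_simps)
  finally show ?thesis by (simp add: eq_neg_iff_add_eq_0 add.commute)
qed

text \<open>Repeated raising reduces to the subscripts N = a + b and 0, where
  \<open>pair_sym\<close> is twice the coefficient of u^N in c(-u) c(u).\<close>

lemma pair_sym_eq_zero:
  assumes neg: "\<And>r. r < 0 \<Longrightarrow> c r = 0"
    and sum: "\<And>N. a + b = int N \<Longrightarrow> (\<Sum>s\<le>N. (- 1) ^ s * c (int s) * c (int N - int s)) = 0"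
  shows "pair_sym c a b = 0"
proof -
  have up: "pair_sym c (a + int j) (b - int j) = (- 1) ^ j * pair_sym c a b" for a b j
  proof (induction j)
    case (Suc j)
    have "pair_sym c (a + int j + 1) (b - int j - 1) = - pair_sym c (a + int j) (b - int j)"
      by (rule pair_sym_raise[OF neg])
    thus ?case using Suc by (simp add: algebra_simps)
  qed simp
  have 0: "pair_sym c (a + b) 0 = 0"
  proof (cases "a + b \<ge> 0")
    case True
    then obtain N where N: "a + b = int N" using zero_le_imp_eq_int by blast
    have eq: "(\<Sum>s=1..int N. (- 1) ^ nat s * c s * c (int N - s)) = (\<Sum>s=1..N. (- 1) ^ s * c (int s) * c (int N - int s))"
      by (rule sum.reindex_bij_witness[where i = int and j = nat]) auto
    have "pair_sym c (int N) 0 = c (int N) * c 0 + (c 0 * c (int N) + 2 * (\<Sum>s=1..N. (- 1) ^ s * c (int s) * c (int N - int s)))"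
      unfolding eq[symmetric] by (simp add: pair_sym_def)
    also have "\<dots> = 2 * (\<Sum>s\<le>N. (- 1) ^ s * c (int s) * c (int N - int s))"
      by (simp add: atMost_atLeast0 sum.atLeast_Suc_atMost[of 0 N] algebra_simps)
    finally show ?thesis using sum N by simp
  next
    case False thus ?thesis by (simp add: pair_sym_def neg)
  qed
  show ?thesis
  proof (cases "b \<ge> 0")
    case True
    hence "(- 1) ^ nat b * pair_sym c a b = 0" using up[of a "nat b" b] 0 by simp
    hence "(- 1) ^ nat b * ((- 1) ^ nat b * pair_sym c a b) = 0" by simp
    thus ?thesis by (simp flip: mult.assoc power_mult_distrib)
  next
    case False
    thus ?thesis using up[of "a + b" "nat (- b)" 0] 0 by simp
  qed
qed

subsection \<open>Pfaffians with a fixed sequence for each row\<close>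

definition row_pf :: "nat \<Rightarrow> (nat \<Rightarrow> int \<Rightarrow> 'a::comm_ring_1) \<Rightarrow> (nat \<Rightarrow> int) \<Rightarrow> 'a"
  where "row_pf m c b = schur_pf (map (\<lambda>i. (c i, b i)) [1..<Suc m])"

definition row_index :: "nat \<Rightarrow> nat list"
  where "row_index m = (if even m then [1..<Suc m] else [0..<Suc m])"

lemma row_index: "distinct (row_index m)" "sorted_wrt (<) (row_index m)" "set (row_index m) \<subseteq> {0..m}"
  "{1..m} \<subseteq> set (row_index m)"
  by (auto simp: row_index_def simp del: upt_Suc)

lemma row_pf_eq: "row_pf m c b = pf (pair_pf c b) (row_index m)"
  using schur_pf_eq_pf[of "[1..<Suc m]" c b]
  by (simp add: row_pf_def row_index_def upt_conv_Cons[of 0] del: upt_Suc)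

lemma row_pf_cong:
  assumes "\<And>i. 1 \<le> i \<Longrightarrow> i \<le> m \<Longrightarrow> c i = c' i \<and> b i = b' i"
  shows "row_pf m c b = row_pf m c' b'"
  unfolding row_pf_def using assms by (auto intro!: arg_cong[where f = schur_pf])

lemma row_pf_linear:
  assumes "1 \<le> p" "p \<le> m"
  shows "row_pf m (c(p := \<lambda>r. x * c1 r + y * c2 r)) b = x * row_pf m (c(p := c1)) b + y * row_pf m (c(p := c2)) b"
  unfolding row_pf_eq
proof (rule pf_linear[where p = p])
  show "p \<in> set (row_index m)" using assms row_index(4)[of m] by auto
qed (use assms in \<open>auto simp: row_index pair_pf_def algebra_simps sum.distrib sum_distrib_left\<close>)

lemma schur_pf_pair_shift:
  "schur_pf [(\<lambda>r. d (r - 1), a), e] = schur_pf [(d, a - 1), e]"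
  "(\<And>r. r < 0 \<Longrightarrow> d r = 0) \<Longrightarrow> schur_pf [e, (\<lambda>r. d (r - 1), a)] = schur_pf [e, (d, a - 1)]"
proof -
  show "schur_pf [(\<lambda>r. d (r - 1), a), e] = schur_pf [(d, a - 1), e]"
    by (cases e) (simp add: algebra_simps)
  assume d: "\<And>r. r < 0 \<Longrightarrow> d r = 0"
  obtain c q where e: "e = (c, q)" by (cases e)
  \<comment> \<open>The two sums differ at most in the term s = a, which contains
    \<open>d (-1)\<close>.\<close>
  have "(\<Sum>s=1..a. (- 1) ^ nat s * c (q + s) * d (a - s - 1)) = (\<Sum>s=1..a - 1. (- 1) ^ nat s * c (q + s) * d (a - s - 1))"
    by (rule sum.mono_neutral_right) (auto simp: d)
  thus "schur_pf [e, (\<lambda>r. d (r - 1), a)] = schur_pf [e, (d, a - 1)]"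
    by (simp add: e algebra_simps)
qed

lemma row_pf_shift:
  assumes "\<And>r. r < 0 \<Longrightarrow> d r = 0"
  shows "row_pf m (c(p := \<lambda>r. d (r - 1))) b = row_pf m (c(p := d)) (b(p := b p - 1))"
  unfolding row_pf_eq
proof (rule pf_cong)
  fix i j
  show "pair_pf (c(p := \<lambda>r. d (r - 1))) b i j = pair_pf (c(p := d)) (b(p := b p - 1)) i j"
    by (simp add: pair_pf_def schur_pf_pair_shift assms del: schur_pf.simps)
qed

lemma row_pf_eq_zero:
  assumes "1 \<le> p" "p \<le> m"
    and "\<And>i. i < p \<Longrightarrow> pair_pf c b i p = 0" "\<And>j. p < j \<Longrightarrow> j \<le> m \<Longrightarrow> pair_pf c b p j = 0"
  shows "row_pf m c b = 0"
proof -
  \<comment> \<open>Entries out of list order are replaced by 0; the Pfaffian does not read them,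
    and row and column \<open>p\<close> become zero.\<close>
  define Q where "Q = (\<lambda>i j. if i < j then pair_pf c b i j else 0)"
  have "row_pf m c b = pf Q (row_index m)"
    unfolding row_pf_eq by (rule pf_cong_sorted[OF row_index(2)]) (simp add: Q_def)
  also have "\<dots> = 0"
  proof (rule pf_zero_row[of _ p])
    show "p \<in> set (row_index m)" using assms row_index(4)[of m] by auto
    show "Q i p = 0 \<and> Q p i = 0" if "i \<in> set (row_index m)" "i \<noteq> p" for i
      using assms that row_index(3)[of m] by (auto simp: Q_def)
  qed (rule row_index)
  finally show ?thesis .
qed

text \<open>In a pair the earlier row only gains and the later row only loses. The first row thus
  occurs only at subscripts at least \<open>b 1\<close>; dually, in \<open>row_pf_last_zero\<close>
  the last row occurs only at subscripts at most \<open>b m\<close>.\<close>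

lemma row_pf_first_zero:
  assumes "1 \<le> m" "\<And>r. b 1 \<le> r \<Longrightarrow> c 1 r = 0"
  shows "row_pf m c b = 0"
  by (rule row_pf_eq_zero[of 1]) (use assms in \<open>auto simp: pair_pf_def\<close>)

lemma row_pf_last_zero:
  assumes "1 \<le> m" "b m < 0" "\<And>r. r < 0 \<Longrightarrow> c m r = 0"
  shows "row_pf m c b = 0"
  by (rule row_pf_eq_zero[of m]) (use assms in \<open>auto simp: pair_pf_def\<close>)

lemma pf_two_equal_rows:
  assumes tf: "\<And>x::'a::comm_ring_1. 2 * x = 0 \<Longrightarrow> x = 0" and "P a a = (0 :: 'a)"
  shows "pf P (a # a # ys) = 0"
  using pf_swap_first[of P a a ys] assms by (simp flip: mult_2)

text \<open>A last row with subscript 0 pairs with row j in the entry \<open>c j (b j)\<close>, just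
  like the auxiliary row 0. For odd m it thus takes over the role of row 0. For even m rows 0 and
  \<open>Suc m\<close> are proportional apart from the entry 1 pairing them with each other, so only
  the terms with this entry survive.\<close>

lemma row_pf_append:
  fixes c :: "nat \<Rightarrow> int \<Rightarrow> 'a::comm_ring_1"
  assumes tf: "\<And>x::'a. 2 * x = 0 \<Longrightarrow> x = 0"
    and "b (Suc m) = 0" "c (Suc m) 0 = 1" "\<And>r. r < 0 \<Longrightarrow> c (Suc m) r = 0"
  shows "row_pf (Suc m) c b = row_pf m c b"
proof -
  define z where "z = Suc m"
  \<comment> \<open>The completion is antisymmetric between \<open>z\<close> and the other rows, so
    that \<open>pf_move\<close> can bring \<open>z\<close> to the front, and zero on the diagonal,
    so that \<open>pf_two_equal_rows\<close> applies to row 0 taken twice.\<close>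
  define Q where "Q = (\<lambda>i j. if i = j then 0 else if i = z then - pair_pf c b j z else pair_pf c b i j)"
  let ?ys = "[1..<Suc m]"
  have Q: "row_pf l c b = pf Q (row_index l)" if "l \<le> z" for l
    unfolding row_pf_eq using that row_index(3)[of l]
    by (intro pf_cong_sorted[OF row_index(2)]) (fastforce simp: Q_def)
  have anti: "Q y z + Q z y = 0" if "y \<in> set ?ys" for y using that by (auto simp: Q_def z_def)
  have zR: "pf Q (z # R) = - pf Q (0 # R)" if "set R \<subseteq> set ?ys" for R
  proof -
    have "Q z (R ! s) = - Q 0 (R ! s)" if "s < length R" for s
    proof -
      have "R ! s \<in> set ?ys" using \<open>set R \<subseteq> set ?ys\<close> that nth_mem by blast
      thus ?thesis using assms by (auto simp: Q_def z_def pair_pf_def)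
    qed
    thus ?thesis by (simp add: sum_negf[symmetric])
  qed
  have ri: "row_index (Suc m) = (if even m then 0 # ?ys @ [z] else ?ys @ [z])"
    "row_index m = (if even m then ?ys else 0 # ?ys)"
    by (simp_all add: row_index_def z_def upt_conv_Cons[of 0] del: upt_Suc) simp_all
  show ?thesis
  proof (cases "even m")
    case True
    have "row_pf (Suc m) c b = pf Q ([0] @ ?ys @ z # [])"
      using True by (simp add: Q z_def ri del: upt_Suc)
    also have "\<dots> = pf Q (0 # z # ?ys)"
      using pf_move[of ?ys Q z "[0]" "[]", OF anti] True by simp
    also have "\<dots> = Q 0 z * pf Q ?ys - (\<Sum>s<length ?ys. (- 1) ^ s * Q 0 (?ys ! s) * pf Q (z # remove_nth s ?ys))"
      by (simp add: sum.lessThan_Suc_shift algebra_simps sum_negf del: sum.lessThan_Suc upt_Suc)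
    also have "(\<Sum>s<length ?ys. (- 1) ^ s * Q 0 (?ys ! s) * pf Q (z # remove_nth s ?ys)) =
       - (\<Sum>s<length ?ys. (- 1) ^ s * Q 0 (?ys ! s) * pf Q (0 # remove_nth s ?ys))"
      unfolding sum_negf[symmetric] using zR[OF set_remove_nth_subset] by (intro sum.cong) (simp_all del: upt_Suc pf.simps)
    also have "\<dots> = pf Q (0 # 0 # ?ys) - Q 0 0 * pf Q ?ys"
      by (simp add: sum.lessThan_Suc_shift algebra_simps sum_negf del: sum.lessThan_Suc upt_Suc)
    also have "\<dots> = 0" by (subst pf_two_equal_rows[OF tf]) (simp_all add: Q_def)
    also have "Q 0 z * pf Q ?ys - 0 = row_pf m c b"
    proof -
      have "Q 0 z = 1" using assms by (simp add: Q_def pair_pf_def z_def)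
      thus ?thesis using True by (simp add: Q z_def ri del: upt_Suc)
    qed
    finally show ?thesis .
  next
    case False
    have "row_pf (Suc m) c b = pf Q ([] @ ?ys @ z # [])"
      using False by (simp add: Q z_def ri del: upt_Suc)
    also have "\<dots> = - pf Q (z # ?ys)"
      using pf_move[of ?ys Q z "[]" "[]", OF anti] False by simp
    also have "\<dots> = pf Q (0 # ?ys)" using zR[of ?ys] by simp
    also have "\<dots> = row_pf m c b"
      using False by (simp add: Q z_def ri del: upt_Suc)
    finally show ?thesis .
  qed
qed

text \<open>\<open>H\<close> is the Pfaffian with rows \<open>p\<close> and \<open>Suc p\<close>
  deleted, hence independent of their subscripts. The entries of the two rows against each other add
  up to \<open>pair_sym\<close>.\<close>

lemma row_pf_swap:
  assumes p: "1 \<le> p" "Suc p \<le> m" and c: "c p = c (Suc p)"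
  shows "\<exists>H. (\<forall>b. row_pf m c b + row_pf m c (b \<circ> transpose p (Suc p)) = pair_sym (c p) (b p) (b (Suc p)) * H b) \<and>
    (\<forall>b b'. (\<forall>i. i \<noteq> p \<longrightarrow> i \<noteq> Suc p \<longrightarrow> b i = b' i) \<longrightarrow> H b = H b')"
proof -
  let ?t = "transpose p (Suc p)"
  define lo :: nat where "lo = (if even m then 1 else 0)"
  define xs ys where "xs = [lo..<p]" and "ys = [Suc (Suc p)..<Suc m]"
  have ri: "row_index m = xs @ p # Suc p # ys"
  proof -
    have "row_index m = [lo..<Suc m]" by (simp add: row_index_def lo_def)
    also have "\<dots> = [lo..<p] @ [p..<Suc m]" using p upt_add_eq_append[of lo p "Suc m - p"] by (simp add: lo_def)
    also have "[p..<Suc m] = p # Suc p # ys" using p by (simp add: upt_conv_Cons ys_def)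
    finally show ?thesis by (simp add: xs_def)
  qed
  have map: "map ?t (row_index m) = xs @ Suc p # p # ys"
  proof -
    have "map ?t xs = xs" "map ?t ys = ys" by (auto intro!: map_idI simp: xs_def ys_def transpose_def)
    thus ?thesis by (simp add: ri)
  qed
  define H where "H = (\<lambda>b. pf (pair_pf c b) (xs @ ys))"
  have 1: "row_pf m c b + row_pf m c (b \<circ> ?t) = pair_sym (c p) (b p) (b (Suc p)) * H b" for b
  proof -
    have "pair_pf c (b \<circ> ?t) i j = pair_pf c b (?t i) (?t j)" for i j
    proof -
      have "c (?t i) = c i" for i using c by (auto simp: transpose_def)
      moreover have "?t i = 0 \<longleftrightarrow> i = 0" using p by (auto simp: transpose_def)
      ultimately show ?thesis by (simp add: pair_pf_def del: schur_pf.simps)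
    qed
    hence "pair_pf c (b \<circ> ?t) = (\<lambda>i j. pair_pf c b (?t i) (?t j))" by (intro ext)
    hence "row_pf m c (b \<circ> ?t) = pf (\<lambda>i j. pair_pf c b (?t i) (?t j)) (row_index m)"
      by (simp add: row_pf_eq)
    also have "\<dots> = pf (pair_pf c b) (xs @ Suc p # p # ys)"
      by (simp add: map flip: pf_map)
    moreover have "pair_pf c b p (Suc p) + pair_pf c b (Suc p) p = pair_sym (c p) (b p) (b (Suc p))"
      using p c by (simp add: pair_pf_def pair_sym_def del: schur_pf.simps)
    ultimately show ?thesis using pf_swap[of "pair_pf c b" xs p "Suc p" ys]
      by (simp add: row_pf_eq ri H_def)
  qed
  have 2: "H b = H b'" if "\<And>i. i \<noteq> p \<Longrightarrow> i \<noteq> Suc p \<Longrightarrow> b i = b' i" for b b'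
    unfolding H_def
  proof (rule pf_cong)
    fix i j assume "i \<in> set (xs @ ys)" "j \<in> set (xs @ ys)"
    hence "b i = b' i" "b j = b' j" using that by (auto simp: xs_def ys_def)
    thus "pair_pf c b i j = pair_pf c b' i j" by (simp add: pair_pf_def)
  qed
  show ?thesis
  proof (intro exI conjI allI impI)
    show "row_pf m c b + row_pf m c (b \<circ> ?t) = pair_sym (c p) (b p) (b (Suc p)) * H b" for b by (rule 1)
    show "H b = H b'" if "\<forall>i. i \<noteq> p \<longrightarrow> i \<noteq> Suc p \<longrightarrow> b i = b' i" for b b'
      using that by (intro 2) blast
  qed
qed

section \<open>Raising operators\<close>

text \<open>\<open>raise i j\<close> is the action of the raising operator \<open>R\<^sub>i\<^sub>j\<close> on subscripts, and \<open>raise_sum D\<close> is the product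
  of all \<open>1 + R\<^sub>i\<^sub>j\<close> with \<open>(i, j) \<in> D\<close>.\<close>

definition raise_sum :: "(nat \<times> nat) set \<Rightarrow> ((nat \<Rightarrow> int) \<Rightarrow> 'a::comm_ring_1) \<Rightarrow> (nat \<Rightarrow> int) \<Rightarrow> 'a"
  where "raise_sum D g b = (\<Sum>I\<in>Pow D. g (\<lambda>i. b i + shift_I I i))"

definition raise :: "nat \<Rightarrow> nat \<Rightarrow> (nat \<Rightarrow> int) \<Rightarrow> nat \<Rightarrow> int"
  where "raise i j b = b(i := b i + 1, j := b j - 1)"

lemma shift_I_insert:
  assumes "finite I" "(i, j) \<notin> I" "i \<noteq> j"
  shows "(\<lambda>s. b s + shift_I (insert (i, j) I) s) = raise i j (\<lambda>s. b s + shift_I I s)"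
proof
  fix s
  have fin: "finite {x. (s, x) \<in> I}" "finite {x. (x, s) \<in> I}"
    using finite_vimageI[OF assms(1), of "Pair s"] finite_vimageI[OF assms(1), of "\<lambda>x. (x, s)"]
    by (simp_all add: vimage_def inj_on_def)
  have "{x. (s, x) \<in> insert (i, j) I} = (if s = i then insert j {x. (s, x) \<in> I} else {x. (s, x) \<in> I})"
    "{x. (x, s) \<in> insert (i, j) I} = (if s = j then insert i {x. (x, s) \<in> I} else {x. (x, s) \<in> I})"
    by auto
  thus "b s + shift_I (insert (i, j) I) s = raise i j (\<lambda>s. b s + shift_I I s) s"
    using assms fin by (auto simp: shift_I_def raise_def)
qed

lemma raise_add: "raise i j (\<lambda>s. b s + a s) = (\<lambda>s. raise i j b s + a s)"
  by (auto simp: raise_def fun_eq_iff)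

lemma raise_sum_insert:
  assumes "finite D" "(i, j) \<notin> D" "i \<noteq> j"
  shows "raise_sum (insert (i, j) D) g b = raise_sum D (\<lambda>b. g b + g (raise i j b)) b"
proof -
  have disj: "Pow D \<inter> insert (i, j) ` Pow D = {}" using assms by auto
  have "inj_on (insert (i, j)) (Pow D)"
    using assms(2) by (intro inj_onI) (metis PowD insert_ident subsetD)
  hence "raise_sum (insert (i, j) D) g b =
      raise_sum D g b + (\<Sum>I\<in>Pow D. g (\<lambda>s. b s + shift_I (insert (i, j) I) s))"
    using assms by (simp add: raise_sum_def Pow_insert sum.union_disjoint[OF _ _ disj] sum.reindex)
  also have "(\<Sum>I\<in>Pow D. g (\<lambda>s. b s + shift_I (insert (i, j) I) s)) =
      (\<Sum>I\<in>Pow D. g (raise i j (\<lambda>s. b s + shift_I I s)))"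
    using assms finite_subset by (intro sum.cong refl arg_cong[where f = g] shift_I_insert) auto
  finally show ?thesis by (simp add: raise_sum_def sum.distrib)
qed

lemma raise_sum_raise: "raise_sum D (\<lambda>b. g (raise i j b)) b = raise_sum D g (raise i j b)"
  by (simp add: raise_sum_def raise_add)

lemma raise_sum_add: "raise_sum D (\<lambda>b. g b + h b) b = raise_sum D g b + raise_sum D h b"
  by (simp add: raise_sum_def sum.distrib)

lemma raise_sum_mult: "raise_sum D (\<lambda>b. x * g b) b = x * raise_sum D g b"
  by (simp add: raise_sum_def sum_distrib_left)

lemma shift_I_image:
  assumes "bij t"
  shows "shift_I (map_prod t t ` I) (t s) = shift_I I s"
proof -
  have inj: "t x = t y \<longleftrightarrow> x = y" for x y using assms by (auto simp: bij_def inj_def)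
  have surj: "\<exists>x. y = t x" for y using assms by (metis bij_pointE)
  have "{j. (t s, j) \<in> map_prod t t ` I} = t ` {j. (s, j) \<in> I}"
    "{i. (i, t s) \<in> map_prod t t ` I} = t ` {i. (i, s) \<in> I}"
    using inj surj by (auto simp: image_iff map_prod_def split_beta) (metis fst_conv snd_conv)+
  moreover have "inj_on t A" for A using inj by (auto simp: inj_on_def)
  ultimately show ?thesis by (simp add: shift_I_def card_image)
qed

text \<open>An involution of the rows that preserves \<open>D\<close> permutes the subsets of
  \<open>D\<close>, and the shifts are permuted along with them.\<close>

lemma raise_sum_comp:
  assumes t: "bij t" "\<And>x. t (t x) = x" and D: "map_prod t t ` D = D"
  shows "raise_sum D (\<lambda>b. g (b \<circ> t)) b = raise_sum D g (b \<circ> t)"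
proof -
  let ?f = "\<lambda>I. map_prod t t ` I"
  have f: "?f (?f I) = I" for I
    by (auto simp: image_image map_prod_def t(2) split_beta)
  have fD: "?f I \<in> Pow D" if "I \<in> Pow D" for I
    using image_mono[of I D "map_prod t t"] that D by auto
  show ?thesis
    unfolding raise_sum_def
  proof (rule sum.reindex_bij_witness[where i = ?f and j = ?f])
    fix I
    have "shift_I (?f I) s = shift_I I (t s)" for s
      using shift_I_image[OF t(1), of I "t s"] t(2) by simp
    thus "g (\<lambda>i. (b \<circ> t) i + shift_I (?f I) i) = g ((\<lambda>i. b i + shift_I I i) \<circ> t)"
      by (simp add: comp_def)
  qed (use f fD in auto)
qed

text \<open>Row \<open>m\<close> is never the raised row of a pair in \<open>D\<close>, so its
  subscript stays negative in every summand.\<close>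

lemma raise_sum_last_zero:
  assumes "1 \<le> m" "b m < 0" "\<And>r. r < 0 \<Longrightarrow> c m r = 0" "\<And>j. (m, j) \<notin> D"
  shows "raise_sum D (row_pf m c) b = 0"
  unfolding raise_sum_def
proof (rule sum.neutral, rule ballI)
  fix I assume "I \<in> Pow D"
  hence "{j. (m, j) \<in> I} = {}" using assms(4) by auto
  hence "shift_I I m \<le> 0" by (simp only: shift_I_def) simp
  thus "row_pf m c (\<lambda>i. b i + shift_I I i) = 0"
    using assms by (intro row_pf_last_zero) auto
qed

lemma raise_sum_first_zero:
  assumes "1 \<le> m" "\<And>r. r \<ge> b 1 \<Longrightarrow> c 1 r = 0" "\<And>j. (j, 1) \<notin> D"
  shows "raise_sum D (row_pf m c) b = 0"
  unfolding raise_sum_def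
proof (rule sum.neutral, rule ballI)
  fix I assume "I \<in> Pow D"
  hence "{j. (j, 1) \<in> I} = {}" using assms(3) by auto
  hence "shift_I I 1 \<ge> 0" by (simp only: shift_I_def) simp
  thus "row_pf m c (\<lambda>i. b i + shift_I I i) = 0"
    using assms by (intro row_pf_first_zero) auto
qed

lemma raise_sum_all_pairs:
  fixes c :: "nat \<Rightarrow> int \<Rightarrow> 'a::comm_ring_1"
  assumes tf: "\<And>x::'a. 2 * x = 0 \<Longrightarrow> x = 0"
    and c: "\<And>i. 1 \<le> i \<Longrightarrow> i \<le> m \<Longrightarrow> c i 0 = 1" "\<And>i r. 1 \<le> i \<Longrightarrow> i \<le> m \<Longrightarrow> r < 0 \<Longrightarrow> c i r = 0"
  shows "raise_sum {(i, j). 1 \<le> i \<and> i < j \<and> j \<le> m} (row_pf m c) (\<lambda>_. 0) = 1"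
  using c
proof (induction m)
  case 0
  have "{(i, j). 1 \<le> i \<and> i < j \<and> j \<le> (0::nat)} = {}" by auto
  hence "Pow {(i, j). 1 \<le> i \<and> i < j \<and> j \<le> (0::nat)} = {{}}" by blast
  thus ?case by (simp only: raise_sum_def row_pf_def) simp
next
  case (Suc m)
  let ?D = "\<lambda>m::nat. {(i, j). 1 \<le> i \<and> i < j \<and> j \<le> m}"
  have fin: "finite (?D n)" for n by (rule finite_subset[of _ "{1..n} \<times> {1..n}"]) auto
  have "raise_sum (?D (Suc m)) (row_pf (Suc m) c) (\<lambda>_. 0) = (\<Sum>I\<in>Pow (?D m). row_pf (Suc m) c (\<lambda>i. 0 + shift_I I i))"
    unfolding raise_sum_def
  proof (rule sum.mono_neutral_right)
    show "\<forall>I\<in>Pow (?D (Suc m)) - Pow (?D m). row_pf (Suc m) c (\<lambda>i. 0 + shift_I I i) = 0"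
    proof
      fix I assume I: "I \<in> Pow (?D (Suc m)) - Pow (?D m)"
      then obtain i j where ij: "(i, j) \<in> I" "(i, j) \<notin> ?D m" "(i, j) \<in> ?D (Suc m)" by auto
      hence j: "j = Suc m" by auto
      have "{j. (Suc m, j) \<in> I} = {}" using I by auto
      moreover have "finite I" using I fin finite_subset by blast
      hence "finite {i. (i, Suc m) \<in> I}"
        using finite_vimageI[of I "\<lambda>x. (x, Suc m)"] by (simp add: vimage_def inj_on_def)
      hence "card {i. (i, Suc m) \<in> I} > 0" using ij j by (auto simp: card_gt_0_iff)
      ultimately have "shift_I I (Suc m) < 0" by (simp only: shift_I_def) simp
      thus "row_pf (Suc m) c (\<lambda>i. 0 + shift_I I i) = 0"
        using Suc.prems by (intro row_pf_last_zero) auto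
    qed
  qed (use fin in auto)
  also have "\<dots> = (\<Sum>I\<in>Pow (?D m). row_pf m c (\<lambda>i. 0 + shift_I I i))"
  proof (intro sum.cong refl row_pf_append[OF tf])
    fix I assume "I \<in> Pow (?D m)"
    hence "{j. (Suc m, j) \<in> I} = {}" "{i. (i, Suc m) \<in> I} = {}" by auto
    thus "0 + shift_I I (Suc m) = 0" by (simp only: shift_I_def card.empty)
  qed (use Suc.prems in auto)
  also have "\<dots> = 1" using Suc by (simp add: raise_sum_def)
  finally show ?case .
qed

lemma transpose_Suc: "bij (transpose p (Suc p))" "transpose p (Suc p) (transpose p (Suc p) x) = x"
  by simp_all

text \<open>Let \<open>\<tau>\<close> exchange the rows \<open>p\<close> and \<open>p + 1\<close>. The symmetrization of the Pfaffian under \<open>\<tau>\<close> changes sign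
  under \<open>R\<^sub>p\<^sub>,\<^sub>p\<^sub>+\<^sub>1\<close>, while \<open>R\<^sub>p\<^sub>,\<^sub>p\<^sub>+\<^sub>1\<close> maps \<open>b\<close> to \<open>b \<circ> \<tau>\<close>; so the symmetrized sum equals its own negative.\<close>

lemma raise_sum_equal_rows_pair:
  fixes c :: "nat \<Rightarrow> int \<Rightarrow> 'a::comm_ring_1"
  assumes tf: "\<And>x::'a. 2 * x = 0 \<Longrightarrow> x = 0"
    and p: "1 \<le> p" "Suc p \<le> m" and c: "c p = c (Suc p)" "\<And>r. r < 0 \<Longrightarrow> c p r = 0"
    and D: "finite D" "(p, Suc p) \<in> D" "map_prod (transpose p (Suc p)) (transpose p (Suc p)) ` (D - {(p, Suc p)}) = D - {(p, Suc p)}"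
    and b: "b (Suc p) = b p + 1"
  shows "raise_sum D (row_pf m c) b = 0"
proof -
  let ?t = "transpose p (Suc p)" and ?D = "D - {(p, Suc p)}" and ?g = "row_pf m c"
  from row_pf_swap[of p m c, OF p c(1)]
  obtain H where H': "(\<forall>b. ?g b + ?g (b \<circ> ?t) = pair_sym (c p) (b p) (b (Suc p)) * H b) \<and>
    (\<forall>b b'. (\<forall>i. i \<noteq> p \<longrightarrow> i \<noteq> Suc p \<longrightarrow> b i = b' i) \<longrightarrow> H b = H b')" ..
  note H = H'[THEN conjunct1, rule_format] H'[THEN conjunct2, rule_format]
  define h where "h = (\<lambda>b. ?g b + ?g (b \<circ> ?t))"
  have h: "h (raise p (Suc p) b) = - h b" for b
  proof -
    have "H (raise p (Suc p) b) = H b" by (rule H(2)) (simp add: raise_def)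
    thus ?thesis unfolding h_def H(1) by (simp add: raise_def pair_sym_raise[OF c(2)])
  qed
  have bt: "raise p (Suc p) b = b \<circ> ?t" using b by (auto simp: raise_def fun_eq_iff transpose_def)
  have eq: "raise_sum ?D h b = raise_sum ?D ?g b + raise_sum ?D ?g (b \<circ> ?t)" for b
    unfolding h_def raise_sum_add by (simp add: raise_sum_comp[OF transpose_Suc D(3)])
  have "b \<circ> ?t \<circ> ?t = b" by (auto simp: fun_eq_iff)
  hence "raise_sum ?D h b = raise_sum ?D h (b \<circ> ?t)" unfolding eq by simp
  also have "\<dots> = raise_sum ?D (\<lambda>b. h (raise p (Suc p) b)) b"
    using raise_sum_raise[of ?D h p "Suc p" b] by (simp only: bt)
  also have "\<dots> = - raise_sum ?D h b"
    unfolding h by (simp add: raise_sum_def sum_negf)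
  finally have "raise_sum ?D h b + raise_sum ?D h b = 0" by (rule eq_neg_iff_add_eq_0[THEN iffD1])
  hence "2 * raise_sum ?D h b = 0" by (simp only: mult_2)
  hence "raise_sum ?D h b = 0" by (rule tf)
  hence "raise_sum ?D ?g b + raise_sum ?D ?g (b \<circ> ?t) = 0" by (simp only: eq)
  moreover have "raise_sum D ?g b = raise_sum (insert (p, Suc p) ?D) ?g b"
    using D(2) by (simp add: insert_absorb)
  moreover have "\<dots> = raise_sum ?D (\<lambda>b. ?g b + ?g (raise p (Suc p) b)) b"
    using D(1) by (intro raise_sum_insert) auto
  moreover have "\<dots> = raise_sum ?D ?g b + raise_sum ?D ?g (b \<circ> ?t)"
    unfolding raise_sum_add using raise_sum_raise[of ?D ?g p "Suc p" b] by (simp only: bt)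
  ultimately show ?thesis by simp
qed

text \<open>Exchanging the two rows fixes both \<open>D\<close> and \<open>b\<close>, so twice the
  sum equals its symmetrization. Rows \<open>p\<close> and \<open>Suc p\<close> are never lowered,
  so the sum of their subscripts stays at least \<open>2 * b p\<close>, where
  \<open>pair_sym\<close> vanishes.\<close>

lemma raise_sum_equal_rows:
  fixes c :: "nat \<Rightarrow> int \<Rightarrow> 'a::comm_ring_1"
  assumes tf: "\<And>x::'a. 2 * x = 0 \<Longrightarrow> x = 0"
    and p: "1 \<le> p" "Suc p \<le> m" and c: "c p = c (Suc p)"
      "\<And>x y. x + y \<ge> 2 * b p \<Longrightarrow> pair_sym (c p) x y = 0"
    and D: "map_prod (transpose p (Suc p)) (transpose p (Suc p)) ` D = D" "\<And>j. (j, p) \<notin> D" "\<And>j. (j, Suc p) \<notin> D"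
    and b: "b (Suc p) = b p"
  shows "raise_sum D (row_pf m c) b = 0"
proof -
  let ?t = "transpose p (Suc p)" and ?g = "row_pf m c"
  from row_pf_swap[of p m c, OF p c(1)]
  obtain H where "(\<forall>b. ?g b + ?g (b \<circ> ?t) = pair_sym (c p) (b p) (b (Suc p)) * H b) \<and>
    (\<forall>b b'. (\<forall>i. i \<noteq> p \<longrightarrow> i \<noteq> Suc p \<longrightarrow> b i = b' i) \<longrightarrow> H b = H b')" ..
  note H = this[THEN conjunct1, rule_format]
  have bt: "b \<circ> ?t = b"
  proof
    show "(b \<circ> ?t) x = b x" for x using b by (simp add: transpose_def)
  qed
  have "2 * raise_sum D ?g b = raise_sum D ?g b + raise_sum D ?g (b \<circ> ?t)"
    unfolding bt by simp
  also have "\<dots> = raise_sum D (\<lambda>b. ?g b + ?g (b \<circ> ?t)) b"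
    unfolding raise_sum_add using raise_sum_comp[OF transpose_Suc D(1), of ?g b] by simp
  also have "\<dots> = 0"
    unfolding raise_sum_def H
  proof (rule sum.neutral, rule ballI)
    fix I assume "I \<in> Pow D"
    hence "{i. (i, p) \<in> I} = {}" "{i. (i, Suc p) \<in> I} = {}" using D by auto
    hence "shift_I I p \<ge> 0" "shift_I I (Suc p) \<ge> 0" by (simp_all only: shift_I_def) simp_all
    thus "pair_sym (c p) (b p + shift_I I p) (b (Suc p) + shift_I I (Suc p)) * H (\<lambda>i. b i + shift_I I i) = 0"
      using b c(2)[of "b p + shift_I I p" "b (Suc p) + shift_I I (Suc p)"] by simp
  qed
  finally show ?thesis by (rule tf)
qed

section \<open>Theta polynomials\<close>

definition fps_map :: "('a \<Rightarrow> 'b) \<Rightarrow> 'a::comm_ring_1 fps \<Rightarrow> 'b::comm_ring_1 fps"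
  where "fps_map h f = Abs_fps (\<lambda>n. h (fps_nth f n))"

lemma fps_nth_map [simp]: "fps_nth (fps_map h f) n = h (fps_nth f n)"
  by (simp add: fps_map_def)

lemma fps_map_subst:
  fixes \<sigma> :: "var \<Rightarrow> var"
  assumes "finite_fibres \<sigma>"
  shows "fps_map (mps_subst \<sigma> \<epsilon>) (f * g) = fps_map (mps_subst \<sigma> \<epsilon>) f * fps_map (mps_subst \<sigma> \<epsilon>) g"
    "fps_map (mps_subst \<sigma> \<epsilon>) (lin_fps a) = lin_fps (mps_subst \<sigma> \<epsilon> a)"
    "fps_map (mps_subst \<sigma> \<epsilon>) (geom_fps a) = geom_fps (mps_subst \<sigma> \<epsilon> a)"
    "fps_map (mps_subst \<sigma> \<epsilon>) 1 = 1"
  unfolding fps_map_def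
  using subst_fps_mult[OF assms] subst_fps_lin[OF assms] subst_fps_geom[OF assms] subst_fps_one[OF assms] by auto

lemma fps_map_subst_prod:
  fixes \<sigma> :: "var \<Rightarrow> var"
  assumes "finite_fibres \<sigma>"
  shows "fps_map (mps_subst \<sigma> \<epsilon>) (prod F A) = (\<Prod>i\<in>A. fps_map (mps_subst \<sigma> \<epsilon>) (F i))"
  by (induction A rule: infinite_finite_induct) (simp_all add: fps_map_subst[OF assms])

lemma lin_geom_minus: "lin_fps a * geom_fps (- a) = 1"
  using lin_minus_geom[of "- a"] by simp

subsection \<open>The reflections acting on the variables t\<close>

definition t_var :: "nat \<Rightarrow> var \<Rightarrow> var"
  where "t_var i v = (if i = 0
    then (case v of VX j \<Rightarrow> if j = 0 then VX 0 else if j = 1 then VT 1 else VX (j - 1) | _ \<Rightarrow> v)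
    else (case v of VT j \<Rightarrow> VT (transpose i (i + 1) j) | _ \<Rightarrow> v))"

definition t_sgn :: "nat \<Rightarrow> var \<Rightarrow> int"
  where "t_sgn i v = (if i = 0 \<and> (v = VX 1 \<or> v = VT 1) then - 1 else 1)"

text \<open>Unlike \<^const>\<open>st\<close>, with which it agrees on \<^const>\<open>Rinf\<close>, this is a substitution in power series:
  the reflection with number 0 maps \<open>x\<^sub>1, x\<^sub>2, x\<^sub>3, \<dots>\<close> to \<open>- t\<^sub>1, x\<^sub>1, x\<^sub>2, \<dots>\<close>.\<close>

definition t_refl :: "nat \<Rightarrow> var mps \<Rightarrow> var mps"
  where "t_refl i = mps_subst (t_var i) (t_sgn i)"

lemma finite_fibres_t_var: "finite_fibres (t_var i)"
  by (rule finite_fibresI[where F = "\<lambda>v. {v, t_var i v, VX 0, VX 1} \<union> (case v of VX j \<Rightarrow> {VX (Suc j)} | _ \<Rightarrow> {})"])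
     (auto simp: t_var_def split: var.splits)

lemmas subst_hom = subst_mult subst_add subst_one subst_zero subst_uminus subst_sum

lemmas t_refl_hom = subst_hom[OF finite_fibres_t_var[of i], where \<epsilon> = "t_sgn i", folded t_refl_def] for i

lemma t_refl_diff: "t_refl i (f - g) = t_refl i f - t_refl i g"
  using t_refl_hom(2)[of i "f - g" g] by simp

lemmas fps_map_t_refl = fps_map_subst[OF finite_fibres_t_var[of i], where \<epsilon> = "t_sgn i", folded t_refl_def]
  fps_map_subst_prod[OF finite_fibres_t_var[of i], where \<epsilon> = "t_sgn i", folded t_refl_def] for i

lemma t_refl_Var:
  "t_refl i (zv j) = zv j"
  "i \<ge> 1 \<Longrightarrow> t_refl i (xv j) = xv j"
  "i \<ge> 1 \<Longrightarrow> t_refl i (tv j) = tv (transpose i (i + 1) j)"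
  "t_refl 0 (xv (Suc 0)) = - tv (Suc 0)" "j \<ge> 1 \<Longrightarrow> t_refl 0 (xv (Suc j)) = xv j"
  "t_refl 0 (tv (Suc 0)) = - tv (Suc 0)" "j \<noteq> 1 \<Longrightarrow> t_refl 0 (tv j) = tv j"
  by (simp_all add: t_refl_def subst_Var[OF finite_fibres_t_var] t_var_def t_sgn_def)

lemma t_refl_Q_Suc:
  assumes "i \<ge> 1"
  shows "fps_map (t_refl i) Q_gen = Q_gen"
proof (rule fps_ext)
  show "fps_nth (fps_map (t_refl i) Q_gen) n = fps_nth Q_gen n" for n
    using subst_Q[OF finite_fibres_t_var, of i "t_sgn i" n] t_refl_Var(2)[OF assms]
    by (simp add: t_refl_def Qr_def)
qed

text \<open>The substitution inserts - t_1 in front of the sequence of x variables. On truncations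
  it maps the product of N + 1 factors to the new factor times the product of N factors, and the
  limit is taken coefficientwise.\<close>

lemma t_refl_Q_0: "fps_map (t_refl 0) Q_gen = lin_fps (- tv 1) * geom_fps (- tv 1) * Q_gen"
proof (rule fps_ext)
  fix r
  let ?C = "lin_fps (- tv 1) * geom_fps (- tv 1)"
  have "fps_map (t_refl 0) (Q_trunc (Suc N)) = ?C * Q_trunc N" for N
  proof (induction N)
    case 0
    have "Q_trunc (Suc 0) = lin_fps (xv (Suc 0)) * geom_fps (xv (Suc 0))" "Q_trunc 0 = 1"
      by (simp_all add: Q_trunc_def)
    thus ?case using t_refl_Var(4) by (simp add: fps_map_t_refl)
  next
    case (Suc N)
    show ?case
      unfolding Q_trunc_Suc[of "Suc N"] fps_map_t_refl Suc
      by (simp only: t_refl_Var(5)[of "Suc N"] Q_trunc_Suc[of N] mult.assoc)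
  qed
  from arg_cong[OF this, where f = "\<lambda>f. fps_nth f r"]
  have tr: "t_refl 0 (fps_nth (Q_trunc (Suc N)) r) = fps_nth (?C * Q_trunc N) r" for N
    by simp
  have "converges_to (\<lambda>N. fps_nth (?C * Q_trunc N) r) (fps_nth (?C * Q_gen) r)"
    unfolding fps_mult_nth[of ?C]
    by (intro converges_to_sum converges_to_mult converges_to_const Q_converges[unfolded Qr_def]) simp
  moreover have "converges_to (\<lambda>N. t_refl 0 (fps_nth (Q_trunc (Suc N)) r)) (t_refl 0 (Qr r))"
    unfolding t_refl_def
  proof (rule subst_converges_to[OF finite_fibres_t_var])
    have "\<forall>\<^sub>F N in sequentially. mps_coeff (fps_nth (Q_trunc N) r) m = mps_coeff (Qr r) m" for m
      using Q_converges[of r] by (simp add: converges_to_def)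
    thus "converges_to (\<lambda>N. fps_nth (Q_trunc (Suc N)) r) (Qr r)"
      unfolding converges_to_def by (subst eventually_sequentially_Suc) blast
  qed
  ultimately show "fps_nth (fps_map (t_refl 0) Q_gen) r = fps_nth (?C * Q_gen) r"
    unfolding tr using converges_to_unique by (simp add: Qr_def)
qed

lemma fps_Rinf_gens:
  "a \<in> Rinf \<Longrightarrow> fps_nth (lin_fps a) n \<in> Rinf" "a \<in> Rinf \<Longrightarrow> fps_nth (geom_fps a) n \<in> Rinf"
  "fps_nth Q_gen n \<in> Rinf"
  using Rinf_gens(3)[of n] by (auto simp: fps_nth_lin geom_fps_def Qr_def intro: Rinf_ops)

lemma fps_Rinf_prod:
  assumes "\<And>i n. i \<in> A \<Longrightarrow> fps_nth (F i) n \<in> Rinf"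
  shows "fps_nth (prod F A) n \<in> Rinf"
  using assms
  by (induction A arbitrary: n rule: infinite_finite_induct) (auto intro: Rinf_ops fps_coeffs_Rinf_mult)

lemma ring_aut_sum:
  assumes "\<phi> \<in> ring_aut Rinf" "\<And>i. i \<in> A \<Longrightarrow> F i \<in> Rinf"
  shows "\<phi> (sum F A) = (\<Sum>i\<in>A. \<phi> (F i))"
proof -
  have "\<phi> 0 = 0" using ring_aut_Rinf(6)[OF assms(1) Rinf_ops(1) Rinf_ops(1)] by simp
  thus ?thesis using assms(2)
    by (induction A rule: infinite_finite_induct) (simp_all add: ring_aut_Rinf[OF assms(1)] Rinf_ops)
qed

lemma fps_map_ring_aut:
  assumes "\<phi> \<in> ring_aut Rinf"
  shows "(\<And>n. fps_nth f n \<in> Rinf) \<Longrightarrow> (\<And>n. fps_nth g n \<in> Rinf) \<Longrightarrow> fps_map \<phi> (f * g) = fps_map \<phi> f * fps_map \<phi> g"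
    "a \<in> Rinf \<Longrightarrow> fps_map \<phi> (lin_fps a) = lin_fps (\<phi> a)"
    "a \<in> Rinf \<Longrightarrow> fps_map \<phi> (geom_fps a) = geom_fps (\<phi> a)"
proof -
  note R = ring_aut_Rinf[OF assms]
  have z: "\<phi> 0 = 0" using R(6)[OF Rinf_ops(1) Rinf_ops(1)] by simp
  show "fps_map \<phi> (f * g) = fps_map \<phi> f * fps_map \<phi> g" if "\<And>n. fps_nth f n \<in> Rinf" "\<And>n. fps_nth g n \<in> Rinf"
    by (rule fps_ext) (simp add: fps_mult_nth ring_aut_sum[OF assms] that R Rinf_ops)
  show "fps_map \<phi> (lin_fps a) = lin_fps (\<phi> a)" if "a \<in> Rinf"
    by (rule fps_ext) (simp add: fps_nth_lin z R)
  show "fps_map \<phi> (geom_fps a) = geom_fps (\<phi> a)" if "a \<in> Rinf"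
  proof (rule fps_ext)
    have "\<phi> (a ^ n) = \<phi> a ^ n" for n
      by (induction n) (simp_all add: R Rinf_ops that)
    thus "fps_nth (fps_map \<phi> (geom_fps a)) n = fps_nth (geom_fps (\<phi> a)) n" for n
      by (simp add: geom_fps_def)
  qed
qed

lemma sz_Q_0: "fps_map (sz 0) Q_gen = lin_fps (zv 1) * geom_fps (zv 1) * Q_gen"
  using sz_0_aut by (simp add: fps_map_def Qr_def)

lemma omega_Q: "fps_map omega Q_gen = Q_gen"
  by (rule fps_ext) (use omega_aut in \<open>simp flip: Qr_def\<close>)

lemma st_eq_t_refl:
  assumes "f \<in> Rinf"
  shows "st i f = t_refl i f"
  using assms
proof (induction rule: Rinf_induct)
  note oR = ring_aut_Rinf[OF omega_aut[THEN conjunct1]] and sR = ring_aut_Rinf[OF sz_ring_aut]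
  case (t j)
  have "sz i (zv j) = (if i = 0 then (if j = 1 then - zv 1 else zv j) else zv (transpose i (i + 1) j))"
    using sz_0_aut sz_Suc_aut[of i] t by auto
  moreover have "transpose i (i + 1) j \<ge> 1" if "i \<noteq> 0" using that t by (auto simp: transpose_def)
  ultimately show ?case
    using omega_aut t t_refl_Var(3)[of i j] t_refl_Var(6) t_refl_Var(7)[of j]
    by (auto simp: st_def sR oR Rinf_gens Rinf_ops)
next
  note oR = ring_aut_Rinf[OF omega_aut[THEN conjunct1]] and sR = ring_aut_Rinf[OF sz_ring_aut]
  case (z j)
  have "sz i (tv j) = tv j"
    using sz_0_aut sz_Suc_aut[of i] z by (cases "i = 0") auto
  thus ?case using omega_aut z by (simp add: st_def sR oR Rinf_gens Rinf_ops t_refl_Var)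
next
  note om = omega_aut[THEN conjunct1]
  case (Qr r)
  have o: "omega (Qr r) = Qr r" using omega_aut by simp
  show ?case
  proof (cases "i = 0")
    case True
    have "fps_map omega (fps_map (sz 0) Q_gen) = lin_fps (- tv 1) * geom_fps (- tv 1) * Q_gen"
      unfolding sz_Q_0 using omega_aut
      by (simp add: fps_map_ring_aut[OF om] omega_Q fps_coeffs_Rinf_mult fps_Rinf_gens Rinf_gens)
    hence "omega (sz 0 (Qr r)) = fps_nth (fps_map (t_refl 0) Q_gen) r"
      unfolding t_refl_Q_0 by (metis Qr_def fps_nth_map)
    thus ?thesis using True o by (simp add: st_def Qr_def)
  next
    case False
    have "t_refl i (Qr r) = Qr r" using t_refl_Q_Suc[of i] False by (metis Qr_def fps_nth_map less_one not_le)
    thus ?thesis using False o sz_Suc_aut[of i] by (simp add: st_def)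
  qed
qed (simp_all add: st_def ring_aut_Rinf[OF sz_ring_aut] ring_aut_Rinf[OF omega_aut[THEN conjunct1]] t_refl_hom)

subsection \<open>Recursion and action of the reflections\<close>

text \<open>The coefficient of u in the linear factor by which the generating functions with indices
  \<open>l\<close> and \<open>l - 1\<close> differ: for \<open>l \<ge> 1\<close> the numerator 1 -
  t_l u is gained, for \<open>l \<le> 0\<close> the denominator 1 + t_{1-l} u is lost.\<close>

definition t_root :: "int \<Rightarrow> var mps"
  where "t_root l = (if l \<ge> 1 then - tv (nat l) else tv (nat (1 - l)))"

lemma theta_gen_rec: "theta_gen k l = lin_fps (t_root l) * theta_gen k (l - 1)"
proof (cases "l \<ge> 1")
  case True
  obtain n where l: "l = int (Suc n)" using True by (intro that[of "nat (l - 1)"]) simp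
  have [simp]: "nat (1 + int n) = Suc n" by simp
  show ?thesis by (simp add: theta_gen_def t_root_def l mult_ac)
next
  case False
  obtain n where l: "l = - int n" using False by (intro that[of "nat (- l)"]) simp
  have gen: "theta_gen k (- int j) = Q_gen * (\<Prod>i=1..k. lin_fps (zv i)) * (\<Prod>i=1..j. geom_fps (- tv i))" for j
    by (simp add: theta_gen_def)
  have [simp]: "- int n - 1 = - int (Suc n)" "nat (1 + int n) = Suc n" by simp_all
  have "lin_fps (tv (Suc n)) * geom_fps (- tv (Suc n)) = 1" by (rule lin_geom_minus)
  hence "theta_gen k (- int n) = theta_gen k (- int n) * (lin_fps (tv (Suc n)) * geom_fps (- tv (Suc n)))"
    by simp
  also have "\<dots> = lin_fps (tv (Suc n)) * theta_gen k (- int (Suc n))"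
    unfolding gen by (simp add: mult_ac)
  finally show ?thesis by (simp add: t_root_def l)
qed

lemma theta_neg: "r < 0 \<Longrightarrow> theta k l r = 0"
  by (simp add: theta_def)

lemma theta_rec: "theta k l r = theta k (l - 1) r + t_root l * theta k (l - 1) (r - 1)"
proof (cases "r \<ge> 0")
  case True
  then obtain n where r: "r = int n" using nonneg_int_cases by blast
  have "fps_nth (lin_fps a * f) n = fps_nth f n + a * (if n = 0 then 0 else fps_nth f (n - 1))" for a and f :: "var mps fps"
    by (simp add: lin_fps_def algebra_simps)
  thus ?thesis unfolding r theta_def theta_gen_rec[of k l] by (auto simp: nat_diff_distrib')
qed (simp add: theta_def)

text \<open>For \<open>i \<ge> 1\<close> the t factors involve both or neither of t_i and t_{i+1},
  symmetrically, unless the absolute value of \<open>l\<close> is \<open>i\<close>. For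
  \<open>i = 0\<close> the factor (1 - t_1 u) / (1 + t_1 u) acquired by the Q series is compensated
  by the sign change in 1 - t_1 u or in 1 / (1 + t_1 u), one of which is present.\<close>

lemma t_refl_theta_gen:
  assumes "\<bar>l\<bar> \<noteq> int i"
  shows "fps_map (t_refl i) (theta_gen k l) = theta_gen k l"
proof (cases "i = 0")
  case True
  let ?Z = "\<Prod>i=1..k. lin_fps (zv i)"
  have Z: "fps_map (t_refl 0) ?Z = ?Z"
    by (simp add: fps_map_t_refl t_refl_Var)
  have Q: "fps_map (t_refl 0) (Q_gen * ?Z * f) = lin_fps (- tv 1) * geom_fps (- tv 1) * Q_gen * ?Z * fps_map (t_refl 0) f" for f
    by (simp only: fps_map_t_refl(1) t_refl_Q_0 Z)
  have t: "t_refl 0 (- tv j) = (if j = 1 then tv 1 else - tv j)" for j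
    by (simp add: t_refl_hom t_refl_Var)
  have split: "(\<Prod>j=1..Suc n. F j) = F 1 * (\<Prod>j=2..Suc n. F j)" for n and F :: "nat \<Rightarrow> var mps fps"
    by (subst prod.atLeast_Suc_atMost) (simp_all add: eval_nat_numeral)
  have invariant: "fps_map (t_refl 0) (Q_gen * ?Z * (X * R)) = Q_gen * ?Z * (X * R)"
    if "lin_fps (- tv 1) * geom_fps (- tv 1) * fps_map (t_refl 0) X = X" "fps_map (t_refl 0) R = R" for X R
  proof -
    have "fps_map (t_refl 0) (Q_gen * ?Z * (X * R)) =
        Q_gen * ?Z * ((lin_fps (- tv 1) * geom_fps (- tv 1) * fps_map (t_refl 0) X) * R)"
      unfolding Q fps_map_t_refl(1)[of _ X] that(2) by (simp only: mult_ac)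
    thus ?thesis by (simp only: that(1))
  qed
  show ?thesis
  proof (cases "l \<ge> 0")
    case l: True
    define n where "n = nat (l - 1)"
    let ?R = "\<Prod>j=2..Suc n. lin_fps (- tv j)"
    have "nat l = Suc n" using assms True l by (auto simp: n_def)
    hence th: "theta_gen k l = Q_gen * ?Z * (lin_fps (- tv 1) * ?R)"
      using l by (simp only: theta_gen_def split if_True)
    show ?thesis unfolding True th
    proof (rule invariant)
      have "lin_fps (- tv 1) * geom_fps (- tv 1) * fps_map (t_refl 0) (lin_fps (- tv 1)) =
          (lin_fps (tv 1) * geom_fps (- tv 1)) * lin_fps (- tv 1)"
        by (simp add: fps_map_t_refl t mult_ac)
      thus "lin_fps (- tv 1) * geom_fps (- tv 1) * fps_map (t_refl 0) (lin_fps (- tv 1)) = lin_fps (- tv 1)"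
        by (simp only: lin_geom_minus) simp
      show "fps_map (t_refl 0) ?R = ?R"
        unfolding fps_map_t_refl by (rule prod.cong) (auto simp: t)
    qed
  next
    case l: False
    define n where "n = nat (- l - 1)"
    let ?R = "\<Prod>j=2..Suc n. geom_fps (- tv j)"
    have "nat (- l) = Suc n" using l by (auto simp: n_def)
    hence th: "theta_gen k l = Q_gen * ?Z * (geom_fps (- tv 1) * ?R)"
      using l by (simp only: theta_gen_def split if_False)
    show ?thesis unfolding True th
    proof (rule invariant)
      have "lin_fps (- tv 1) * geom_fps (- tv 1) * fps_map (t_refl 0) (geom_fps (- tv 1)) =
          (lin_fps (- tv 1) * geom_fps (tv 1)) * geom_fps (- tv 1)"
        by (simp add: fps_map_t_refl t mult_ac)
      thus "lin_fps (- tv 1) * geom_fps (- tv 1) * fps_map (t_refl 0) (geom_fps (- tv 1)) = geom_fps (- tv 1)"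
        by (simp only: lin_minus_geom) simp
      show "fps_map (t_refl 0) ?R = ?R"
        unfolding fps_map_t_refl by (rule prod.cong) (auto simp: t)
    qed
  qed
next
  case False
  hence i: "i \<ge> 1" by simp
  have P: "(\<Prod>j=1..n. F (transpose i (i + 1) j)) = (\<Prod>j=1..n. F j)" if "n \<noteq> i" for n and F :: "nat \<Rightarrow> var mps fps"
    by (rule prod.reindex_bij_witness[where i = "transpose i (i + 1)" and j = "transpose i (i + 1)"])
      (use that i in \<open>auto simp: transpose_def\<close>)
  have "nat l \<noteq> i" if "l \<ge> 0" using assms that by auto
  moreover have "nat (- l) \<noteq> i" if "l < 0" using assms that by auto
  ultimately show ?thesis
    using P[of "nat l" "\<lambda>j. lin_fps (- tv j)"] P[of "nat (- l)" "\<lambda>j. geom_fps (- tv j)"]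
    by (auto simp: theta_gen_def fps_map_t_refl t_refl_Q_Suc[OF i] t_refl_Var(1) t_refl_Var(3)[OF i] t_refl_hom)
qed

lemma t_refl_theta: "\<bar>l\<bar> \<noteq> int i \<Longrightarrow> t_refl i (theta k l r) = theta k l r"
  using t_refl_theta_gen[of l i k] by (auto simp: theta_def t_refl_hom dest: arg_cong[where f = "\<lambda>f. fps_nth f (nat r)"])

text \<open>After splitting off one linear factor with \<open>theta_rec\<close>, the theta
  polynomials of index \<open>l - 1\<close> are invariant, and the reflection lowers
  \<open>t_root l\<close> by \<open>alpha i\<close>.\<close>

lemma t_refl_theta_root:
  assumes "\<bar>l\<bar> = int i"
  shows "t_refl i (theta k l r) = theta k l r - alpha i * theta k (l - 1) (r - 1)"
proof -
  have "\<bar>l - 1\<bar> \<noteq> int i" using assms by auto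
  hence inv: "t_refl i (theta k (l - 1) r) = theta k (l - 1) r" for r by (rule t_refl_theta)
  have "t_refl i (t_root l) = t_root l - alpha i"
  proof -
    consider "i = 0" "l = 0" | "i \<ge> 1" "l = int i" | "i \<ge> 1" "l = - int i" using assms by linarith
    thus ?thesis
    proof cases
      case 1 thus ?thesis using t_refl_Var(6) by (simp add: t_root_def alpha_def)
    next
      case 2 thus ?thesis by (simp add: t_root_def alpha_def t_refl_hom t_refl_Var)
    next
      case 3
      have "nat (1 + int i) = Suc i" by simp
      thus ?thesis using 3 by (simp add: t_root_def alpha_def t_refl_hom t_refl_Var)
    qed
  qed
  thus ?thesis
    unfolding theta_rec[of k l] t_refl_hom inv by (simp add: left_diff_distrib)
qed

lemma theta_Rinf: "theta k l r \<in> Rinf"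
proof -
  have "fps_nth (theta_gen k l) n \<in> Rinf" for n
    unfolding theta_gen_def by (auto intro!: fps_coeffs_Rinf_mult fps_Rinf_gens fps_Rinf_prod Rinf_gens Rinf_ops)
  thus ?thesis by (simp add: theta_def Rinf_ops)
qed

lemma theta_0: "theta k l 0 = 1"
proof -
  have "fps_nth (prod F A) 0 = (\<Prod>i\<in>A. fps_nth (F i) 0)" for F :: "nat \<Rightarrow> var mps fps" and A
    by (induction A rule: infinite_finite_induct) simp_all
  moreover have "fps_nth Q_gen 0 = 1" using Q_0 by (simp add: Qr_def)
  ultimately show ?thesis by (simp add: theta_def theta_gen_def lin_fps_def geom_fps_def)
qed

subsection \<open>The quadratic relations among theta polynomials\<close>

definition fps_neg :: "'a::comm_ring_1 fps \<Rightarrow> 'a fps"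
  where "fps_neg f = Abs_fps (\<lambda>n. (- 1) ^ n * fps_nth f n)"

lemma fps_neg_mult: "fps_neg (f * g) = fps_neg f * fps_neg g"
proof (rule fps_ext)
  fix n
  have "(- 1) ^ n * (fps_nth f i * fps_nth g (n - i)) = (- 1) ^ i * fps_nth f i * ((- 1) ^ (n - i) * fps_nth g (n - i))"
    if "i \<le> n" for i
  proof -
    have "(- 1 :: 'a) ^ n = (- 1) ^ i * (- 1) ^ (n - i)" using that by (simp flip: power_add)
    thus ?thesis by (simp add: mult_ac)
  qed
  thus "fps_nth (fps_neg (f * g)) n = fps_nth (fps_neg f * fps_neg g) n"
    by (simp add: fps_neg_def fps_mult_nth sum_distrib_left)
qed

lemma fps_neg_lin: "fps_neg (lin_fps a) = lin_fps (- a)"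
  by (rule fps_ext) (simp add: fps_neg_def fps_nth_lin)

lemma fps_neg_geom: "fps_neg (geom_fps a) = geom_fps (- a)"
proof (rule fps_ext)
  show "fps_nth (fps_neg (geom_fps a)) n = fps_nth (geom_fps (- a)) n" for n
    using power_minus[of a n] by (simp add: fps_neg_def geom_fps_def)
qed

lemma fps_neg_prod: "fps_neg (prod F A) = (\<Prod>i\<in>A. fps_neg (F i))"
  by (induction A rule: infinite_finite_induct) (simp_all add: fps_neg_mult, simp_all add: fps_neg_def fps_eq_iff)

lemma Q_neg_Q: "fps_neg Q_gen * Q_gen = 1"
proof (rule fps_ext)
  fix n
  have "fps_neg (Q_trunc N) * Q_trunc N = 1" for N
  proof -
    have "fps_neg (Q_trunc N) * Q_trunc N = (\<Prod>i=1..N. (lin_fps (- xv i) * geom_fps (xv i)) * (lin_fps (xv i) * geom_fps (- xv i)))"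
      by (simp add: Q_trunc_def fps_neg_prod fps_neg_mult fps_neg_lin fps_neg_geom mult_ac flip: prod.distrib)
    thus ?thesis by (simp add: lin_minus_geom lin_geom_minus)
  qed
  moreover have "converges_to (\<lambda>N. fps_nth (fps_neg (Q_trunc N) * Q_trunc N) n) (fps_nth (fps_neg Q_gen * Q_gen) n)"
    unfolding fps_mult_nth fps_neg_def fps_nth_Abs_fps
    by (intro converges_to_sum converges_to_mult converges_to_const Q_converges[unfolded Qr_def]) simp
  ultimately have "converges_to (\<lambda>_. fps_nth 1 n) (fps_nth (fps_neg Q_gen * Q_gen) n)" by simp
  thus "fps_nth (fps_neg Q_gen * Q_gen) n = fps_nth 1 n"
    using converges_to_const converges_to_unique by blast
qed

lemma fps_nth_mult_degree:
  fixes f g :: "'a::comm_ring_1 fps"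
  assumes "\<And>r. r > a \<Longrightarrow> fps_nth f r = 0" "\<And>r. r > b \<Longrightarrow> fps_nth g r = 0" "n > a + b"
  shows "fps_nth (f * g) n = 0"
  unfolding fps_mult_nth
proof (rule sum.neutral, rule ballI)
  fix i assume "i \<in> {0..n}"
  hence "i > a \<or> n - i > b" using assms(3) by auto
  thus "fps_nth f i * fps_nth g (n - i) = 0" using assms(1,2) by auto
qed

lemma fps_nth_prod_lin_degree:
  assumes "n > card A"
  shows "fps_nth (\<Prod>i\<in>A. lin_fps (a i)) n = 0"
  using assms
proof (induction A arbitrary: n rule: infinite_finite_induct)
  case (insert i A)
  have "fps_nth (lin_fps (a i) * (\<Prod>i\<in>A. lin_fps (a i))) n = 0"
    by (rule fps_nth_mult_degree[where a = 1 and b = "card A"]) (use insert in \<open>auto simp: fps_nth_lin\<close>)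
  thus ?case using insert by simp
qed auto

text \<open>Since Q(-u) Q(u) = 1, for \<open>l \<ge> 0\<close> the product of the generating
  function at -u and at u is a polynomial in u of degree at most 2 (k + l).\<close>

lemma theta_pair_sym:
  assumes "l \<ge> 0" "x + y \<ge> 2 * (int k + l + 1)"
  shows "pair_sym (theta k l) x y = 0"
proof (rule pair_sym_eq_zero)
  fix N assume N: "x + y = int N"
  let ?A = "\<Prod>i=1..k. lin_fps (zv i)" and ?B = "\<Prod>i=1..nat l. lin_fps (- tv i)"
  let ?A' = "\<Prod>i=1..k. lin_fps (- zv i)" and ?B' = "\<Prod>i=1..nat l. lin_fps (tv i)"
  have "fps_neg (theta_gen k l) * theta_gen k l = (fps_neg Q_gen * Q_gen) * ((?A' * ?B') * (?A * ?B))"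
    using assms(1) by (simp add: theta_gen_def fps_neg_prod fps_neg_mult fps_neg_lin mult_ac)
  also have "\<dots> = (?A' * ?B') * (?A * ?B)" by (simp only: Q_neg_Q) simp
  also have "fps_nth \<dots> N = 0"
    by (rule fps_nth_mult_degree[where a = "k + nat l" and b = "k + nat l"]; (rule fps_nth_mult_degree[where a = k and b = "nat l"])?)
      (use assms N in \<open>auto intro!: fps_nth_prod_lin_degree simp: nat_less_iff\<close>)
  finally have "(\<Sum>s=0..N. (- 1) ^ s * fps_nth (theta_gen k l) s * fps_nth (theta_gen k l) (N - s)) = 0"
    by (simp add: fps_mult_nth fps_neg_def)
  thus "(\<Sum>s\<le>N. (- 1) ^ s * theta k l (int s) * theta k l (int N - int s)) = 0"
    unfolding atMost_atLeast0 by (simp add: theta_def nat_diff_distrib' flip: of_nat_diff)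
qed (simp add: theta_neg)

section \<open>Invariants of the reflections\<close>

definition vars_in :: "'v set \<Rightarrow> 'v mps set"
  where "vars_in A = {f. \<forall>m. mps_coeff f m \<noteq> 0 \<longrightarrow> set_mset m \<subseteq> A}"

lemma vars_inD: "f \<in> vars_in A \<Longrightarrow> mps_coeff f m \<noteq> 0 \<Longrightarrow> set_mset m \<subseteq> A"
  by (simp add: vars_in_def)

lemma vars_in_mono: "f \<in> vars_in A \<Longrightarrow> A \<subseteq> B \<Longrightarrow> f \<in> vars_in B"
  by (auto simp: vars_in_def)

lemma vars_in_ops:
  "1 \<in> vars_in A" "0 \<in> vars_in A" "f \<in> vars_in A \<Longrightarrow> - f \<in> vars_in A"
  "f \<in> vars_in A \<Longrightarrow> g \<in> vars_in A \<Longrightarrow> f + g \<in> vars_in A"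
  "v \<in> A \<Longrightarrow> Var v \<in> vars_in A"
proof -
  show "v \<in> A \<Longrightarrow> Var v \<in> vars_in A" by (auto simp: vars_in_def Var_def split: if_splits)
  show "f + g \<in> vars_in A" if "f \<in> vars_in A" "g \<in> vars_in A"
    unfolding vars_in_def
  proof (intro CollectI allI impI)
    fix m assume "mps_coeff (f + g) m \<noteq> 0"
    hence "mps_coeff f m \<noteq> 0 \<or> mps_coeff g m \<noteq> 0" by auto
    thus "set_mset m \<subseteq> A" using that vars_inD by blast
  qed
qed (auto simp: vars_in_def split: if_splits)

lemma vars_in_mult:
  assumes "f \<in> vars_in A" "g \<in> vars_in A"
  shows "f * g \<in> vars_in A"
  unfolding vars_in_def
proof (intro CollectI allI impI)
  fix m assume "mps_coeff (f * g) m \<noteq> 0"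
  then obtain a b where ab: "a + b = m" "mps_coeff f a \<noteq> 0" "mps_coeff g b \<noteq> 0"
    unfolding coeff_times by (auto elim!: sum.not_neutral_contains_not_neutral)
  thus "set_mset m \<subseteq> A" using vars_inD[OF assms(1) ab(2)] vars_inD[OF assms(2) ab(3)] by auto
qed

lemma vars_in_sum: "(\<And>i. i \<in> S \<Longrightarrow> F i \<in> vars_in A) \<Longrightarrow> sum F S \<in> vars_in A"
  by (induction S rule: infinite_finite_induct) (auto intro: vars_in_ops)

lemma vars_in_fps_mult:
  "(\<And>n. fps_nth f n \<in> vars_in A) \<Longrightarrow> (\<And>n. fps_nth g n \<in> vars_in A) \<Longrightarrow> fps_nth (f * g) n \<in> vars_in A"
  by (auto simp: fps_mult_nth intro!: vars_in_sum vars_in_mult)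

lemma vars_in_Qr: "Qr r \<in> vars_in (VX ` {1..})"
proof -
  have "fps_nth (Q_trunc N) n \<in> vars_in (VX ` {1..})" for N n
  proof (induction N arbitrary: n)
    case 0 show ?case by (auto simp: Q_trunc_def intro: vars_in_ops)
  next
    case (Suc N)
    have v: "xv (Suc N) \<in> vars_in (VX ` {1..})" by (intro vars_in_ops) auto
    moreover from v have "xv (Suc N) ^ j \<in> vars_in (VX ` {1..})" for j
      by (induction j) (auto intro: vars_in_ops vars_in_mult)
    ultimately show ?case
      unfolding Q_trunc_Suc
      by (intro vars_in_fps_mult Suc) (auto simp: fps_nth_lin geom_fps_def intro: vars_in_ops)
  qed
  hence V: "fps_nth (Q_trunc N) r \<in> vars_in (VX ` {1..})" for N .
  show ?thesis
    unfolding vars_in_def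
  proof (intro CollectI allI impI)
    fix m assume m: "mps_coeff (Qr r) m \<noteq> 0"
    have "\<forall>\<^sub>F N in sequentially. mps_coeff (fps_nth (Q_trunc N) r) m = mps_coeff (Qr r) m"
      using Q_converges[of r] by (simp add: converges_to_def)
    then obtain N where "mps_coeff (fps_nth (Q_trunc N) r) m = mps_coeff (Qr r) m"
      using eventually_happens'[OF sequentially_bot] by blast
    thus "set_mset m \<subseteq> VX ` {1..}" using vars_inD[OF V, of N m] m by simp
  qed
qed

lemma vars_in_Rinf:
  assumes "f \<in> Rinf"
  shows "\<exists>N. f \<in> vars_in (VX ` {1..} \<union> range VZ \<union> VT ` {1..N})" (is "\<exists>N. f \<in> vars_in (?A N)")
  using assms
proof (induction rule: Rinf_induct)
  case (t i) thus ?case by (intro exI[of _ i] vars_in_ops) auto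
next
  case (z i) thus ?case by (intro exI[of _ 0] vars_in_ops) auto
next
  case (Qr r)
  have "VX ` {1..} \<subseteq> ?A 0" by auto
  thus ?case by (intro exI[of _ 0] vars_in_mono[OF vars_in_Qr])
next
  case one show ?case by (auto intro: vars_in_ops)
next
  case (uminus f) thus ?case by (auto intro: vars_in_ops)
next
  case (add f g)
  then obtain N M where "f \<in> vars_in (?A N)" "g \<in> vars_in (?A M)" by blast
  moreover have "?A N \<subseteq> ?A (max N M)" "?A M \<subseteq> ?A (max N M)" by auto
  ultimately have "f \<in> vars_in (?A (max N M))" "g \<in> vars_in (?A (max N M))"
    by (meson vars_in_mono)+
  thus ?case by (intro exI[of _ "max N M"] vars_in_ops)
next
  case (mult f g)
  then obtain N M where "f \<in> vars_in (?A N)" "g \<in> vars_in (?A M)" by blast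
  moreover have "?A N \<subseteq> ?A (max N M)" "?A M \<subseteq> ?A (max N M)" by auto
  ultimately have "f \<in> vars_in (?A (max N M))" "g \<in> vars_in (?A (max N M))"
    by (meson vars_in_mono)+
  thus ?case by (intro exI[of _ "max N M"] vars_in_mult)
qed

text \<open>Injectivity on the variables of \<open>f\<close> prevents distinct monomials of
  \<open>f\<close> from being identified, so the sum defining the coefficient has only one relevant
  term.\<close>

lemma coeff_subst_inj:
  assumes \<sigma>: "finite_fibres \<sigma>" "inj_on \<sigma> B" and f: "f \<in> vars_in B" and m: "set_mset m \<subseteq> B"
  shows "mps_coeff (mps_subst \<sigma> \<epsilon> f) (image_mset \<sigma> m) = prod_mset (image_mset \<epsilon> m) * mps_coeff f m"
proof -
  have inv: "image_mset (inv_into B \<sigma>) (image_mset \<sigma> a) = a" if "set_mset a \<subseteq> B" for a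
    using that \<sigma>(2) unfolding multiset.map_comp
    by (subst multiset.map_ident_strong) (auto simp: inv_into_f_f)
  have "prod_mset (image_mset \<epsilon> a) * mps_coeff f a = 0"
    if "image_mset \<sigma> a = image_mset \<sigma> m" "a \<noteq> m" for a
  proof (rule ccontr)
    assume "\<not> ?thesis"
    hence "set_mset a \<subseteq> B" using f by (auto simp: vars_in_def)
    thus False using that inv[of a] inv[OF m] by metis
  qed
  hence "mps_coeff (mps_subst \<sigma> \<epsilon> f) (image_mset \<sigma> m) =
      (\<Sum>a | image_mset \<sigma> a = image_mset \<sigma> m. if a = m then prod_mset (image_mset \<epsilon> m) * mps_coeff f m else 0)"
    unfolding mps_subst_def coeff_Abs_mps by (intro sum.cong) auto
  thus ?thesis using finite_image_mset_fibre[OF \<sigma>(1)] by simp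
qed

lemma prod_mset_t_sgn: "prod_mset (image_mset (t_sgn i) m) \<noteq> 0"
  by (induction m) (auto simp: t_sgn_def)

text \<open>The reflections move variables along the chain ..., x_2, x_1, t_1, t_2, ... up to sign.
  An invariant containing one of these variables would contain arbitrarily late t variables, but an
  element of \<open>Rinf\<close> involves only finitely many.\<close>

lemma t_refl_invariant:
  assumes f: "f \<in> Rinf" and inv: "\<And>i. t_refl i f = f"
  shows "f \<in> vars_in (range VZ)"
proof -
  obtain N where N: "f \<in> vars_in (VX ` {1..} \<union> range VZ \<union> VT ` {1..N})"
    using vars_in_Rinf[OF f] by blast
  \<comment> \<open>Descending induction from N: reflection \<open>j\<close> carries an occurrence
    of t_j to one of t_{j+1}.\<close>
  have noT: "VT j \<notin># m" if "mps_coeff f m \<noteq> 0" for j m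
  proof (cases "j \<ge> 1")
    case True
    show ?thesis using that True
    proof (induction "Suc N - j" arbitrary: j m)
      case 0 thus ?case using vars_inD[OF N 0(2)] by auto
    next
      case (Suc d)
      have "inj (t_var j)"
        using Suc.prems(2) by (auto simp: inj_def t_var_def split: var.splits) (metis transpose_involutory)
      hence "mps_coeff f (image_mset (t_var j) m) = prod_mset (image_mset (t_sgn j) m) * mps_coeff f m"
        using coeff_subst_inj[OF finite_fibres_t_var, of j UNIV f m "t_sgn j"] inv[of j]
        by (simp add: t_refl_def vars_in_def)
      hence "mps_coeff f (image_mset (t_var j) m) \<noteq> 0" using Suc.prems prod_mset_t_sgn by simp
      hence "VT (Suc j) \<notin># image_mset (t_var j) m" by (rule Suc.hyps(1)[rotated]) (use Suc.hyps(2) in auto)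
      moreover have "t_var j (VT j) = VT (Suc j)" using Suc.prems by (simp add: t_var_def)
      ultimately show ?case by (metis imageI set_image_mset)
    qed
  next
    case False
    thus ?thesis using vars_inD[OF N that] by auto
  qed
  let ?B = "VX ` {1..} \<union> range VZ"
  have B: "f \<in> vars_in ?B"
    unfolding vars_in_def
  proof (intro CollectI allI impI)
    fix m assume m: "mps_coeff f m \<noteq> 0"
    show "set_mset m \<subseteq> ?B" using vars_inD[OF N m] noT[OF m] by auto
  qed
  \<comment> \<open>The t variables had to be excluded first: \<open>t_var 0\<close> sends both x_1
    and t_1 to t_1.\<close>
  have "inj_on (t_var 0) ?B"
    by (auto simp: inj_on_def t_var_def split: if_splits)
  hence co: "mps_coeff f (image_mset (t_var 0) m) = prod_mset (image_mset (t_sgn 0) m) * mps_coeff f m"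
    if "mps_coeff f m \<noteq> 0" for m
    using coeff_subst_inj[OF finite_fibres_t_var _ B vars_inD[OF B that], of 0 "t_sgn 0"] inv[of 0]
    by (simp add: t_refl_def)
  \<comment> \<open>Reflection 0 carries x_1 to t_1, which is already excluded, and x_{j+1} to
    x_j.\<close>
  have noX: "VX (Suc j) \<notin># m" if "mps_coeff f m \<noteq> 0" for j m
    using that
  proof (induction j arbitrary: m)
    case 0
    hence "mps_coeff f (image_mset (t_var 0) m) \<noteq> 0" using co prod_mset_t_sgn by simp
    hence "VT 1 \<notin># image_mset (t_var 0) m" by (rule noT)
    moreover have "t_var 0 (VX (Suc 0)) = VT 1" by (simp add: t_var_def)
    ultimately show ?case by (metis imageI set_image_mset)
  next
    case (Suc j)
    hence "mps_coeff f (image_mset (t_var 0) m) \<noteq> 0" using co prod_mset_t_sgn by simp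
    hence "VX (Suc j) \<notin># image_mset (t_var 0) m" by (rule Suc.IH)
    moreover have "t_var 0 (VX (Suc (Suc j))) = VX (Suc j)" by (simp add: t_var_def)
    ultimately show ?case by (metis imageI set_image_mset)
  qed
  show ?thesis
    unfolding vars_in_def
  proof (intro CollectI allI impI subsetI)
    fix m v assume m: "mps_coeff f m \<noteq> 0" and v: "v \<in># m"
    have "v \<in> ?B" using vars_inD[OF B m] v by blast
    moreover have "v \<noteq> VX j" if "j \<ge> 1" for j using noX[OF m, of "j - 1"] v that by auto
    ultimately show "v \<in> range VZ" by auto
  qed
qed

subsection \<open>The specialization x = 0, z = t\<close>

text \<open>This is localization at the torus-fixed point of the identity.\<close>

definition spec_var :: "var \<Rightarrow> var"
  where "spec_var v = (case v of VX j \<Rightarrow> VX j | VZ j \<Rightarrow> VT j | VT j \<Rightarrow> VT j)"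

text \<open>The factor 0 sets the x variables to zero, while \<open>spec_var\<close> itself keeps
  finite fibres as required for substitution in power series.\<close>

definition spec_sgn :: "var \<Rightarrow> int"
  where "spec_sgn v = (case v of VX j \<Rightarrow> 0 | _ \<Rightarrow> 1)"

definition spec_id :: "var mps \<Rightarrow> var mps"
  where "spec_id = mps_subst spec_var spec_sgn"

lemma finite_fibres_spec: "finite_fibres spec_var"
  by (rule finite_fibresI[where F = "\<lambda>v. {v} \<union> (case v of VT j \<Rightarrow> {VZ j} | _ \<Rightarrow> {})"])
     (auto simp: spec_var_def split: var.splits)

lemmas spec_id_hom = subst_hom[OF finite_fibres_spec, where \<epsilon> = spec_sgn, folded spec_id_def]

lemma spec_id_diff: "spec_id (f - g) = spec_id f - spec_id g"
  using spec_id_hom(2)[of "f - g" g] by simp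

lemmas fps_map_spec_id = fps_map_subst[OF finite_fibres_spec, where \<epsilon> = spec_sgn, folded spec_id_def]
  fps_map_subst_prod[OF finite_fibres_spec, where \<epsilon> = spec_sgn, folded spec_id_def]

lemma spec_id_Var: "spec_id (xv j) = 0" "spec_id (zv j) = tv j" "spec_id (tv j) = tv j"
  by (simp_all add: spec_id_def subst_Var[OF finite_fibres_spec] spec_var_def spec_sgn_def)

lemma spec_id_Q: "fps_map spec_id Q_gen = 1"
proof (rule fps_ext)
  fix n
  have "lin_fps 0 * geom_fps (0 :: var mps) = 1" using lin_minus_geom[of "0 :: var mps"] by simp
  hence Q: "fps_map spec_id (Q_trunc N) = 1" for N
    by (simp add: Q_trunc_def fps_map_spec_id spec_id_Var)
  have "spec_id (fps_nth (Q_trunc N) n) = fps_nth 1 n" for N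
    using arg_cong[OF Q[of N], of "\<lambda>f. fps_nth f n"] by (simp only: fps_nth_map)
  moreover have "converges_to (\<lambda>N. spec_id (fps_nth (Q_trunc N) n)) (spec_id (Qr n))"
    unfolding spec_id_def by (rule subst_converges_to[OF finite_fibres_spec Q_converges])
  ultimately have "converges_to (\<lambda>_. fps_nth 1 n) (spec_id (Qr n))" by simp
  hence "spec_id (Qr n) = fps_nth 1 n" using converges_to_const by (rule converges_to_unique)
  thus "fps_nth (fps_map spec_id Q_gen) n = fps_nth 1 n" by (simp add: Qr_def)
qed

lemma spec_id_Qr: "spec_id (Qr r) = (if r = 0 then 1 else 0)"
  using arg_cong[OF spec_id_Q, of "\<lambda>f. fps_nth f r"] by (simp add: Qr_def)

lemma spec_id_Rinf: "f \<in> Rinf \<Longrightarrow> spec_id f \<in> Rinf"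
  by (induction rule: Rinf_induct) (auto simp: spec_id_hom spec_id_Var spec_id_Qr intro: Rinf_ops Rinf_gens)

lemma spec_id_vars: "spec_id f \<in> vars_in (range VT)"
  unfolding vars_in_def
proof (intro CollectI allI impI subsetI)
  fix m v assume "mps_coeff (spec_id f) m \<noteq> 0" "v \<in># m"
  then obtain a where a: "image_mset spec_var a = m" "prod_mset (image_mset spec_sgn a) \<noteq> 0"
    unfolding spec_id_def mps_subst_def coeff_Abs_mps by (auto elim!: sum.not_neutral_contains_not_neutral)
  have "\<And>j. VX j \<notin># a" using a(2) by (force simp: prod_mset_zero_iff spec_sgn_def)
  thus "v \<in> range VT" using a(1) \<open>v \<in># m\<close> by (auto simp: spec_var_def split: var.splits)
qed

lemma spec_id_const: "mps_coeff (spec_id f) {#} = mps_coeff f {#}"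
  by (simp add: spec_id_def mps_subst_def)

lemma spec_id_inj:
  assumes "f \<in> vars_in (range VZ)" "spec_id f = 0"
  shows "f = 0"
proof (rule mps_eqI)
  fix m
  show "mps_coeff f m = mps_coeff 0 m"
  proof (rule ccontr)
    assume "\<not> ?thesis"
    hence m: "mps_coeff f m \<noteq> 0" by simp
    note sub = vars_inD[OF assms(1) m]
    have "mps_coeff (spec_id f) (image_mset spec_var m) = prod_mset (image_mset spec_sgn m) * mps_coeff f m"
      unfolding spec_id_def
      by (rule coeff_subst_inj[OF finite_fibres_spec _ assms(1) sub]) (auto simp: inj_on_def spec_var_def)
    moreover have "prod_mset (image_mset spec_sgn m) \<noteq> 0" using sub by (auto simp: prod_mset_zero_iff spec_sgn_def)
    ultimately show False using m assms(2) by simp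
  qed
qed

text \<open>On setting z = t, reflecting z and t simultaneously becomes reflecting t. For
  \<open>i = 0\<close> the Q series acquires one factor from each reflection, and the two factors
  are inverse to each other at z = t.\<close>

lemma spec_id_refl:
  assumes "f \<in> Rinf"
  shows "spec_id (t_refl i (sz i f)) = t_refl i (spec_id f)"
  using assms
proof (induction rule: Rinf_induct)
  case (t j)
  have "sz i (tv j) = tv j" using sz_0_aut sz_Suc_aut[of i] t by (cases "i = 0") auto
  moreover have "spec_id (t_refl i (tv j)) = t_refl i (tv j)"
    using t_refl_Var(6) t_refl_Var(7)[of j] t_refl_Var(3)[of i j]
    by (cases "i = 0"; cases "j = 1") (auto simp: spec_id_Var spec_id_hom)
  ultimately show ?case by (simp add: spec_id_Var)
next
  case (z j)
  have "sz i (zv j) = (if i = 0 then (if j = 1 then - zv 1 else zv j) else zv (transpose i (i + 1) j))"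
    using sz_0_aut sz_Suc_aut[of i] z by auto
  thus ?case
    using t_refl_Var(6) t_refl_Var(7)[of j] t_refl_Var(3)[of i j]
    by (auto simp: spec_id_Var spec_id_hom t_refl_Var(1) t_refl_hom)
next
  case (Qr r)
  show ?case
  proof (cases "i = 0")
    case True
    have "fps_map spec_id (fps_map (t_refl 0) (fps_map (sz 0) Q_gen)) =
        (lin_fps (tv 1) * geom_fps (- tv 1)) * (lin_fps (- tv 1) * geom_fps (tv 1))"
      unfolding sz_Q_0
      by (simp add: fps_map_t_refl t_refl_Q_0 t_refl_Var fps_map_spec_id spec_id_Var spec_id_Q spec_id_hom mult_ac)
    also have "\<dots> = 1" by (simp only: lin_geom_minus lin_minus_geom) simp
    finally have "fps_nth (fps_map spec_id (fps_map (t_refl 0) (fps_map (sz 0) Q_gen))) r = fps_nth 1 r" by simp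
    hence "spec_id (t_refl 0 (sz 0 (Qr r))) = (if r = 0 then 1 else 0)" by (simp add: Qr_def)
    thus ?thesis using True by (simp add: spec_id_Qr t_refl_hom)
  next
    case False
    have "t_refl i (Qr r) = Qr r" using t_refl_Q_Suc[of i] False by (metis Qr_def fps_nth_map less_one not_le)
    thus ?thesis using False sz_Suc_aut[of i] by (simp add: spec_id_Qr t_refl_hom)
  qed
qed (simp_all add: ring_aut_Rinf[OF sz_ring_aut] t_refl_hom spec_id_hom)

text \<open>At this point the generating function with l = -k becomes 1, since each 1 + t_i u
  cancels. Each increase of \<open>l\<close> multiplies it by one linear factor, so its degree is at
  most k + l.\<close>

lemma theta_spec_id:
  assumes "- int k \<le> l" "r > int k + l"
  shows "spec_id (theta k l r) = 0"
  using assms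
proof (induction l arbitrary: r rule: int_ge_induct)
  case base
  have gen: "theta_gen k (- int j) = Q_gen * (\<Prod>i=1..k. lin_fps (zv i)) * (\<Prod>i=1..j. geom_fps (- tv i))" for j
    by (simp add: theta_gen_def)
  have "fps_map spec_id (theta_gen k (- int k)) = 1 * (\<Prod>i=1..k. lin_fps (tv i)) * (\<Prod>i=1..k. geom_fps (- tv i))"
    by (simp only: gen fps_map_spec_id spec_id_Var spec_id_Q spec_id_hom)
  also have "\<dots> = (\<Prod>i=1..k. lin_fps (tv i) * geom_fps (- tv i))"
    by (simp only: prod.distrib mult_1)
  also have "\<dots> = 1" by (simp add: lin_geom_minus)
  finally have "fps_nth (fps_map spec_id (theta_gen k (- int k))) (nat r) = fps_nth 1 (nat r)" by simp
  thus ?case using base by (simp add: theta_def)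
next
  case (step l)
  have "spec_id (theta k l r) = 0" "spec_id (theta k l (r - 1)) = 0" using step by auto
  thus ?case using theta_rec[of k "l + 1" r] by (simp add: spec_id_hom)
qed

section \<open>Lengths of signed permutations\<close>

lemma sgen_apply:
  "sgen i x = (if i = 0 then (if x = 1 then - 1 else if x = - 1 then 1 else x)
    else if x = int i then int i + 1 else if x = int i + 1 then int i
    else if x = - int i then - (int i + 1) else if x = - (int i + 1) then - int i else x)"
  by (auto simp: sgen_def transpose_def)

lemma sgen_simps [simp]: "sgen i (sgen i x) = x" "sgen i (- x) = - sgen i x" "sgen i 0 = 0" "sgen i \<circ> sgen i = id"
  by (auto simp: sgen_apply fun_eq_iff)

text \<open>The pairs of nonzero letters a < b whose order the generator reverses.\<close>

definition sgen_swaps :: "nat \<Rightarrow> (int \<times> int) set"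
  where "sgen_swaps i = (if i = 0 then {(- 1, 1)} else {(int i, int i + 1), (- (int i + 1), - int i)})"

lemma sgen_mono:
  assumes "a < b" "a \<noteq> 0" "b \<noteq> 0" "(a, b) \<notin> sgen_swaps i"
  shows "sgen i a < sgen i b"
  using assms unfolding sgen_apply sgen_swaps_def by (cases "i = 0") (simp_all, linarith+)

lemma sgen_Winf: "sgen i \<in> Winf"
proof -
  have "{x. sgen i x \<noteq> x} \<subseteq> {- int i - 1..int i + 1}" by (auto simp: sgen_apply)
  hence "finite {x. sgen i x \<noteq> x}" by (rule finite_subset) simp
  moreover have "bij (sgen i)" by (rule o_bij[of "sgen i"]) simp_all
  ultimately show ?thesis
    unfolding Winf_def permutes_def by (auto simp: bij_iff) 
qed

lemma Winf_comp: "w \<in> Winf \<Longrightarrow> v \<in> Winf \<Longrightarrow> w \<circ> v \<in> Winf"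
  unfolding Winf_def
  by (auto intro: permutes_compose intro!: finite_subset[of "{i. w (v i) \<noteq> i}" "{i. v i \<noteq> i} \<union> {i. w i \<noteq> i}"])

lemma Winf_facts:
  assumes "w \<in> Winf"
  shows "w (- x) = - w x" "w 0 = 0" "bij w" "w x = w y \<longleftrightarrow> x = y" "w x = 0 \<longleftrightarrow> x = 0"
proof -
  have p: "w permutes UNIV - {0}" using assms by (simp add: Winf_def)
  show "w (- x) = - w x" using assms by (simp add: Winf_def)
  show 0: "w 0 = 0" using p by (simp add: permutes_def)
  show b: "bij w" using permutes_bij[OF p] .
  show inj: "w x = w y \<longleftrightarrow> x = y" for x y using b by (auto simp: bij_def inj_def)
  show "w x = 0 \<longleftrightarrow> x = 0" using inj[of x 0] 0 by simp
qed

lemma Winf_inv: "w \<in> Winf \<Longrightarrow> inv w \<in> Winf"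
proof -
  assume w: "w \<in> Winf"
  note f = Winf_facts[OF w]
  have b: "w (inv w x) = x" for x using f(3) by (simp add: bij_def surj_f_inv_f)
  have "inv w (- x) = - inv w x" for x
    using f(4)[of "inv w (- x)" "- inv w x"] f(1) b by simp
  moreover have "{x. inv w x \<noteq> x} = {x. w x \<noteq> x}"
    using b f(4) by (metis (mono_tags, lifting))
  moreover have "inv w permutes UNIV - {0}" using w permutes_inv by (auto simp: Winf_def)
  ultimately show ?thesis using w by (simp add: Winf_def)
qed

lemma Winf_id: "id \<in> Winf"
  by (simp add: Winf_def permutes_id)

lemma Winf_bound:
  assumes "w \<in> Winf"
  obtains N where "N \<ge> 0" "\<And>x. \<bar>x\<bar> > N \<Longrightarrow> w x = x"
proof -
  have "finite (abs ` {x. w x \<noteq> x})" using assms by (simp add: Winf_def)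
  then obtain N where "\<And>x. x \<in> abs ` {x. w x \<noteq> x} \<Longrightarrow> x \<le> N"
    by (meson bdd_above.E bdd_above_finite)
  thus thesis using that[of "max N 0"] by fastforce
qed

definition descent :: "(int \<Rightarrow> int) \<Rightarrow> nat \<Rightarrow> bool"
  where "descent w i \<longleftrightarrow> (if i = 0 then w 1 < 0 else w (int i) > w (int i + 1))"

text \<open>Twice the number of inversions: the pair \<open>(a, b)\<close> and its mirror image \<open>(- b, - a)\<close> belong to the
  same positive root, and the second summand compensates for the pairs \<open>(- a, a)\<close>, which are fixed
  by this symmetry.\<close>

definition inv_pairs :: "(int \<Rightarrow> int) \<Rightarrow> (int \<times> int) set"
  where "inv_pairs w = {(a, b). a < b \<and> a \<noteq> 0 \<and> b \<noteq> 0 \<and> w a > w b}"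

definition inv_count :: "(int \<Rightarrow> int) \<Rightarrow> nat"
  where "inv_count w = card (inv_pairs w) + card {a. a > 0 \<and> w a < 0}"

lemma inv_finite:
  assumes "w \<in> Winf"
  shows "finite (inv_pairs w)" "finite {a. a > 0 \<and> w a < 0}"
proof -
  obtain N where N: "N \<ge> 0" "\<And>x. \<bar>x\<bar> > N \<Longrightarrow> w x = x" using Winf_bound[OF assms] by blast
  note f = Winf_facts[OF assms]
  have P: "a \<ge> - N \<and> b \<le> N" if "a < b" "w a > w b" for a b
  proof (rule ccontr)
    assume "\<not> ?thesis"
    then consider "b > N" | "a < - N" by linarith
    thus False
    proof cases
      case 1
      hence b: "w b = b" using N(2)[of b] by simp
      hence "w (w a) = w a" using that 1 N(2)[of "w a"] by simp
      thus False using f(4) that b by simp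
    next
      case 2
      hence a: "w a = a" using N(2)[of a] by simp
      hence "w (w b) = w b" using that 2 N(2)[of "w b"] by simp
      thus False using f(4) that a by simp
    qed
  qed
  have "inv_pairs w \<subseteq> {- N..N} \<times> {- N..N}"
  proof
    fix x assume "x \<in> inv_pairs w"
    then obtain a b where "x = (a, b)" "a < b" "w a > w b" by (auto simp: inv_pairs_def)
    thus "x \<in> {- N..N} \<times> {- N..N}" using P[of a b] by simp
  qed
  thus "finite (inv_pairs w)" by (rule finite_subset) simp
  have "a \<le> N" if "a > 0" "w a < 0" for a using N(2)[of a] that by (cases "a > N") simp_all
  hence "{a. a > 0 \<and> w a < 0} \<subseteq> {0..N}" by auto
  thus "finite {a. a > 0 \<and> w a < 0}" by (rule finite_subset) simp
qed

text \<open>The inversion pairs of \<open>w \<circ> sgen i\<close> are the images of those of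
  \<open>w\<close> together with the pairs in \<open>sgen_swaps i\<close>. These are two pairs for
  \<open>i \<ge> 1\<close>; for \<open>i = 0\<close> there is one pair, and the second summand of
  \<open>inv_count\<close> grows by one.\<close>

lemma inv_count_ascent:
  assumes w: "w \<in> Winf" and asc: "\<not> descent w i"
  shows "inv_count (w \<circ> sgen i) = inv_count w + 2"
proof -
  let ?s = "sgen i"
  note f = Winf_facts[OF w]
  define S where "S = sgen_swaps i"
  have mono: "?s a < ?s b" if "a < b" "a \<noteq> 0" "b \<noteq> 0" "(a, b) \<notin> S" for a b
    using sgen_mono[of a b i] that by (simp add: S_def)
  note S_def = S_def[unfolded sgen_swaps_def]
  have Sw: "w a < w b" if "(a, b) \<in> S" for a b
  proof (cases "i = 0")
    case True
    hence "w 1 > 0" using asc f(5)[of 1] by (auto simp: descent_def)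
    thus ?thesis using that True f(1)[of 1] by (auto simp: S_def)
  next
    case False
    hence "w (int i) < w (int i + 1)" using asc f(4)[of "int i" "int i + 1"] by (auto simp: descent_def)
    thus ?thesis using that False f(1)[of "int i"] f(1)[of "int i + 1"] by (auto simp: S_def)
  qed
  have S: "a < b" "a \<noteq> 0" "b \<noteq> 0" "?s a > ?s b" "(?s b, ?s a) \<in> S" if "(a, b) \<in> S" for a b
    using that by (cases "i = 0"; auto simp: S_def sgen_apply)+
  have s0: "?s x = 0 \<longleftrightarrow> x = 0" for x by (metis sgen_simps(1,3))
  have eq: "inv_pairs (w \<circ> ?s) = map_prod ?s ?s ` inv_pairs w \<union> S"
  proof (intro equalityI subsetI)
    fix x assume x: "x \<in> inv_pairs (w \<circ> ?s)"
    then obtain a b where ab: "x = (a, b)" "a < b" "a \<noteq> 0" "b \<noteq> 0" "w (?s a) > w (?s b)"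
      by (auto simp: inv_pairs_def)
    show "x \<in> map_prod ?s ?s ` inv_pairs w \<union> S"
    proof (cases "(a, b) \<in> S")
      case False
      hence "(?s a, ?s b) \<in> inv_pairs w" using ab mono[of a b] by (simp add: inv_pairs_def s0)
      moreover have "x = map_prod ?s ?s (?s a, ?s b)" using ab by simp
      ultimately show ?thesis by blast
    qed (use ab in auto)
  next
    fix x assume "x \<in> map_prod ?s ?s ` inv_pairs w \<union> S"
    thus "x \<in> inv_pairs (w \<circ> ?s)"
    proof
      assume "x \<in> map_prod ?s ?s ` inv_pairs w"
      then obtain a b where ab: "x = (?s a, ?s b)" "a < b" "a \<noteq> 0" "b \<noteq> 0" "w a > w b"
        by (auto simp: inv_pairs_def)
      moreover have "(a, b) \<notin> S" using Sw[of a b] ab by auto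
      ultimately show ?thesis using mono[of a b] by (simp add: inv_pairs_def s0)
    next
      assume x: "x \<in> S"
      obtain a b where ab: "x = (a, b)" by (cases x)
      note Sx = S[OF x[unfolded ab]]
      show ?thesis using Sx(1-3) Sw[OF Sx(5)] by (simp add: ab inv_pairs_def)
    qed
  qed
  have disj: "map_prod ?s ?s ` inv_pairs w \<inter> S = {}"
  proof (rule ccontr)
    assume "\<not> ?thesis"
    then obtain a b where "(a, b) \<in> inv_pairs w" "(?s a, ?s b) \<in> S" by auto
    thus False using S(4)[of "?s a" "?s b"] by (auto simp: inv_pairs_def)
  qed
  have "inj (map_prod ?s ?s)" by (rule inj_on_inverseI[of _ "map_prod ?s ?s"]) auto
  hence "card (map_prod ?s ?s ` inv_pairs w) = card (inv_pairs w)" by (intro card_image) (rule inj_on_subset, auto)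
  moreover have "finite S" by (simp add: S_def)
  ultimately have c1: "card (inv_pairs (w \<circ> ?s)) = card (inv_pairs w) + card S"
    unfolding eq using disj inv_finite(1)[OF w] by (subst card_Un_disjoint) auto
  show ?thesis
  proof (cases "i = 0")
    case True
    have "w 1 > 0" using asc f(5)[of 1] True by (auto simp: descent_def)
    hence "{a. a > 0 \<and> (w \<circ> ?s) a < 0} = insert 1 {a. a > 0 \<and> w a < 0}"
      using True f(1)[of 1] by (auto simp: sgen_apply)
    moreover have "1 \<notin> {a. a > 0 \<and> w a < 0}" using \<open>w 1 > 0\<close> by auto
    ultimately show ?thesis using c1 inv_finite(2)[OF w] True by (simp add: inv_count_def S_def)
  next
    case False
    have "{a. a > 0 \<and> (w \<circ> ?s) a < 0} = ?s ` {a. a > 0 \<and> w a < 0}"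
    proof (intro equalityI subsetI)
      have pos: "?s a > 0 \<longleftrightarrow> a > 0" for a using False by (auto simp: sgen_apply)
      fix x assume "x \<in> {a. a > 0 \<and> (w \<circ> ?s) a < 0}"
      hence "?s x \<in> {a. a > 0 \<and> w a < 0}" using pos by auto
      thus "x \<in> ?s ` {a. a > 0 \<and> w a < 0}" by (metis image_eqI sgen_simps(1))
    next
      fix x assume "x \<in> ?s ` {a. a > 0 \<and> w a < 0}"
      thus "x \<in> {a. a > 0 \<and> (w \<circ> ?s) a < 0}" using False by (auto simp: sgen_apply)
    qed
    moreover have "inj_on ?s A" for A by (rule inj_on_inverseI[of _ ?s]) simp
    ultimately show ?thesis using c1 False by (simp add: inv_count_def S_def card_image)
  qed
qed

lemma inv_count_descent:
  assumes w: "w \<in> Winf" and "descent w i"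
  shows "inv_count w = inv_count (w \<circ> sgen i) + 2"
proof -
  have "\<not> descent (w \<circ> sgen i) i"
    using assms(2) Winf_facts(1)[OF w, of 1] by (auto simp: descent_def sgen_apply split: if_splits)
  from inv_count_ascent[OF Winf_comp[OF w sgen_Winf] this] show ?thesis
    by (simp add: comp_assoc)
qed

text \<open>Without descents 0 < w 1 < w 2 < ..., which gives \<open>w x \<ge> x\<close> for
  positive x. Going down from a point beyond which \<open>w\<close> is the identity gives the
  opposite inequality.\<close>

lemma no_descent_id:
  assumes w: "w \<in> Winf" and nd: "\<And>i. \<not> descent w i"
  shows "w = id"
proof -
  note f = Winf_facts[OF w]
  obtain N where N: "N \<ge> 0" "\<And>x. \<bar>x\<bar> > N \<Longrightarrow> w x = x" using Winf_bound[OF w] by blast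
  have step: "w x < w (x + 1)" if "x \<ge> 1" for x
    using nd[of "nat x"] that f(4)[of x "x + 1"] by (auto simp: descent_def)
  have lower: "w x \<ge> x" if "x \<ge> 1" for x
    using that
  proof (induction x rule: int_ge_induct)
    case base show ?case using nd[of 0] f(5)[of 1] by (auto simp: descent_def)
  next
    case (step x) thus ?case using \<open>\<And>x. 1 \<le> x \<Longrightarrow> w x < w (x + 1)\<close>[of x] by simp
  qed
  have "w x \<le> x" if "x \<ge> 1" for x
  proof -
    have "x \<le> N + 1 \<Longrightarrow> x \<ge> 1 \<Longrightarrow> w x \<le> x" for x
    proof (induction x rule: int_le_induct)
      case base show ?case using N by auto
    next
      case (step x) thus ?case using \<open>\<And>x. 1 \<le> x \<Longrightarrow> w x < w (x + 1)\<close>[of "x - 1"] by simp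
    qed
    thus ?thesis using N(2)[of x] that N(1) by (cases "x \<le> N + 1") auto
  qed
  hence eq: "w x = x" if "x \<ge> 1" for x using lower that by (meson antisym)
  have "w x = x" for x
    using eq[of x] eq[of "- x"] f(1)[of x] f(2) by (cases "x = 0") (auto simp: not_le, smt (verit))
  thus ?thesis by auto
qed

section \<open>Words in the generators and the length function\<close>

definition word :: "nat list \<Rightarrow> int \<Rightarrow> int"
  where "word is = foldr (\<lambda>i v. sgen i \<circ> v) is id"

lemma word_simps [simp]: "word [] = id" "word (i # is) = sgen i \<circ> word is"
  by (simp_all add: word_def)

lemma word_append: "word (is @ js) = word is \<circ> word js"
  by (induction "is") (simp_all add: comp_assoc)

lemma word_Winf: "word is \<in> Winf"
  by (induction "is") (simp_all only: word_simps Winf_id Winf_comp sgen_Winf)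

lemma inv_count_id: "inv_count id = 0"
proof -
  have "inv_pairs id = {}" by (auto simp: inv_pairs_def)
  moreover have "{a :: int. a > 0 \<and> id a < 0} = {}" by auto
  ultimately show ?thesis by (simp only: inv_count_def) simp
qed

lemma inv_count_word: "inv_count (word is) \<le> 2 * length is"
proof (induction "is" rule: rev_induct)
  case Nil show ?case by (simp only: word_simps inv_count_id)
next
  case (snoc i "is")
  have "inv_count (word is \<circ> sgen i) \<le> inv_count (word is) + 2"
    using inv_count_ascent[OF word_Winf[of "is"], of i] inv_count_descent[OF word_Winf[of "is"], of i]
    by (cases "descent (word is) i") linarith+
  also have "\<dots> \<le> 2 * length is + 2" using snoc by linarith
  also have "\<dots> = 2 * length (is @ [i])" by simp
  finally show ?case by (simp only: word_append word_simps comp_id)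
qed

lemma word_exists: "w \<in> Winf \<Longrightarrow> \<exists>is. 2 * length is = inv_count w \<and> w = word is"
proof (induction "inv_count w" arbitrary: w rule: less_induct)
  case less
  show ?case
  proof (cases "\<exists>i. descent w i")
    case True
    then obtain i where i: "descent w i" by blast
    note c = inv_count_descent[OF less.prems i]
    obtain js where js: "2 * length js = inv_count (w \<circ> sgen i)" "w \<circ> sgen i = word js"
      using less.hyps[of "w \<circ> sgen i"] c Winf_comp[OF less.prems sgen_Winf] by auto
    have "w = w \<circ> sgen i \<circ> sgen i" by (simp add: comp_assoc)
    also have "\<dots> = word (js @ [i])" by (simp only: js(2) word_append word_simps comp_id)
    finally have "w = word (js @ [i])" .
    thus ?thesis using js(1) c by (intro exI[of _ "js @ [i]"]) simp
  next
    case False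
    hence "w = id" using no_descent_id less.prems by blast
    thus ?thesis by (intro exI[of _ "[]"]) (simp add: inv_count_id)
  qed
qed

text \<open>Each letter of a word changes the count by at most 2, and removing descents one after
  another attains this bound.\<close>

lemma cox_len_inv_count:
  assumes "w \<in> Winf"
  shows "2 * cox_len w = inv_count w"
proof -
  obtain js where js: "2 * length js = inv_count w" "w = word js" using word_exists[OF assms] by blast
  have "cox_len w = length js"
    unfolding cox_len_def word_def[symmetric]
  proof (rule Least_equality)
    fix l assume "\<exists>is. length is = l \<and> w = word is"
    thus "length js \<le> l" using inv_count_word js(1) by (metis mult_le_cancel1 zero_less_numeral)
  qed (use js in auto)
  thus ?thesis using js by simp
qed

lemma cox_len_right:
  assumes "w \<in> Winf"
  shows "cox_len (w \<circ> sgen i) < cox_len w \<longleftrightarrow> descent w i" "cox_len w < cox_len (w \<circ> sgen i) \<longleftrightarrow> \<not> descent w i"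
  using cox_len_inv_count[OF assms] cox_len_inv_count[OF Winf_comp[OF assms sgen_Winf], of i]
    inv_count_ascent[OF assms, of i] inv_count_descent[OF assms, of i]
  by (cases "descent w i"; linarith)+

lemma cox_len_inv_le:
  assumes "w \<in> Winf"
  shows "cox_len (inv w) \<le> cox_len w"
proof -
  have "\<exists>is. length is = cox_len w \<and> w = word is"
    unfolding cox_len_def word_def[symmetric] by (rule LeastI_ex) (use word_exists[OF assms] in blast)
  then obtain js where js: "length js = cox_len w" "w = word js" by blast
  have P: "word js (word (rev js) x) = x" for js x
    by (induction js arbitrary: x) (simp_all add: word_append)
  hence "inv w = word (rev js)"
    unfolding js(2) using P[of js] P[of "rev js"] by (intro inv_equality) simp_all
  hence "\<exists>is. length is = length js \<and> inv w = word is" by (intro exI[of _ "rev js"]) simp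
  thus ?thesis
    unfolding js(1)[symmetric] unfolding cox_len_def word_def[symmetric] by (rule Least_le)
qed

lemma cox_len_inv:
  assumes "w \<in> Winf"
  shows "cox_len (inv w) = cox_len w"
  using cox_len_inv_le[OF assms] cox_len_inv_le[OF Winf_inv[OF assms], unfolded inv_inv_eq[OF Winf_facts(3)[OF assms]]]
  by (rule antisym)

lemma cox_len_left:
  assumes w: "w \<in> Winf"
  shows "cox_len (sgen i \<circ> w) < cox_len w \<longleftrightarrow> descent (inv w) i"
proof -
  have "inv (sgen i) = sgen i" by (rule inv_equality) simp_all
  hence "inv (sgen i \<circ> w) = inv w \<circ> sgen i"
    using o_inv_distrib[OF Winf_facts(3)[OF sgen_Winf] Winf_facts(3)[OF w]] by simp
  thus ?thesis
    using cox_len_inv[OF Winf_comp[OF sgen_Winf w], of i] cox_len_inv[OF w] cox_len_right(1)[OF Winf_inv[OF w], of i]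
    by simp
qed

lemma mps_two_torsion_free: "2 * (x :: 'v mps) = 0 \<Longrightarrow> x = 0"
proof (rule mps_eqI)
  fix m assume "2 * x = 0"
  moreover have "mps_coeff (2 * x) m = mps_coeff x m + mps_coeff x m" by (simp only: mult_2 coeff_simps)
  ultimately show "mps_coeff x m = mps_coeff 0 m" by simp
qed

section \<open>Characterization of double Schubert polynomials by left divided differences\<close>

lemma t_refl_delta_op:
  assumes "f \<in> Rinf"
  shows "t_refl i f = f - alpha i * delta_op i f"
  using delta_op_well_defined(2)[OF assms, of i] st_eq_t_refl[OF assms, of i] by simp

lemma sz_del_op:
  assumes "f \<in> Rinf"
  shows "sz i f = f - omega (alpha i) * del_op i f"
  using del_op_well_defined(2)[OF assms, of i] by simp

lemma hom_two: "t_refl i 2 = 2" "spec_id 2 = 2"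
  using t_refl_hom(2)[of i 1 1] spec_id_hom(2)[of 1 1] by (simp_all add: t_refl_hom(3) spec_id_hom(3))

lemma t_refl_omega_alpha: "t_refl i (omega (alpha j)) = omega (alpha j)"
  by (simp add: omega_alpha t_refl_hom t_refl_diff t_refl_Var hom_two)

lemma spec_id_alpha: "spec_id (omega (alpha i)) = - alpha i" "spec_id (alpha i) = alpha i"
  unfolding omega_alpha by (simp_all add: alpha_def spec_id_hom spec_id_diff spec_id_Var hom_two)

lemma double_schubert_facts:
  assumes "double_schubert C" "w \<in> Winf"
  shows "C w \<in> Rinf" "C id = 1" "w \<noteq> id \<Longrightarrow> mps_coeff (C w) {#} = 0"
    "del_op i (C w) = (if cox_len (w \<circ> sgen i) < cox_len w then C (w \<circ> sgen i) else 0)"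
    "delta_op i (C w) = (if cox_len (sgen i \<circ> w) < cox_len w then C (sgen i \<circ> w) else 0)"
proof -
  note D = assms(1)[unfolded double_schubert_def]
  note D2 = D[THEN conjunct2, THEN conjunct2]
  show "C w \<in> Rinf" using D[THEN conjunct1] assms(2) by (rule bspec)
  show "del_op i (C w) = (if cox_len (w \<circ> sgen i) < cox_len w then C (w \<circ> sgen i) else 0)"
    using bspec[OF D2[THEN conjunct1] assms(2)] by (rule spec)
  show "delta_op i (C w) = (if cox_len (sgen i \<circ> w) < cox_len w then C (sgen i \<circ> w) else 0)"
    using bspec[OF D2[THEN conjunct2, THEN conjunct1] assms(2)] by (rule spec)
  show "mps_coeff (C w) {#} = 0" if "w \<noteq> id"
    using bspec[OF D2[THEN conjunct2, THEN conjunct2, THEN conjunct1] assms(2)] that by (rule mp)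
  show "C id = 1" using D2 by (elim conjE)
qed

text \<open>By \<open>spec_id_refl\<close>, reflecting the specialized polynomial in t is the same
  as reflecting \<open>C w\<close> in both z and t before specializing. The two resulting correction
  terms cancel by induction, so the specialization is invariant. It then involves no t by
  \<open>t_refl_invariant\<close> and only t by \<open>spec_id_vars\<close>; hence it is constant,
  and its constant term is 0.\<close>

lemma spec_id_schubert:
  assumes C: "double_schubert C" and w: "w \<in> Winf"
  shows "spec_id (C w) = (if w = id then 1 else 0)"
  using w
proof (induction "cox_len w" arbitrary: w rule: less_induct)
  case less
  note F = double_schubert_facts[OF C]
  show ?case
  proof (cases "w = id")
    case True thus ?thesis using F(2)[OF less.prems] by (simp add: spec_id_hom)
  next
    case ne: False
    let ?h = "spec_id (C w)"
    have inv: "t_refl i ?h = ?h" for i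
    proof -
      let ?d = "delta_op i (C w)" and ?e = "del_op i (C w)"
      have ws: "w \<circ> sgen i \<in> Winf" "sgen i \<circ> w \<in> Winf" using less.prems Winf_comp sgen_Winf by auto
      have sid: "w \<circ> sgen i = id \<longleftrightarrow> w = sgen i" "sgen i \<circ> w = id \<longleftrightarrow> w = sgen i"
        by (metis comp_assoc comp_id id_comp sgen_simps(4))+
      have e: "?e \<in> Rinf" using del_op_well_defined(1)[OF F(1)[OF less.prems]] .
      \<comment> \<open>For \<open>w = sgen i\<close> both divided differences are 1. Otherwise both
        sides vanish by induction.\<close>
      have "spec_id (t_refl i ?e) = spec_id ?d"
      proof (cases "w = sgen i")
        case True
        have "descent (sgen i) i" by (simp add: descent_def sgen_apply)
        hence len: "cox_len (sgen i \<circ> sgen i) < cox_len (sgen i)"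
          using cox_len_right(1)[OF sgen_Winf[of i], of i] by blast
        hence "?e = C (sgen i \<circ> sgen i)" "?d = C (sgen i \<circ> sgen i)"
          using F(4,5)[OF less.prems, of i] unfolding True by (simp_all only: if_True)
        hence "?e = 1" "?d = 1" using F(2)[OF less.prems] by (simp_all only: sgen_simps)
        thus ?thesis by (simp add: t_refl_hom)
      next
        case False
        have d: "spec_id ?d = 0"
        proof (cases "cox_len (sgen i \<circ> w) < cox_len w")
          case True
          thus ?thesis using F(5)[OF less.prems, of i] less.hyps[OF True ws(2)] sid False by simp
        qed (use F(5)[OF less.prems, of i] in \<open>simp add: spec_id_hom\<close>)
        have "spec_id (t_refl i ?e) = 0"
        proof (cases "cox_len (w \<circ> sgen i) < cox_len w")
          case True
          let ?w = "w \<circ> sgen i"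
          have e: "?e = C ?w" using F(4)[OF less.prems, of i] True by simp
          have 0: "spec_id (C ?w) = 0" using less.hyps[OF True ws(1)] sid False by simp
          \<comment> \<open>Reflecting \<open>C ?w\<close> in t brings in its left divided
            difference, which is 0 or belongs to the shorter element
            \<open>sgen i \<circ> w \<circ> sgen i\<close>; this conjugate is not the identity since
            \<open>w\<close> is not.\<close>
          have "spec_id (delta_op i (C ?w)) = 0"
          proof (cases "cox_len (sgen i \<circ> ?w) < cox_len ?w")
            case t: True
            have ne': "sgen i \<circ> ?w \<noteq> id"
            proof
              assume "sgen i \<circ> ?w = id"
              hence "sgen i (w (sgen i x)) = x" for x by (metis comp_apply id_apply)
              hence "w x = x" for x by (metis sgen_simps(1))
              thus False using ne by auto
            qed
            show ?thesis
              using F(5)[OF ws(1), of i] t ne' less.hyps[of "sgen i \<circ> ?w"] True Winf_comp[OF sgen_Winf ws(1)] by simp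
          qed (use F(5)[OF ws(1), of i] in \<open>simp add: spec_id_hom\<close>)
          thus ?thesis unfolding e t_refl_delta_op[OF F(1)[OF ws(1)]] using 0 by (simp add: spec_id_hom spec_id_diff)
        qed (use F(4)[OF less.prems, of i] in \<open>simp add: spec_id_hom t_refl_hom\<close>)
        thus ?thesis using d by simp
      qed
      moreover have "t_refl i ?h = spec_id (t_refl i (C w - omega (alpha i) * ?e))"
        using spec_id_refl[OF F(1)[OF less.prems], of i] sz_del_op[OF F(1)[OF less.prems], of i] by simp
      moreover have "\<dots> = ?h - alpha i * spec_id ?d + alpha i * spec_id (t_refl i ?e)"
        by (simp add: t_refl_diff t_refl_hom t_refl_omega_alpha t_refl_delta_op[OF F(1)[OF less.prems], of i]
            spec_id_diff spec_id_hom spec_id_alpha)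
      ultimately show ?thesis by simp
    qed
    have "?h \<in> vars_in (range VZ)"
      by (rule t_refl_invariant[OF spec_id_Rinf[OF F(1)[OF less.prems]] inv])
    moreover have "?h \<in> vars_in (range VT)" by (rule spec_id_vars)
    ultimately have "set_mset m = {}" if "mps_coeff ?h m \<noteq> 0" for m
      using vars_inD that by blast
    moreover have "mps_coeff ?h {#} = 0" using F(3)[OF less.prems ne] by (simp add: spec_id_const)
    ultimately have "mps_coeff ?h m = mps_coeff 0 m" for m
      by (metis coeff_simps(1) set_mset_eq_empty_iff)
    thus ?thesis using ne by (auto intro: mps_eqI)
  qed
qed

lemma schubert_unique:
  assumes C: "double_schubert C" and w: "w \<in> Winf" "w \<noteq> id"
    and f: "f \<in> Rinf" "spec_id f = 0"
    and rec: "\<And>i. f - t_refl i f = alpha i * (if cox_len (sgen i \<circ> w) < cox_len w then C (sgen i \<circ> w) else 0)"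
  shows "C w = f"
proof -
  note F = double_schubert_facts[OF C w(1)]
  have "t_refl i (C w - f) = C w - f" for i
  proof -
    define K where "K = alpha i * (if cox_len (sgen i \<circ> w) < cox_len w then C (sgen i \<circ> w) else 0)"
    have "t_refl i (C w) = C w - K" using t_refl_delta_op[OF F(1), of i] F(5)[of i] by (simp add: K_def)
    moreover have "t_refl i f = f - K" using rec[of i] by (simp add: K_def algebra_simps)
    ultimately show ?thesis by (simp add: t_refl_diff)
  qed
  hence "C w - f \<in> vars_in (range VZ)"
    using F(1) f(1) by (intro t_refl_invariant) (auto intro: Rinf_ops)
  moreover have "spec_id (C w - f) = 0"
    using spec_id_schubert[OF C w(1)] w(2) f(2) by (simp add: spec_id_diff)
  ultimately have "C w - f = 0" by (rule spec_id_inj)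
  thus ?thesis by simp
qed

section \<open>Divided differences of Pfaffian sums of theta polynomials\<close>

lemma row_pf_hom:
  fixes h :: "'a::comm_ring_1 \<Rightarrow> 'b::comm_ring_1"
  assumes "h 1 = 1" "\<And>a b. h (a + b) = h a + h b" "\<And>a b. h (a * b) = h a * h b"
  shows "h (row_pf m c b) = row_pf m (\<lambda>j r. h (c j r)) b"
  using schur_pf_hom[of h "map (\<lambda>i. (c i, b i)) [1..<Suc m]", OF assms]
  by (simp add: row_pf_def comp_def del: upt_Suc)

lemma t_refl_raise_sum: "t_refl i (raise_sum D (row_pf m c) b) = raise_sum D (row_pf m (\<lambda>j r. t_refl i (c j r))) b"
  unfolding raise_sum_def t_refl_hom by (intro sum.cong refl row_pf_hom) (simp_all add: t_refl_hom)

lemma spec_id_raise_sum: "spec_id (raise_sum D (row_pf m c) b) = raise_sum D (row_pf m (\<lambda>j r. spec_id (c j r))) b"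
  unfolding raise_sum_def spec_id_hom by (intro sum.cong refl row_pf_hom) (simp_all add: spec_id_hom)

lemma raise_sum_row_cong:
  assumes "\<And>i. 1 \<le> i \<Longrightarrow> i \<le> m \<Longrightarrow> c i = c' i \<and> b i = b' i"
  shows "raise_sum D (row_pf m c) b = raise_sum D (row_pf m c') b'"
  unfolding raise_sum_def using assms by (intro sum.cong refl row_pf_cong) auto

lemma raise_sum_upd: "raise_sum D (\<lambda>b. g (b(p := b p - 1))) b = raise_sum D g (b(p := b p - 1))"
proof -
  have "(\<lambda>i. b i + shift_I I i)(p := b p + shift_I I p - 1) = (\<lambda>i. (b(p := b p - 1)) i + shift_I I i)" for I
    by (auto simp: fun_eq_iff)
  thus ?thesis by (simp only: raise_sum_def)
qed

lemma row_pf_Rinf: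
  assumes "\<And>i r. c i r \<in> Rinf"
  shows "row_pf m c b \<in> Rinf"
proof -
  have "2 \<in> Rinf" using Rinf_ops(4)[OF Rinf_ops(1) Rinf_ops(1)] by simp
  hence P: "pair_pf c b i j \<in> Rinf" for i j
    using assms by (auto simp: pair_pf_def intro!: Rinf_ops)
  have "pf (pair_pf c b) xs \<in> Rinf" for xs
  proof (induction "length xs" arbitrary: xs rule: less_induct)
    case less
    thus ?case using P by (cases xs) (auto intro!: Rinf_ops)
  qed
  thus ?thesis by (simp add: row_pf_eq)
qed

lemma raise_sum_Rinf: "(\<And>i r. c i r \<in> Rinf) \<Longrightarrow> raise_sum D (row_pf m c) b \<in> Rinf"
  unfolding raise_sum_def by (intro Rinf_ops row_pf_Rinf)

lemma t_refl_theta_sum_none: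
  assumes "\<And>j. 1 \<le> j \<Longrightarrow> j \<le> m \<Longrightarrow> \<bar>chi j\<bar> \<noteq> int i"
  shows "t_refl i (raise_sum D (row_pf m (\<lambda>j. theta k (chi j))) b) = raise_sum D (row_pf m (\<lambda>j. theta k (chi j))) b"
  unfolding t_refl_raise_sum using assms by (intro raise_sum_row_cong) (auto simp: t_refl_theta)

lemma t_refl_theta_sum_single:
  assumes p: "1 \<le> p" "p \<le> m" "\<bar>chi p\<bar> = int i"
    and others: "\<And>j. 1 \<le> j \<Longrightarrow> j \<le> m \<Longrightarrow> j \<noteq> p \<Longrightarrow> \<bar>chi j\<bar> \<noteq> int i"
  shows "t_refl i (raise_sum D (row_pf m (\<lambda>j. theta k (chi j))) b) = raise_sum D (row_pf m (\<lambda>j. theta k (chi j))) b -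
     alpha i * raise_sum D (row_pf m (\<lambda>j. theta k ((chi(p := chi p - 1)) j))) (b(p := b p - 1))"
proof -
  let ?c = "\<lambda>j. theta k (chi j)" and ?d = "theta k (chi p - 1)"
  have "t_refl i (raise_sum D (row_pf m ?c) b) =
      raise_sum D (row_pf m (?c(p := \<lambda>r. 1 * theta k (chi p) r + - alpha i * (\<lambda>r. ?d (r - 1)) r))) b"
    unfolding t_refl_raise_sum using others p
    by (intro raise_sum_row_cong) (auto simp: t_refl_theta t_refl_theta_root)
  also have "\<dots> = raise_sum D (\<lambda>b. row_pf m (?c(p := theta k (chi p))) b + - alpha i * row_pf m (?c(p := ?d)) (b(p := b p - 1))) b"
    unfolding raise_sum_def row_pf_linear[OF p(1,2)] by (simp add: row_pf_shift theta_neg)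
  also have "\<dots> = raise_sum D (row_pf m ?c) b - alpha i * raise_sum D (row_pf m (?c(p := ?d))) (b(p := b p - 1))"
  proof -
    have "?c(p := theta k (chi p)) = ?c" by auto
    thus ?thesis
      using raise_sum_upd[of D "row_pf m (?c(p := ?d))" p b]
      by (simp only: raise_sum_add raise_sum_mult) simp
  qed
  also have "?c(p := ?d) = (\<lambda>j. theta k ((chi(p := chi p - 1)) j))" by auto
  finally show ?thesis .
qed

text \<open>Write row \<open>p\<close> as A + y A' and row \<open>q\<close> as B + z B', where the
  primes lower the subscript by one. The reflection replaces (y, z) by (- z, - y), so the product y
  z is unchanged and the difference is (y + z) (A' B + A B') with y + z = \<open>alpha i\<close>.
  Since A B' arises from A' B by the raising operator for (p, q), this yields the factor 1 +
  R.\<close>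

lemma t_refl_theta_sum_double:
  assumes p: "1 \<le> p" "p \<le> m" "chi p = int i" and q: "1 \<le> q" "q \<le> m" "chi q = - int i" and pq: "p \<noteq> q" and i: "i \<ge> 1"
    and others: "\<And>j. 1 \<le> j \<Longrightarrow> j \<le> m \<Longrightarrow> j \<noteq> p \<Longrightarrow> j \<noteq> q \<Longrightarrow> \<bar>chi j\<bar> \<noteq> int i"
    and D: "finite D" "(p, q) \<notin> D"
  shows "t_refl i (raise_sum D (row_pf m (\<lambda>j. theta k (chi j))) b) = raise_sum D (row_pf m (\<lambda>j. theta k (chi j))) b -
     alpha i * raise_sum (insert (p, q) D) (row_pf m (\<lambda>j. theta k ((chi(p := chi p - 1, q := chi q - 1)) j))) (b(p := b p - 1))"
proof -
  let ?c = "\<lambda>j. theta k (chi j)"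
  let ?A = "theta k (int i - 1)" and ?B = "theta k (- int i - 1)"
  let ?A' = "\<lambda>r. ?A (r - 1)" and ?B' = "\<lambda>r. ?B (r - 1)"
  define y where "y = t_root (int i)"
  define z where "z = t_root (- int i)"
  define R where "R = (\<lambda>X Y. row_pf m (?c(p := X, q := Y)))"
  have alpha: "alpha i = y + z"
  proof -
    have "nat (1 + int i) = Suc i" by simp
    thus ?thesis using i by (simp add: y_def z_def t_root_def alpha_def)
  qed
  have bil: "R (\<lambda>r. 1 * ?A r + u * ?A' r) (\<lambda>r. 1 * ?B r + v * ?B' r) b =
     R ?A ?B b + v * R ?A ?B' b + u * R ?A' ?B b + u * v * R ?A' ?B' b" for u v b
  proof -
    have q': "R X (\<lambda>r. 1 * Y r + v * Z r) b = 1 * R X Y b + v * R X Z b" for X Y Z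
      unfolding R_def by (rule row_pf_linear[OF q(1,2)])
    have p': "R (\<lambda>r. 1 * Y r + u * Z r) X b = 1 * R Y X b + u * R Z X b" for X Y Z
      unfolding R_def fun_upd_twist[OF pq] by (rule row_pf_linear[OF p(1,2)])
    show ?thesis unfolding p' q' by (simp add: algebra_simps)
  qed
  have c: "?c = ?c(p := \<lambda>r. 1 * ?A r + y * ?A' r, q := \<lambda>r. 1 * ?B r + z * ?B' r)"
    using p q pq by (auto simp: fun_eq_iff y_def z_def theta_rec[of k "int i"] theta_rec[of k "- int i"])
  have "t_refl i (?c j r) = (?c(p := \<lambda>r. 1 * ?A r + (- z) * ?A' r, q := \<lambda>r. 1 * ?B r + (- y) * ?B' r)) j r"
    if "1 \<le> j" "j \<le> m" for j r
    using t_refl_theta[of "chi j" i k r] t_refl_theta_root[of "chi j" i k r] p q pq others[of j] that alpha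
    by (auto simp: y_def z_def theta_rec[of k "int i" r] theta_rec[of k "- int i" r] algebra_simps)
  hence "t_refl i (raise_sum D (row_pf m ?c) b) =
      raise_sum D (R (\<lambda>r. 1 * ?A r + (- z) * ?A' r) (\<lambda>r. 1 * ?B r + (- y) * ?B' r)) b"
    unfolding t_refl_raise_sum R_def by (intro raise_sum_row_cong) (auto intro!: ext)
  moreover have "raise_sum D (row_pf m ?c) b = raise_sum D (R (\<lambda>r. 1 * ?A r + y * ?A' r) (\<lambda>r. 1 * ?B r + z * ?B' r)) b"
    unfolding R_def using c by simp
  ultimately have "raise_sum D (row_pf m ?c) b - t_refl i (raise_sum D (row_pf m ?c) b) =
      alpha i * raise_sum D (\<lambda>b. R ?A' ?B b + R ?A ?B' b) b"
    unfolding alpha raise_sum_def bil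
    by (simp add: sum_distrib_left algebra_simps flip: sum_subtractf)
  moreover have "raise_sum D (\<lambda>b. R ?A' ?B b + R ?A ?B' b) b = raise_sum (insert (p, q) D) (R ?A ?B) (b(p := b p - 1))"
  proof -
    have "R ?A' ?B b = R ?A ?B (b(p := b p - 1))" for b
      unfolding R_def fun_upd_twist[OF pq] by (rule row_pf_shift) (simp add: theta_neg)
    moreover have "R ?A ?B' b = R ?A ?B (raise p q (b(p := b p - 1)))" for b
    proof -
      have "raise p q (b(p := b p - 1)) = b(q := b q - 1)" using pq by (auto simp: raise_def)
      thus ?thesis unfolding R_def by (simp add: row_pf_shift theta_neg)
    qed
    ultimately have "raise_sum D (\<lambda>b. R ?A' ?B b + R ?A ?B' b) b =
        raise_sum D (\<lambda>b. R ?A ?B b + R ?A ?B (raise p q b)) (b(p := b p - 1))"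
      using raise_sum_upd[of D "\<lambda>b. R ?A ?B b + R ?A ?B (raise p q b)" p b] by simp
    thus ?thesis using D pq by (simp add: raise_sum_insert)
  qed
  moreover have "?c(p := ?A, q := ?B) = (\<lambda>j. theta k ((chi(p := chi p - 1, q := chi q - 1)) j))"
    using p q pq by (auto simp: fun_eq_iff)
  ultimately show ?thesis by (simp add: R_def algebra_simps)
qed

section \<open>Grassmannian signed permutations\<close>

text \<open>Together with \<open>part_at\<close> and \<open>pairs_at\<close>, this reads the
  combinatorial data directly from the permutation, so that they can be compared for
  \<open>w\<close> and \<open>sgen i \<circ> w\<close> without passing through partitions. Rows are
  numbered from 1.\<close>

definition chi_at :: "nat \<Rightarrow> (int \<Rightarrow> int) \<Rightarrow> nat \<Rightarrow> int"
  where "chi_at k w j = (let x = w (int (k + j)) in if x < 0 then - x - 1 else - x)"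

definition part_at :: "nat \<Rightarrow> (int \<Rightarrow> int) \<Rightarrow> nat \<Rightarrow> int"
  where "part_at k w j = (let x = w (int (k + j)) in
    if x < 0 then - x + int k else int (card {p \<in> {1..k}. w (int p) > x}))"

definition pairs_at :: "nat \<Rightarrow> nat \<Rightarrow> (int \<Rightarrow> int) \<Rightarrow> (nat \<times> nat) set"
  where "pairs_at k n w = {(i, j). 1 \<le> i \<and> i < j \<and> j \<le> n - k \<and> chi_at k w i + chi_at k w j < 0}"

definition theta_sum :: "nat \<Rightarrow> nat \<Rightarrow> (int \<Rightarrow> int) \<Rightarrow> var mps"
  where "theta_sum k n w =
    raise_sum (pairs_at k n w) (row_pf (n - k) (\<lambda>j. theta k (chi_at k w j))) (part_at k w)"

lemma finite_pairs_at: "finite (pairs_at k n w)"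
  by (rule finite_subset[of _ "{1..n} \<times> {1..n}"]) (auto simp: pairs_at_def)

lemma map_prod_transpose_image:
  assumes "\<And>a b. (a, b) \<in> E \<Longrightarrow> (transpose p q a, transpose p q b) \<in> E"
  shows "map_prod (transpose p q) (transpose p q) ` E = E"
proof (intro equalityI subsetI)
  fix x assume x: "x \<in> E"
  obtain a b where ab: "x = (a, b)" by (cases x)
  show "x \<in> map_prod (transpose p q) (transpose p q) ` E"
    using assms[of a b] x by (intro image_eqI[of _ _ "(transpose p q a, transpose p q b)"]) (simp_all add: ab)
qed (use assms in auto)

text \<open>Below, \<open>v x\<close> is the position of the letter x in \<open>w\<close>. Left
  multiplication by \<open>sgen i\<close> acts on letters and is governed by
  \<open>descent v i\<close>; the positions beyond k are the rows of the Pfaffian.\<close>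

locale grassmannian =
  fixes k n :: nat and w :: "int \<Rightarrow> int"
  assumes kn: "k \<le> n" and w: "w \<in> Wn_grass k n"
begin

abbreviation "v \<equiv> inv w"
abbreviation "row j \<equiv> w (int (k + j))"
abbreviation "chi \<equiv> chi_at k w"
abbreviation "part \<equiv> part_at k w"

lemma Winf: "w \<in> Winf" and fixed: "x > int n \<Longrightarrow> w x = x" and ascent: "i \<noteq> k \<Longrightarrow> \<not> descent w i"
proof -
  show W: "w \<in> Winf" using w by (simp add: Wn_grass_def W_grass_def)
  show "x > int n \<Longrightarrow> w x = x" using w by (simp add: Wn_grass_def Wn_def)
  show "i \<noteq> k \<Longrightarrow> \<not> descent w i"
    using w cox_len_right(2)[OF W, of i] by (simp add: Wn_grass_def W_grass_def)
qed

lemmas facts = Winf_facts[OF Winf] and inv_facts = Winf_facts[OF Winf_inv[OF Winf]]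

lemma wv [simp]: "w (v x) = x" and vw [simp]: "v (w x) = x"
  using facts(3) by (simp_all add: bij_def surj_f_inv_f)

lemma v_eq: "v x = y \<longleftrightarrow> w y = x"
  using wv vw by metis

lemma less_Suc:
  assumes "a \<ge> 1" "a \<noteq> int k"
  shows "w a < w (a + 1)"
proof -
  have "\<not> descent w (nat a)" using assms by (intro ascent) auto
  thus ?thesis using assms facts(4)[of a "a + 1"] by (auto simp: descent_def)
qed

lemma increasing_right:
  assumes "int k < a" "a < b"
  shows "w a < w b"
  using assms(2)
proof (induction b rule: int_gr_induct)
  case base show ?case using assms(1) by (intro less_Suc) auto
next
  case (step b)
  have "w b < w (b + 1)" using assms(1) step by (intro less_Suc) auto
  thus ?case using step by simp
qed

lemma increasing_left:
  assumes "1 \<le> a" "a < b" "b \<le> int k"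
  shows "w a < w b"
  using assms(2,3)
proof (induction b rule: int_gr_induct)
  case base thus ?case using assms(1) by (intro less_Suc) auto
next
  case (step b)
  have "w b < w (b + 1)" using assms(1) step by (intro less_Suc) auto
  thus ?case using step by simp
qed

lemma positive_left:
  assumes "1 \<le> a" "a \<le> int k"
  shows "w a > 0"
proof -
  have "w 1 > 0" using assms ascent[of 0] facts(5)[of 1] by (auto simp: descent_def)
  thus ?thesis using assms increasing_left[of 1 a] by (cases "a = 1") auto
qed

lemma mono_right: "v x > int k \<Longrightarrow> v y > int k \<Longrightarrow> x < y \<longleftrightarrow> v x < v y"
  using increasing_right[of "v x" "v y"] increasing_right[of "v y" "v x"] by (cases "v x" "v y" rule: linorder_cases) (auto simp: inv_facts(4))

lemma mono_left: "1 \<le> v x \<Longrightarrow> v x \<le> int k \<Longrightarrow> 1 \<le> v y \<Longrightarrow> v y \<le> int k \<Longrightarrow> x < y \<longleftrightarrow> v x < v y"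
  using increasing_left[of "v x" "v y"] increasing_left[of "v y" "v x"] by (cases "v x" "v y" rule: linorder_cases) (auto simp: inv_facts(4))

lemma v_negative:
  assumes "y > 0" "v y < 0"
  shows "v y < - int k"
proof (rule ccontr)
  assume "\<not> ?thesis"
  hence "w (- v y) > 0" using assms by (intro positive_left) auto
  thus False using assms facts(1)[of "v y"] by simp
qed

lemma v_fixed: "x > int n \<Longrightarrow> v x = x"
  using fixed v_eq by blast

lemma v_bound:
  assumes "1 \<le> y" "y \<le> int n"
  shows "v y \<le> int n" "- int n \<le> v y"
proof -
  show "v y \<le> int n" using fixed[of "v y"] assms by (cases "v y > int n") auto
  show "- int n \<le> v y" using fixed[of "- v y"] facts(1)[of "v y"] assms by (cases "- v y > int n") auto
qed

lemma entry_nonzero: "1 \<le> j \<Longrightarrow> row j \<noteq> 0"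
  using facts(5)[of "int (k + j)"] by simp

lemma chi_positive: "1 \<le> j \<Longrightarrow> chi j = int i \<longleftrightarrow> row j = - (int i + 1)"
  using entry_nonzero[of j] by (auto simp: chi_at_def Let_def)

lemma chi_negative: "1 \<le> j \<Longrightarrow> i \<ge> 1 \<Longrightarrow> chi j = - int i \<longleftrightarrow> row j = int i"
  using entry_nonzero[of j] by (auto simp: chi_at_def Let_def)

text \<open>Identifies the rows affected by reflection \<open>i\<close>: they contain the barred
  letter i + 1 or, for \<open>i \<ge> 1\<close>, the letter i.\<close>

lemma chi_abs: "1 \<le> j \<Longrightarrow> \<bar>chi j\<bar> = int i \<longleftrightarrow> row j = - (int i + 1) \<or> (i \<ge> 1 \<and> row j = int i)"
  using chi_positive[of j i] chi_negative[of j i] by (cases "i = 0") auto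

lemma chi_decreasing:
  assumes "1 \<le> a" "a < b"
  shows "chi b < chi a"
  using increasing_right[of "int (k + a)" "int (k + b)"] assms entry_nonzero[of a] entry_nonzero[of b]
  by (auto simp: chi_at_def Let_def)

lemma chi_inj: "1 \<le> a \<Longrightarrow> 1 \<le> b \<Longrightarrow> chi a = chi b \<longleftrightarrow> a = b"
  using chi_decreasing[of a b] chi_decreasing[of b a] by (cases a b rule: linorder_cases) auto

lemma left_value: "p \<in> {1..k} \<Longrightarrow> w (int p) > 0"
  using positive_left[of "int p"] by auto

section \<open>Change of the rows from \<open>w\<close> to \<open>sgen i \<circ> w\<close> at a left
  descent\<close>

context
  fixes i :: nat
  assumes desc: "descent v i"
begin

lemma descent_Suc_not_right: "\<not> v (int i + 1) > int k"
proof
  assume *: "v (int i + 1) > int k"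
  show False
  proof (cases "i = 0")
    case True thus ?thesis using desc * by (simp add: descent_def)
  next
    case False
    thus ?thesis using desc * mono_right[of "int i" "int i + 1"] by (simp add: descent_def)
  qed
qed

lemma descent_not_negative:
  assumes "i \<noteq> 0"
  shows "\<not> v (int i) < - int k"
proof
  assume *: "v (int i) < - int k"
  have "v (- (int i + 1)) = - v (int i + 1)" "v (- int i) = - v (int i)" by (rule inv_facts(1))+
  thus False using desc * assms mono_right[of "- (int i + 1)" "- int i"] by (simp add: descent_def)
qed

lemma descent_bound: "int i + 1 \<le> int n"
proof (rule ccontr)
  assume *: "\<not> ?thesis"
  hence "v (int i + 1) = int i + 1" by (intro v_fixed) simp
  moreover have "int i + 1 > int k" using * kn by simp
  ultimately show False using descent_Suc_not_right by simp
qed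

text \<open>Left multiplication reverses the order of neighbouring entries only if they are i, i + 1
  or their bars, or the bar of 1 and 1. Such a pair in increasing order contradicts the
  descent.\<close>

lemma descent_in_grass: "sgen i \<circ> w \<in> Wn_grass k n"
proof -
  let ?u = "sgen i \<circ> w"
  have U: "?u \<in> Winf" by (rule Winf_comp[OF sgen_Winf Winf])
  have fixU: "?u x = x" if "x > int n" for x
    using that fixed[of x] descent_bound by (simp add: sgen_apply)
  have "\<not> descent ?u j" if j: "j \<noteq> k" for j
  proof (cases "j = 0")
    case True
    have "w 1 > 0" using True j by (intro positive_left) auto
    moreover have "w 1 \<noteq> 1" if "i = 0" using desc that v_eq[of 1 1] by (auto simp: descent_def)
    ultimately show ?thesis using True by (auto simp: descent_def sgen_apply)
  next
    case False
    have "w (int j) < w (int j + 1)" using False j by (intro less_Suc) auto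
    moreover have "(w (int j), w (int j + 1)) \<notin> sgen_swaps i"
    proof
      assume *: "(w (int j), w (int j + 1)) \<in> sgen_swaps i"
      show False
      proof (cases "i = 0")
        case True
        hence "w (int j) = - 1" "w (int j + 1) = 1" using * by (auto simp: sgen_swaps_def)
        hence "v 1 = int j + 1" by (simp add: v_eq)
        thus False using desc True by (simp add: descent_def)
      next
        case i: False
        hence "w (int j) = int i \<and> w (int j + 1) = int i + 1 \<or> w (int j) = - (int i + 1) \<and> w (int j + 1) = - int i"
          using * by (auto simp: sgen_swaps_def)
        hence "v (int i) = int j \<and> v (int i + 1) = int j + 1 \<or> v (- (int i + 1)) = int j \<and> v (- int i) = int j + 1"
          unfolding v_eq by blast
        thus False using desc i inv_facts(1)[of "int i + 1"] inv_facts(1)[of "int i"] by (auto simp: descent_def)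
      qed
    qed
    moreover have "w (int j) \<noteq> 0" "w (int j + 1) \<noteq> 0" using False facts(5) by auto
    ultimately have "?u (int j) < ?u (int j + 1)" by (simp add: sgen_mono)
    thus ?thesis using False by (simp add: descent_def)
  qed
  thus ?thesis using U fixU cox_len_right(2)[OF U] by (auto simp: Wn_grass_def Wn_def W_grass_def)
qed

lemma entry_unchanged:
  assumes j: "1 \<le> j" and a: "\<bar>chi j\<bar> \<noteq> int i"
  shows "chi_at k (sgen i \<circ> w) j = chi j" "part_at k (sgen i \<circ> w) j = part j"
proof -
  define x where "x = row j"
  have vx: "v x = int (k + j)" by (simp add: x_def)
  have x: "x \<noteq> - (int i + 1)" "i \<ge> 1 \<Longrightarrow> x \<noteq> int i" using a chi_abs[OF j] by (auto simp: x_def)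
  have x1: "x \<noteq> int i + 1" using descent_Suc_not_right vx j by auto
  have x2: "x \<noteq> - int i"
  proof
    assume "x = - int i"
    moreover have "i \<noteq> 0" using \<open>x = - int i\<close> entry_nonzero[OF j] by (auto simp: x_def)
    ultimately show False using descent_not_negative vx inv_facts(1)[of "int i"] j by auto
  qed
  have sx: "sgen i x = x" using x x1 x2 by (auto simp: sgen_apply)
  show "chi_at k (sgen i \<circ> w) j = chi j"
    using sx by (simp add: chi_at_def x_def)
  have "{p \<in> {1..k}. sgen i (w (int p)) > x} = {p \<in> {1..k}. w (int p) > x}" if "x > 0"
  proof -
    have "sgen i (w (int p)) > x \<longleftrightarrow> w (int p) > x" if p: "p \<in> {1..k}" for p
    proof -
      let ?y = "w (int p)"
      have y: "?y > 0" using left_value[OF p] .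
      have "?y \<noteq> x" using facts(4)[of "int p" "int (k + j)"] p j by (auto simp: x_def)
      moreover have "(x, ?y) \<notin> sgen_swaps i" "(?y, x) \<notin> sgen_swaps i"
        using x x1 x2 y \<open>x > 0\<close> by (auto simp: sgen_swaps_def split: if_splits)
      ultimately show ?thesis
        using sgen_mono[of x ?y i] sgen_mono[of ?y x i] y \<open>x > 0\<close> sx by (cases x ?y rule: linorder_cases) auto
    qed
    thus ?thesis by blast
  qed
  moreover have "x \<noteq> 0" using entry_nonzero[OF j] by (simp add: x_def)
  ultimately show "part_at k (sgen i \<circ> w) j = part j"
    unfolding part_at_def Let_def comp_apply x_def[symmetric] sx by simp
qed

lemma entry_positive:
  assumes j: "1 \<le> j" and c: "chi j = int i"
  shows "chi_at k (sgen i \<circ> w) j = chi j - 1" "part_at k (sgen i \<circ> w) j = part j - 1"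
proof -
  have x: "row j = - (int i + 1)" using c chi_positive[OF j] by simp
  show "chi_at k (sgen i \<circ> w) j = chi j - 1"
    using x by (auto simp: chi_at_def Let_def sgen_apply)
  show "part_at k (sgen i \<circ> w) j = part j - 1"
  proof (cases "i = 0")
    case True
    \<comment> \<open>The barred letter 1 becomes 1, so the new part counts the left entries above
      1. These are all k of them, because 1 does not stand on the left; the old part was k +
      1.\<close>
    have "sgen 0 (w (int p)) > 1" if "p \<in> {1..k}" for p
    proof -
      have "v 1 \<noteq> int p" using desc True by (auto simp: descent_def)
      hence "w (int p) \<noteq> 1" using v_eq by blast
      thus ?thesis using left_value[OF that] by (simp add: sgen_apply)
    qed
    hence "{p \<in> {1..k}. sgen 0 (w (int p)) > 1} = {1..k}" by blast
    moreover have "sgen 0 (- 1) = 1" by (simp add: sgen_apply)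
    ultimately show ?thesis using x True by (simp add: part_at_def Let_def)
  next
    case False
    thus ?thesis using x by (simp add: part_at_def Let_def sgen_apply)
  qed
qed

text \<open>The entry i becomes i + 1. One larger left entry is lost exactly if i + 1 itself stands
  on the left. Otherwise i + 1 is barred, which is the case of two affected rows.\<close>

lemma entry_negative:
  assumes j: "1 \<le> j" and c: "chi j = - int i" and i: "i \<ge> 1"
  shows "chi_at k (sgen i \<circ> w) j = chi j - 1"
    "part_at k (sgen i \<circ> w) j = part j - (if v (int i + 1) > 0 then 1 else 0)"
proof -
  have x: "row j = int i" using c chi_negative[OF j i] by simp
  have sx: "sgen i (int i) = int i + 1" using i by (simp add: sgen_apply)
  show "chi_at k (sgen i \<circ> w) j = chi j - 1"
    using x sx by (simp add: chi_at_def Let_def)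
  have "sgen i (w (int p)) > int i + 1 \<longleftrightarrow> w (int p) > int i + 1" if p: "p \<in> {1..k}" for p
  proof -
    have "w (int p) \<noteq> int i" using facts(4)[of "int p" "int (k + j)"] x p j by auto
    thus ?thesis using left_value[OF p] i by (auto simp: sgen_apply)
  qed
  hence "{p \<in> {1..k}. sgen i (w (int p)) > int i + 1} = {p \<in> {1..k}. w (int p) > int i + 1}" by blast
  hence new: "part_at k (sgen i \<circ> w) j = int (card {p \<in> {1..k}. w (int p) > int i + 1})"
    using x sx by (simp add: part_at_def Let_def)
  have old: "part j = int (card {p \<in> {1..k}. w (int p) > int i})"
    using x by (simp add: part_at_def Let_def)
  define A where "A = {p \<in> {1..k}. w (int p) > int i + 1}"
  have v: "int p = v (int i + 1) \<longleftrightarrow> w (int p) = int i + 1" for p using v_eq[of "int i + 1" "int p"] by auto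
  have "w (int p) > int i \<longleftrightarrow> w (int p) > int i + 1 \<or> int p = v (int i + 1)" for p
    unfolding v by linarith
  hence split: "{p \<in> {1..k}. w (int p) > int i} = A \<union> {p \<in> {1..k}. int p = v (int i + 1)}"
    unfolding A_def by blast
  have fin: "finite A" by (simp add: A_def)
  show "part_at k (sgen i \<circ> w) j = part j - (if v (int i + 1) > 0 then 1 else 0)"
  proof (cases "v (int i + 1) > 0")
    case True
    define u where "u = nat (v (int i + 1))"
    have u: "v (int i + 1) = int u" "u \<in> {1..k}" using True descent_Suc_not_right by (auto simp: u_def)
    have "{p \<in> {1..k}. int p = v (int i + 1)} = {u}" using u by auto
    moreover have "u \<notin> A" using v[of u] u by (simp add: A_def)
    ultimately have "card {p \<in> {1..k}. w (int p) > int i} = Suc (card A)" unfolding split using fin by simp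
    thus ?thesis using True unfolding new old A_def[symmetric] by simp
  next
    case False
    hence E: "{p \<in> {1..k}. int p = v (int i + 1)} = {}" by auto
    show ?thesis using False unfolding new old split E A_def[symmetric] by simp
  qed
qed

lemma chi_after:
  assumes "1 \<le> j"
  shows "chi_at k (sgen i \<circ> w) j = chi j - (if \<bar>chi j\<bar> = int i then 1 else 0)"
proof -
  consider "\<bar>chi j\<bar> \<noteq> int i" | "chi j = int i" | "chi j = - int i" "i \<ge> 1"
  proof -
    have "\<bar>chi j\<bar> \<noteq> int i \<or> chi j = int i \<or> (chi j = - int i \<and> i \<ge> 1)" by arith
    thus thesis using that by blast
  qed
  thus ?thesis
    using entry_unchanged(1)[OF assms] entry_positive(1)[OF assms] entry_negative(1)[OF assms] by cases auto
qed

text \<open>Affected indices drop by 1. If only one of the two drops, a new negative sum must come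
  from 0, but then both have absolute value i. If both drop, decreasingness of \<open>chi\<close>
  forces them to be i and - i.\<close>

lemma pairs_after:
  "pairs_at k n (sgen i \<circ> w) = pairs_at k n w \<union>
     {(a, b). 1 \<le> a \<and> a < b \<and> b \<le> n - k \<and> i \<ge> 1 \<and> chi a = int i \<and> chi b = - int i}"
proof -
  have "chi_at k (sgen i \<circ> w) a + chi_at k (sgen i \<circ> w) b < 0 \<longleftrightarrow>
      chi a + chi b < 0 \<or> (i \<ge> 1 \<and> chi a = int i \<and> chi b = - int i)"
    if "1 \<le> a" "a < b" for a b
    using that chi_after[of a] chi_after[of b] chi_decreasing[OF that] by (auto split: if_splits)
  thus ?thesis unfolding pairs_at_def by blast
qed

end

section \<open>The action of a reflection on the Pfaffian sum\<close>

lemma row_of_value: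
  assumes "v y > int k" "v y \<le> int n"
  shows "\<exists>j. 1 \<le> j \<and> j \<le> n - k \<and> row j = y \<and> int (k + j) = v y"
proof (intro exI conjI)
  show "w (int (k + nat (v y - int k))) = y" using assms by (simp flip: v_eq)
qed (use assms in auto)

lemma row_of_negative:
  assumes "y > 0" "v y < 0"
  shows "\<exists>j. 1 \<le> j \<and> j \<le> n - k \<and> row j = - y \<and> int (k + j) = - v y"
proof -
  have "y \<le> int n" using v_fixed[of y] assms by (cases "y > int n") auto
  hence "v (- y) > int k" "v (- y) \<le> int n"
    using v_negative[OF assms] v_bound[of y] assms inv_facts(1)[of y] by auto
  from row_of_value[OF this] show ?thesis by (simp only: inv_facts(1))
qed

lemma w_bound: "1 \<le> x \<Longrightarrow> x \<le> int n \<Longrightarrow> w x \<le> int n"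
  using v_fixed[of "w x"] by (cases "w x > int n") auto

lemma rows_adjacent:
  assumes "1 \<le> a" "1 \<le> b" "row b = row a + 1"
  shows "b = Suc a"
proof -
  have "a < b"
    using increasing_right[of "int (k + b)" "int (k + a)"] assms by (cases a b rule: linorder_cases) auto
  moreover have "\<not> Suc a < b"
  proof
    assume "Suc a < b"
    have "row a < row (Suc a)" by (rule increasing_right) (use assms(1) in simp_all)
    moreover have "row (Suc a) < row b"
      by (rule increasing_right) (use \<open>Suc a < b\<close> in simp_all)
    ultimately show False using assms(3) by linarith
  qed
  ultimately show ?thesis by simp
qed

lemma descent_has_row:
  assumes "descent v i"
  shows "\<exists>j. 1 \<le> j \<and> j \<le> n - k \<and> \<bar>chi j\<bar> = int i"
proof -
  have nz: "v (int i + 1) \<noteq> 0" using inv_facts(5)[of "int i + 1"] by simp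
  show ?thesis
  proof (cases "v (int i + 1) < 0")
    case True
    with row_of_negative[of "int i + 1"]
    obtain j where "1 \<le> j" "j \<le> n - k" "row j = - (int i + 1)" by auto
    thus ?thesis using chi_abs[of j i] by blast
  next
    case False
    hence i: "i \<ge> 1" and gt: "v (int i) > v (int i + 1)" "v (int i + 1) > 0"
      using assms nz by (auto simp: descent_def split: if_splits)
    have "v (int i) > int k"
      using gt mono_left[of "int i" "int i + 1"] by (cases "v (int i) \<le> int k") simp_all
    moreover have "v (int i) \<le> int n" using v_bound(1)[of "int i"] descent_bound[OF assms] i by auto
    ultimately obtain j where "1 \<le> j" "j \<le> n - k" "row j = int i"
      using row_of_value[of "int i"] by blast
    thus ?thesis using chi_abs[of j i] i by blast
  qed
qed

lemma t_refl_theta_sum: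
  "t_refl i (theta_sum k n w) = theta_sum k n w - alpha i * (if descent v i then theta_sum k n (sgen i \<circ> w) else 0)"
proof -
  let ?m = "n - k" and ?ch = chi and ?pa = part and ?D = "pairs_at k n w"
  consider (none) "\<And>j. 1 \<le> j \<Longrightarrow> j \<le> ?m \<Longrightarrow> \<bar>?ch j\<bar> \<noteq> int i"
    | (two) a b where "1 \<le> a" "a \<le> ?m" "1 \<le> b" "b \<le> ?m" "?ch a = int i" "?ch b = - int i" "i \<ge> 1"
    | (one) r where "1 \<le> r" "r \<le> ?m" "\<bar>?ch r\<bar> = int i" "\<And>j. 1 \<le> j \<Longrightarrow> j \<le> ?m \<Longrightarrow> j \<noteq> r \<Longrightarrow> \<bar>?ch j\<bar> \<noteq> int i"
  proof (cases "\<exists>r. 1 \<le> r \<and> r \<le> ?m \<and> \<bar>?ch r\<bar> = int i")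
    case True
    then obtain r where r: "1 \<le> r" "r \<le> ?m" "\<bar>?ch r\<bar> = int i" by blast
    show thesis
    proof (cases "\<exists>j. 1 \<le> j \<and> j \<le> ?m \<and> j \<noteq> r \<and> \<bar>?ch j\<bar> = int i")
      case True
      then obtain j where j: "1 \<le> j" "j \<le> ?m" "j \<noteq> r" "\<bar>?ch j\<bar> = int i" by blast
      have "?ch j \<noteq> ?ch r" using chi_inj j r by simp
      hence "?ch j = int i \<and> ?ch r = - int i \<and> i \<ge> 1 \<or> ?ch j = - int i \<and> ?ch r = int i \<and> i \<ge> 1"
        using j r by arith
      thus thesis using two[of j r] two[of r j] j r by blast
    next
      case False thus thesis using one[OF r] by blast
    qed
  qed (use none in blast)
  thus ?thesis
  proof cases
    case none
    hence "\<not> descent v i" using descent_has_row by blast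
    thus ?thesis unfolding theta_sum_def using t_refl_theta_sum_none[OF none] by simp
  next
    case (two a b)
    let ?c = "?ch(a := ?ch a - 1, b := ?ch b - 1)" and ?b = "?pa(a := ?pa a - 1)"
    have "row a = - (int i + 1)" using two chi_positive by simp
    hence "v (- (int i + 1)) = int (k + a)" by (simp only: v_eq)
    hence va: "v (int i + 1) = - int (k + a)" using inv_facts(1)[of "int i + 1"] by simp
    have "row b = int i" using two chi_negative by simp
    hence vb: "v (int i) = int (k + b)" by (simp only: v_eq)
    \<comment> \<open>The barred letter i + 1 and the letter i on the right already force a descent,
      so the vanishing cases have just one affected row. Moreover the part of row \<open>b\<close>
      is unchanged because i + 1 is not on the left.\<close>
    have desc: "descent v i" using va vb two by (simp add: descent_def)
    have ab: "a < b" using chi_decreasing[of b a] two chi_inj[of a b] by (cases a b rule: linorder_cases) auto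
    have uniq: "1 \<le> j \<Longrightarrow> \<bar>?ch j\<bar> = int i \<Longrightarrow> j = a \<or> j = b" for j
      using chi_inj[of j a] chi_inj[of j b] two by (auto simp: abs_if split: if_splits)
    have D: "pairs_at k n (sgen i \<circ> w) = insert (a, b) ?D"
    proof -
      have a': "a' = a" if "1 \<le> a'" "?ch a' = int i" for a' using uniq[of a'] that two by auto
      have b': "b' = b" if "1 \<le> b'" "?ch b' = - int i" for b' using uniq[of b'] that two by auto
      have "{(a', b'). 1 \<le> a' \<and> a' < b' \<and> b' \<le> ?m \<and> i \<ge> 1 \<and> ?ch a' = int i \<and> ?ch b' = - int i} = {(a, b)}"
        (is "?S = _")
      proof (intro equalityI subsetI)
        fix x assume "x \<in> ?S"
        then obtain a' b' where x: "x = (a', b')" "1 \<le> a'" "a' < b'" "?ch a' = int i" "?ch b' = - int i" by auto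
        hence "a' = a" "b' = b" by (auto intro: a' b')
        thus "x \<in> {(a, b)}" by (simp add: x)
      qed (use two ab in auto)
      thus ?thesis using pairs_after[OF desc] by simp
    qed
    have notin: "(a, b) \<notin> ?D" using two by (simp add: pairs_at_def)
    have "t_refl i (theta_sum k n w) = theta_sum k n w -
        alpha i * raise_sum (insert (a, b) ?D) (row_pf ?m (\<lambda>j. theta k (?c j))) ?b"
      unfolding theta_sum_def
      using two ab uniq notin finite_pairs_at by (intro t_refl_theta_sum_double) auto
    also have "raise_sum (insert (a, b) ?D) (row_pf ?m (\<lambda>j. theta k (?c j))) ?b =
        theta_sum k n (sgen i \<circ> w)"
      unfolding theta_sum_def D
    proof (rule raise_sum_row_cong)
      fix j assume j: "1 \<le> j" "j \<le> ?m"
      have "?c j = chi_at k (sgen i \<circ> w) j"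
        using chi_after[OF desc j(1)] uniq[OF j(1)] two by auto
      moreover have "?b j = part_at k (sgen i \<circ> w) j"
      proof -
        consider "j = a" | "j = b" | "\<bar>?ch j\<bar> \<noteq> int i" "j \<noteq> a" using uniq[OF j(1)] two by auto
        thus ?thesis
        proof cases
          case 1 thus ?thesis using entry_positive(2)[OF desc j(1)] two by simp
        next
          case 2 thus ?thesis using entry_negative(2)[OF desc j(1)] two va ab by simp
        next
          case 3 thus ?thesis using entry_unchanged(2)[OF desc j(1)] by simp
        qed
      qed
      ultimately show "theta k (?c j) = theta k (chi_at k (sgen i \<circ> w) j) \<and>
          ?b j = part_at k (sgen i \<circ> w) j" by simp
    qed
    finally show ?thesis using desc by simp
  next
    case (one r)
    let ?c = "?ch(r := ?ch r - 1)" and ?b = "?pa(r := ?pa r - 1)"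
    have eq: "t_refl i (theta_sum k n w) = theta_sum k n w -
        alpha i * raise_sum ?D (row_pf ?m (\<lambda>j. theta k (?c j))) ?b"
      unfolding theta_sum_def using one by (intro t_refl_theta_sum_single) auto
    have "raise_sum ?D (row_pf ?m (\<lambda>j. theta k (?c j))) ?b = (if descent v i then theta_sum k n (sgen i \<circ> w) else 0)"
    proof (cases "descent v i")
      case desc: True
      have D: "pairs_at k n (sgen i \<circ> w) = ?D"
      proof -
        have E: "{(a, b). 1 \<le> a \<and> a < b \<and> b \<le> ?m \<and> i \<ge> 1 \<and> ?ch a = int i \<and> ?ch b = - int i} = {}"
        proof (rule ccontr)
          assume "\<not> ?thesis"
          then obtain a b where "1 \<le> a" "a < b" "b \<le> ?m" "i \<ge> 1" "?ch a = int i" "?ch b = - int i" by auto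
          thus False using one(4)[of a] one(4)[of b] by (cases "a = r") auto
        qed
        show ?thesis unfolding pairs_after[OF desc] E by simp
      qed
      \<comment> \<open>If i + 1 were barred, its row would be a second affected row.\<close>
      have pos: "v (int i + 1) > 0" if "?ch r = - int i" "i \<ge> 1"
      proof (rule ccontr)
        assume "\<not> ?thesis"
        hence "v (int i + 1) < 0" using inv_facts(5)[of "int i + 1"] by (simp add: not_less order_le_less)
        then obtain j where j: "1 \<le> j" "j \<le> ?m" "row j = - (int i + 1)"
          using row_of_negative[of "int i + 1"] by auto
        hence "?ch j = int i" using chi_positive by blast
        thus False using one(4)[of j] j that by (cases "j = r") auto
      qed
      show ?thesis
        unfolding if_P[OF desc] theta_sum_def D
      proof (rule raise_sum_row_cong)
        fix j assume j: "1 \<le> j" "j \<le> ?m"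
        have "?c j = chi_at k (sgen i \<circ> w) j"
          using chi_after[OF desc j(1)] one(3) one(4)[OF j] by auto
        moreover have "?b j = part_at k (sgen i \<circ> w) j"
        proof (cases "j = r")
          case True
          have "?ch r = int i \<or> (?ch r = - int i \<and> i \<ge> 1)" using one(3) by arith
          thus ?thesis
            using entry_positive(2)[OF desc j(1)] entry_negative(2)[OF desc j(1)] pos True by auto
        next
          case False
          thus ?thesis using entry_unchanged(2)[OF desc j(1)] one(4)[OF j] by simp
        qed
        ultimately show "theta k (?c j) = theta k (chi_at k (sgen i \<circ> w) j) \<and> ?b j = part_at k (sgen i \<circ> w) j" by simp
      qed
    next
      case nd: False
      consider (pos) "?ch r = int i" | (neg) "?ch r = - int i" "i \<ge> 1"
      proof -
        have "?ch r = int i \<or> (?ch r = - int i \<and> i \<ge> 1)" using one(3) by arith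
        thus thesis using that by blast
      qed
      hence "raise_sum ?D (row_pf ?m (\<lambda>j. theta k (?c j))) ?b = 0"
      proof cases
        case pos
        \<comment> \<open>Without a descent the letter i is barred too and stands in the next row.
          The indices i and i - 1 and the parts i + 1 + k and i + k become equal once row
          \<open>r\<close> has been lowered.\<close>
        have wr: "row r = - (int i + 1)" using pos chi_positive one(1) by blast
        hence "v (- (int i + 1)) = int (k + r)" by (simp only: v_eq)
        hence vr: "v (int i + 1) = - int (k + r)" using inv_facts(1)[of "int i + 1"] by simp
        have i: "i \<ge> 1" using nd vr one(1) by (cases "i = 0") (auto simp: descent_def)
        have "v (int i) < 0" using nd vr i one(1) by (auto simp: descent_def)
        then obtain r' where r': "1 \<le> r'" "r' \<le> ?m" "row r' = - int i"
          using row_of_negative[of "int i"] i by auto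
        have Suc: "r' = Suc r" using rows_adjacent[OF one(1) r'(1)] wr r'(3) by simp
        have chS: "?ch (Suc r) = int i - 1" using r'(3) i by (simp add: chi_at_def Let_def Suc)
        have paS: "?pa r = int i + 1 + int k" "?pa (Suc r) = int i + int k"
          using wr r'(3) i unfolding Suc by (simp_all add: part_at_def Let_def)
        show ?thesis
        proof (rule raise_sum_equal_rows[OF mps_two_torsion_free, where p = r])
          have before: "?ch j > int i" if "1 \<le> j" "j < r" for j using chi_decreasing[OF that] pos by simp
          show "map_prod (transpose r (Suc r)) (transpose r (Suc r)) ` ?D = ?D"
          proof (rule map_prod_transpose_image)
            fix a b assume "(a, b) \<in> ?D"
            hence ab: "1 \<le> a" "a < b" "b \<le> ?m" "?ch a + ?ch b < 0" by (auto simp: pairs_at_def)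
            have b: "b \<noteq> r" "b \<noteq> Suc r"
              using ab before[of a] chS pos i by (auto simp: less_Suc_eq)
            show "(transpose r (Suc r) a, transpose r (Suc r) b) \<in> ?D"
            proof (cases "a = r \<or> a = Suc r")
              case True
              \<comment> \<open>The value - i is excluded because row \<open>r\<close> is the only
                affected row; hence b forms a pair in D with both rows or with neither.\<close>
              have "?ch b < - int i" using True ab one(4)[of b] b chS pos by auto
              thus ?thesis using True ab b chS pos one(1) by (auto simp: pairs_at_def transpose_def)
            next
              case False
              thus ?thesis using ab b by (simp add: pairs_at_def transpose_def)
            qed
          qed
          show "(j, r) \<notin> ?D" for j using before[of j] pos by (auto simp: pairs_at_def)
          show "(j, Suc r) \<notin> ?D" for j using before[of j] pos chS i by (auto simp: pairs_at_def less_Suc_eq)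
          \<comment> \<open>The index is now i - 1, and twice the lowered part is 2 (k + (i - 1) +
            1), the bound in \<open>theta_pair_sym\<close>.\<close>
          show "pair_sym (theta k (?c r)) x y = 0" if "2 * ?b r \<le> x + y" for x y
            using that pos paS i by (intro theta_pair_sym) auto
        qed (use one(1) r' Suc chS pos paS in auto)
      next
        case neg
        have wr: "row r = int i" using neg chi_negative one(1) by blast
        hence vr: "v (int i) = int (k + r)" by (simp only: v_eq)
        have "v (int i) \<noteq> v (int i + 1)" using inv_facts(4) by simp
        hence gt: "v (int i + 1) > v (int i)" using nd neg by (auto simp: descent_def)
        show ?thesis
        proof (cases "int i + 1 \<le> int n")
          case True
          have "v (int i + 1) > int k" "v (int i + 1) \<le> int n" using gt vr v_bound(1)[of "int i + 1"] True by auto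
          then obtain r' where r': "1 \<le> r'" "r' \<le> ?m" "row r' = int i + 1" "int (k + r') = v (int i + 1)"
            using row_of_value[of "int i + 1"] by blast
          \<comment> \<open>The letter i + 1 fills the next row, with index - i - 1 and the same
            part. After lowering row \<open>r\<close> the indices agree and its subscript is one
            less than the next one, so \<open>raise_sum_equal_rows_pair\<close> applies.\<close>
          have Suc: "r' = Suc r" using rows_adjacent[OF one(1) r'(1)] wr r'(3) by simp
          have chS: "?ch (Suc r) = - int i - 1" using r'(3) by (simp add: chi_at_def Let_def Suc)
          have ne: "w (int p) \<noteq> int i + 1" if "p \<in> {1..k}" for p
          proof
            assume "w (int p) = int i + 1"
            hence "v (int i + 1) = int p" by (simp only: v_eq)
            thus False using r'(4) that Suc by simp
          qed
          have "w (int p) > int i \<longleftrightarrow> w (int p) > int i + 1" if "p \<in> {1..k}" for p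
            using ne[OF that] by linarith
          hence "{p \<in> {1..k}. w (int p) > int i} = {p \<in> {1..k}. w (int p) > int i + 1}" by blast
          hence paS: "?pa (Suc r) = ?pa r"
            using wr r'(3) unfolding Suc by (simp add: part_at_def Let_def)
          show ?thesis
          proof (rule raise_sum_equal_rows_pair[OF mps_two_torsion_free, where p = r])
            show "(r, Suc r) \<in> ?D" using one(1) r' Suc neg chS by (simp add: pairs_at_def)
            show "map_prod (transpose r (Suc r)) (transpose r (Suc r)) ` (?D - {(r, Suc r)}) = ?D - {(r, Suc r)}"
            proof (rule map_prod_transpose_image)
              fix a b assume "(a, b) \<in> ?D - {(r, Suc r)}"
              hence ab: "1 \<le> a" "a < b" "b \<le> ?m" "?ch a + ?ch b < 0" "\<not> (a = r \<and> b = Suc r)" by (auto simp: pairs_at_def)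
              consider "a = r" "b > Suc r" | "a = Suc r" "b > Suc r" | "b = r" "a < r" | "b = Suc r" "a < r"
                | "a \<noteq> r" "a \<noteq> Suc r" "b \<noteq> r" "b \<noteq> Suc r"
                using ab by linarith
              thus "(transpose r (Suc r) a, transpose r (Suc r) b) \<in> ?D - {(r, Suc r)}"
              proof cases
                case 1
                hence "?ch b < ?ch (Suc r)" by (intro chi_decreasing) auto
                thus ?thesis using 1 ab chS by (auto simp: pairs_at_def transpose_def)
              next
                case 2
                hence "?ch b < ?ch (Suc r)" by (intro chi_decreasing) auto
                thus ?thesis using 2 ab chS neg one(1,2) by (auto simp: pairs_at_def transpose_def)
              next
                case 3
                thus ?thesis using ab chS neg r' Suc by (auto simp: pairs_at_def transpose_def)
              next
                case 4
                \<comment> \<open>A pair (a, Suc r) in D gives \<open>?ch a < int i + 1\<close>. As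
                  row \<open>a\<close> is not affected, \<open>?ch a < int i\<close>, so (a, r) is
                  in D as well.\<close>
                hence "\<bar>?ch a\<bar> \<noteq> int i" using ab by (intro one(4)) auto
                hence "?ch a < int i" using 4 ab chS by auto
                thus ?thesis using 4 ab neg one(1,2) by (auto simp: pairs_at_def transpose_def)
              next
                case 5
                thus ?thesis using ab by (auto simp: pairs_at_def transpose_def)
              qed
            qed
          qed (use one(1) r' Suc chS neg paS finite_pairs_at theta_neg in auto)
        next
          case False
          \<comment> \<open>Here the letter i is the largest letter n of the window, hence in the
            last row with part 0; lowering makes the last subscript negative.\<close>
          have i: "i = n"
          proof -
            have "int (k + r) \<le> int n" using one(2) kn one(1) by auto
            thus ?thesis using False v_fixed[of "int i"] vr by (cases "int i > int n") auto
          qed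
          have r: "r = ?m"
          proof (rule ccontr)
            assume "r \<noteq> ?m"
            hence lt: "int (k + r) + 1 \<le> int n" using one(2) by linarith
            hence "row r < w (int (k + r) + 1)" using one(1) by (intro increasing_right) auto
            moreover have "w (int (k + r) + 1) \<le> int n" using lt by (intro w_bound) auto
            ultimately show False using wr i by simp
          qed
          have "\<not> w (int p) > int n" if "p \<in> {1..k}" for p
            using w_bound[of "int p"] that kn by auto
          hence "{p \<in> {1..k}. w (int p) > int n} = {}" by blast
          hence "?pa r = 0" using wr unfolding i part_at_def Let_def by (simp only: card.empty) simp
          thus ?thesis
            using one(1) r by (intro raise_sum_last_zero) (auto simp: pairs_at_def theta_neg)
        qed
      qed
      thus ?thesis using nd by simp
    qed
    thus ?thesis using eq by simp
  qed
qed

end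

section \<open>The identity and the specialization x = 0, z = t\<close>

lemma theta_sum_id:
  assumes "k \<le> n"
  shows "theta_sum k n id = 1"
proof -
  have chi: "chi_at k id j = - int (k + j)" for j by (simp add: chi_at_def Let_def)
  have "part_at k id j = 0" if "1 \<le> j" for j
  proof -
    have "{p \<in> {1..k}. id (int p) > id (int (k + j))} = {}" by auto
    thus ?thesis unfolding part_at_def Let_def by (simp only: card.empty) simp
  qed
  moreover have "pairs_at k n id = {(i, j). 1 \<le> i \<and> i < j \<and> j \<le> n - k}"
    by (auto simp: pairs_at_def chi)
  ultimately have "theta_sum k n id = raise_sum {(i, j). 1 \<le> i \<and> i < j \<and> j \<le> n - k}
      (row_pf (n - k) (\<lambda>j. theta k (chi_at k id j))) (\<lambda>_. 0)"
    unfolding theta_sum_def by (simp only:) (rule raise_sum_row_cong, simp)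
  also have "\<dots> = 1"
    by (rule raise_sum_all_pairs[OF mps_two_torsion_free]) (simp_all add: theta_0 theta_neg)
  finally show ?thesis .
qed

context grassmannian
begin

text \<open>A nonidentity element has its only descent at k. For a negative first entry, part and
  index give \<open>part 1 = k + chi 1 + 1\<close> directly. For a positive entry x, the x - 1
  smaller letters all stand on the left, and the same equality follows.\<close>

lemma first_row:
  assumes "w \<noteq> id"
  shows "1 \<le> n - k" "- int k \<le> chi 1" "part 1 > int k + chi 1"
proof -
  have desc: "descent w k"
  proof (rule ccontr)
    assume nd: "\<not> descent w k"
    have "\<not> descent w i" for i using ascent[of i] nd by (cases "i = k") simp_all
    hence "w = id" by (rule no_descent_id[OF Winf])
    thus False using assms by simp
  qed
  have "k \<noteq> n"
  proof
    assume "k = n"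
    thus False
      using desc fixed[of "int n + 1"] w_bound[of "int n"] fixed[of 1] by (cases "n = 0") (auto simp: descent_def)
  qed
  thus "1 \<le> n - k" using kn by simp
  define x where "x = w (int k + 1)"
  have x0: "x \<noteq> 0" using facts(5)[of "int k + 1"] by (simp add: x_def)
  have x1: "row 1 = x" by (simp add: x_def add.commute)
  have "- int k \<le> chi 1 \<and> part 1 > int k + chi 1"
  proof (cases "x < 0")
    case True
    thus ?thesis unfolding chi_at_def part_at_def Let_def x1 by simp
  next
    case False
    hence x: "x > 0" using x0 by simp
    have k: "k \<noteq> 0"
    proof
      assume "k = 0"
      hence "w 1 < 0" "x = w 1" using desc by (simp_all add: descent_def x_def)
      thus False using x by simp
    qed
    have wk: "w (int k) > x" using desc k by (simp add: descent_def x_def)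
    define S where "S = {p \<in> {1..k}. w (int p) < x}"
    define T where "T = {p \<in> {1..k}. w (int p) > x}"
    have "w (int p) \<noteq> x" if "p \<in> {1..k}" for p using that facts(4)[of "int p" "int k + 1"] by (auto simp: x_def)
    hence "S \<union> T = {1..k}" by (force simp: S_def T_def)
    moreover have "S \<inter> T = {}" "finite S" "finite T" by (auto simp: S_def T_def)
    ultimately have ST: "card S + card T = k" by (metis card_Un_disjoint card_atLeastAtMost diff_Suc_1)
    have "card S \<le> card {1..x - 1}"
    proof (rule card_inj_on_le)
      show "inj_on (\<lambda>p. w (int p)) S" by (auto simp: inj_on_def facts(4))
      show "(\<lambda>p. w (int p)) ` S \<subseteq> {1..x - 1}"
      proof
        fix y assume "y \<in> (\<lambda>p. w (int p)) ` S"
        then obtain p where "p \<in> {1..k}" "y = w (int p)" "w (int p) < x" by (auto simp: S_def)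
        thus "y \<in> {1..x - 1}" using left_value[of p] by simp
      qed
    qed simp
    hence S1: "int (card S) \<le> x - 1" using x by simp
    \<comment> \<open>x is the smallest entry at the positions beyond k, so a smaller letter cannot
      stand there, barred or not.\<close>
    have left: "1 \<le> v y \<and> v y \<le> int k" if y: "1 \<le> y" "y < x" for y
    proof (rule ccontr)
      assume *: "\<not> ?thesis"
      have "v y \<noteq> 0" using y inv_facts(5)[of y] by simp
      then consider "v y > int k" | "v y < 0" using * by linarith
      thus False
      proof cases
        case 1
        hence "x \<le> w (v y)" using increasing_right[of "int k + 1" "v y"] by (cases "v y = int k + 1") (auto simp: x_def)
        thus False using y by simp
      next
        case 2
        hence "- v y > int k" using v_negative[of y] y by simp
        hence "x \<le> w (- v y)" using increasing_right[of "int k + 1" "- v y"] by (cases "- v y = int k + 1") (auto simp: x_def)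
        thus False using y x facts(1)[of "v y"] by simp
      qed
    qed
    have "card {1..x - 1} \<le> card S"
    proof (rule card_inj_on_le)
      show "inj_on (\<lambda>y. nat (v y)) {1..x - 1}"
      proof (rule inj_onI)
        fix y y' assume y: "y \<in> {1..x - 1}" "y' \<in> {1..x - 1}" "nat (v y) = nat (v y')"
        hence "v y = v y'" using left[of y] left[of y'] by auto
        thus "y = y'" by (simp add: inv_facts(4))
      qed
      show "(\<lambda>y. nat (v y)) ` {1..x - 1} \<subseteq> S"
        using left by (fastforce simp: S_def)
    qed (simp add: S_def)
    hence S2: "x - 1 \<le> int (card S)" using x by simp
    have "k \<in> T" using k wk by (simp add: T_def)
    hence "card T \<ge> 1" using \<open>finite T\<close> by (metis card_gt_0_iff empty_iff less_eq_Suc_le One_nat_def)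
    hence "x \<le> int k" using ST S2 by linarith
    moreover have "part 1 = int (card T)" "chi 1 = - x"
      using x unfolding part_at_def chi_at_def Let_def x1 T_def by simp_all
    ultimately show ?thesis using ST S1 by linarith
  qed
  thus "- int k \<le> chi 1" "part 1 > int k + chi 1" by auto
qed

lemma spec_id_theta_sum:
  assumes "w \<noteq> id"
  shows "spec_id (theta_sum k n w) = 0"
  unfolding theta_sum_def spec_id_raise_sum
proof (rule raise_sum_first_zero)
  show "spec_id (theta k (chi 1) r) = 0" if "r \<ge> part 1" for r
    using that first_row[OF assms] by (intro theta_spec_id) auto
qed (use first_row[OF assms] in \<open>auto simp: pairs_at_def\<close>)

end

theorem schubert_eq_theta_sum:
  assumes C: "double_schubert C" and kn: "k \<le> n" and w: "w \<in> Wn_grass k n"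
  shows "C w = theta_sum k n w"
  using w
proof (induction "cox_len w" arbitrary: w rule: less_induct)
  case less
  interpret grassmannian k n w by unfold_locales (use kn less.prems in auto)
  show ?case
  proof (cases "w = id")
    case True
    thus ?thesis using double_schubert_facts(2)[OF C Winf_id] theta_sum_id[OF kn] by simp
  next
    case False
    show ?thesis
    proof (rule schubert_unique[OF C Winf False])
      show "theta_sum k n w \<in> Rinf"
        unfolding theta_sum_def by (rule raise_sum_Rinf) (rule theta_Rinf)
      show "spec_id (theta_sum k n w) = 0" by (rule spec_id_theta_sum[OF False])
      fix i
      have "C (sgen i \<circ> w) = theta_sum k n (sgen i \<circ> w)" if "descent v i"
        using that less.hyps[of "sgen i \<circ> w"] cox_len_left[OF Winf, of i] descent_in_grass[OF that] by blast
      thus "theta_sum k n w - t_refl i (theta_sum k n w) =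
          alpha i * (if cox_len (sgen i \<circ> w) < cox_len w then C (sgen i \<circ> w) else 0)"
        using t_refl_theta_sum[of i] cox_len_left[OF Winf, of i] by simp
    qed
  qed
qed

section \<open>The bijection with strict partitions\<close>

lemma rank_mono:
  fixes E :: "int set"
  assumes "finite E" "x < y" "y \<in> E"
  shows "card {e \<in> E. e \<le> x} < card {e \<in> E. e \<le> y}"
proof (rule psubset_card_mono)
  have "y \<in> {e \<in> E. e \<le> y}" "y \<notin> {e \<in> E. e \<le> x}" using assms by auto
  moreover have "{e \<in> E. e \<le> x} \<subseteq> {e \<in> E. e \<le> y}" using assms(2) by auto
  ultimately show "{e \<in> E. e \<le> x} \<subset> {e \<in> E. e \<le> y}" by blast
qed (use assms in simp)

lemma rank_inj:
  fixes E :: "int set"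
  assumes "finite E" "x \<in> E" "y \<in> E" "card {e \<in> E. e \<le> x} = card {e \<in> E. e \<le> y}"
  shows "x = y"
  using rank_mono[OF assms(1), of x y] rank_mono[OF assms(1), of y x] assms by (cases x y rule: linorder_cases) auto

lemma rank_surj:
  fixes E :: "int set"
  assumes E: "finite E" and r: "1 \<le> r" "r \<le> card E"
  shows "\<exists>e\<in>E. card {e' \<in> E. e' \<le> e} = r"
proof -
  let ?f = "\<lambda>e. card {e' \<in> E. e' \<le> e}"
  have "?f ` E \<subseteq> {1..card E}"
  proof
    fix y assume "y \<in> ?f ` E"
    then obtain e where e: "e \<in> E" "y = ?f e" by blast
    have "?f e \<noteq> 0" using e E by auto
    moreover have "?f e \<le> card E" using E by (intro card_mono) auto
    ultimately show "y \<in> {1..card E}" using e by simp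
  qed
  moreover have "card (?f ` E) = card E"
    using rank_inj[OF E] by (intro card_image inj_onI) blast
  ultimately have "?f ` E = {1..card E}" by (intro card_subset_eq) simp_all
  thus ?thesis using r by (metis (no_types, lifting) atLeastAtMost_iff imageE)
qed

context grassmannian
begin

lemma negative_value_iff: "e > 0 \<Longrightarrow> v e < 0 \<longleftrightarrow> (\<exists>j. 1 \<le> j \<and> j \<le> n - k \<and> row j = - e)"
proof
  assume "\<exists>j. 1 \<le> j \<and> j \<le> n - k \<and> row j = - e"
  then obtain j where "1 \<le> j" "row j = - e" by blast
  hence "v (- e) = int (k + j)" by (simp only: v_eq)
  thus "v e < 0" using inv_facts(1)[of e] \<open>1 \<le> j\<close> by simp
qed (use row_of_negative[of e] in blast)

abbreviation "positive_values \<equiv> {e \<in> {1..int n}. v e > 0}"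

text \<open>The unbarred letters up to a positive entry of row j are the left entries below it, k
  minus the part in number, and the positive entries of the rows 1 to j. Once the barred letters are
  known, the part thus determines the entry.\<close>

lemma rank_formula:
  assumes j: "1 \<le> j" "j \<le> n - k" and x: "row j > 0"
  shows "int (card {e \<in> positive_values. e \<le> row j}) + part j =
    int k + int (card {a \<in> {1..j}. row a > 0})"
proof -
  define y where "y = row j"
  define P where "P = {p \<in> {1..k}. w (int p) \<le> y}"
  define T where "T = {p \<in> {1..k}. w (int p) > y}"
  define A where "A = {a \<in> {1..j}. row a > 0}"
  have eq: "{e \<in> positive_values. e \<le> y} = (\<lambda>p. w (int p)) ` (P \<union> (\<lambda>a. k + a) ` A)"
  proof (intro equalityI subsetI)
    fix e assume "e \<in> {e \<in> positive_values. e \<le> y}"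
    hence e: "1 \<le> e" "e \<le> int n" "v e > 0" "e \<le> y" by auto
    define p where "p = nat (v e)"
    have p: "int p = v e" "w (int p) = e" using e by (simp_all add: p_def)
    have "p \<in> P \<union> (\<lambda>a. k + a) ` A"
    proof (cases "p \<le> k")
      case True thus ?thesis using p e by (auto simp: P_def)
    next
      case False
      have "\<not> int p > int (k + j)"
      proof
        assume "int p > int (k + j)"
        hence "y < w (int p)" unfolding y_def using j by (intro increasing_right) auto
        thus False using p e by simp
      qed
      hence "p - k \<in> A" using False p e by (auto simp: A_def)
      moreover have "p = k + (p - k)" using False by simp
      ultimately show ?thesis by blast
    qed
    thus "e \<in> (\<lambda>p. w (int p)) ` (P \<union> (\<lambda>a. k + a) ` A)" using p by (metis image_eqI)
  next
    fix e assume "e \<in> (\<lambda>p. w (int p)) ` (P \<union> (\<lambda>a. k + a) ` A)"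
    then consider (left) p where "p \<in> P" "e = w (int p)" | (right) a where "a \<in> A" "e = row a" by blast
    thus "e \<in> {e \<in> positive_values. e \<le> y}"
    proof cases
      case left
      hence "p \<in> {1..k}" by (simp add: P_def)
      thus ?thesis using left left_value[of p] w_bound[of "int p"] kn by (auto simp: P_def)
    next
      case right
      have a: "1 \<le> a" "a \<le> j" "row a > 0" using right(1) by (auto simp: A_def)
      have "row a \<le> y"
        using increasing_right[of "int (k + a)" "int (k + j)"] a by (cases "a = j") (auto simp: y_def)
      moreover have "v e = int (k + a)" unfolding right(2) by (rule vw)
      moreover have "e \<le> int n" unfolding right(2) using a j kn by (intro w_bound) auto
      ultimately show ?thesis using a right(2) by simp
    qed
  qed
  have "card {e \<in> positive_values. e \<le> y} = card (P \<union> (\<lambda>a. k + a) ` A)"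
    unfolding eq by (rule card_image) (auto simp: inj_on_def facts(4))
  also have "\<dots> = card P + card ((\<lambda>a. k + a) ` A)" by (rule card_Un_disjoint) (auto simp: P_def A_def)
  also have "card ((\<lambda>a. k + a) ` A) = card A" by (rule card_image) simp
  finally have 1: "card {e \<in> positive_values. e \<le> y} = card P + card A" .
  have "{1..k} = P \<union> T" by (auto simp: P_def T_def)
  hence "k = card (P \<union> T)" by (metis card_atLeastAtMost diff_Suc_1)
  also have "\<dots> = card P + card T" by (rule card_Un_disjoint) (auto simp: P_def T_def)
  finally have 2: "k = card P + card T" .
  have "part j = int (card T)"
    using x unfolding part_at_def Let_def T_def y_def by simp
  thus ?thesis using 1 2 unfolding A_def y_def by simp
qed

lemma part_at_negative_iff:
  assumes "1 \<le> j"
  shows "part j > int k \<longleftrightarrow> row j < 0"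
proof (cases "row j < 0")
  case False
  have "card {p \<in> {1..k}. w (int p) > row j} \<le> card {1..k}" by (rule card_mono) auto
  thus ?thesis using False by (simp add: part_at_def Let_def)
qed (simp add: part_at_def Let_def)

end

text \<open>The composite of \<open>inv w'\<close> and \<open>w\<close> fixes the positions beyond k
  and maps the left positions increasingly to left positions, so it has no descent.\<close>

lemma grassmannian_eqI:
  assumes "grassmannian k n w" "grassmannian k n w'"
    and rows: "\<And>j. 1 \<le> j \<Longrightarrow> j \<le> n - k \<Longrightarrow> w (int (k + j)) = w' (int (k + j))"
  shows "w = w'"
proof -
  interpret A: grassmannian k n w by (rule assms)
  interpret B: grassmannian k n w' by (rule assms)
  define u where "u = inv w' \<circ> w"
  have U: "u \<in> Winf" unfolding u_def by (rule Winf_comp[OF Winf_inv[OF B.Winf] A.Winf])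
  have right: "u x = x" if "x > int k" for x
  proof (cases "x > int n")
    case True thus ?thesis using A.fixed B.v_fixed by (simp add: u_def)
  next
    case False
    have "int (k + nat (x - int k)) = x" using that by simp
    thus ?thesis using rows[of "nat (x - int k)"] False that B.vw[of x] by (simp add: u_def)
  qed
  have left: "1 \<le> u x \<and> u x \<le> int k" if x: "1 \<le> x" "x \<le> int k" for x
  proof (rule ccontr)
    assume *: "\<not> ?thesis"
    have "u x \<noteq> 0" using x Winf_facts(5)[OF U] by simp
    then consider "u x > int k" | "u x < 0" using * by linarith
    thus False
    proof cases
      case 1
      hence "u (u x) = u x" by (rule right)
      thus False using 1 x Winf_facts(4)[OF U, of "u x" x] by simp
    next
      case 2
      hence "u x < - int k" using A.positive_left[OF x] B.v_negative[of "w x"] by (simp add: u_def)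
      hence "u (- u x) = - u x" by (intro right) simp
      hence "u (u x) = u x" using Winf_facts(1)[OF U, of "u x"] by simp
      hence "u x = x" using Winf_facts(4)[OF U, of "u x" x] by simp
      thus False using 2 x by simp
    qed
  qed
  have "\<not> descent u i" for i
  proof (cases "int i < int k")
    case True
    show ?thesis
    proof (cases "i = 0")
      case i: True thus ?thesis using left[of 1] True by (auto simp: descent_def)
    next
      case False
      have "w (int i) < w (int i + 1)" using False True by (intro A.less_Suc) auto
      thus ?thesis
        using B.mono_left[of "w (int i)" "w (int i + 1)"] left[of "int i"] left[of "int i + 1"] False True
        by (simp add: descent_def u_def)
    qed
  next
    case False
    show ?thesis
    proof (cases "i = 0")
      case True thus ?thesis using False right[of 1] by (simp add: descent_def)
    next
      case i: False
      have "u (int i) \<le> int i" using False i left[of "int i"] right[of "int i"] by (cases "i = k") auto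
      thus ?thesis using False i right[of "int i + 1"] by (simp add: descent_def)
    qed
  qed
  hence "u = id" using no_descent_id[OF U] by blast
  hence "inv w' (w x) = x" for x unfolding u_def by (metis comp_apply id_apply)
  hence "w x = w' x" for x by (metis B.wv)
  thus ?thesis by auto
qed

lemma partition_of_nth:
  assumes "1 \<le> j" "j \<le> n - k"
  shows "int (partition_of k n w ! (j - 1)) = part_at k w j"
  using assms by (simp add: partition_of_def part_at_def Let_def del: upt_Suc)

lemma length_partition_of: "length (partition_of k n w) = n - k"
  by (simp add: partition_of_def del: upt_Suc)

text \<open>Parts greater than k determine the barred entries, hence also the set of unbarred
  letters. By \<open>rank_formula\<close> the other parts fix the ranks of the remaining entries
  within this set.\<close>

lemma inj_on_partition_of:
  assumes kn: "k \<le> n"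
  shows "inj_on (partition_of k n) (Wn_grass k n)"
proof (rule inj_onI)
  fix w w' assume w: "w \<in> Wn_grass k n" "w' \<in> Wn_grass k n" and eq: "partition_of k n w = partition_of k n w'"
  interpret A: grassmannian k n w by unfold_locales (use w kn in auto)
  interpret B: grassmannian k n w' by unfold_locales (use w kn in auto)
  have part: "part_at k w j = part_at k w' j" if "1 \<le> j" "j \<le> n - k" for j
    using partition_of_nth[OF that, of w] partition_of_nth[OF that, of w'] eq by simp
  have sign: "w (int (k + j)) < 0 \<longleftrightarrow> w' (int (k + j)) < 0" if "1 \<le> j" "j \<le> n - k" for j
    using A.part_at_negative_iff[OF that(1)] B.part_at_negative_iff[OF that(1)] part[OF that] by simp
  have neg: "w (int (k + j)) = w' (int (k + j))" if "1 \<le> j" "j \<le> n - k" "w (int (k + j)) < 0" for j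
    using part[OF that(1,2)] sign[OF that(1,2)] that by (simp add: part_at_def Let_def)
  let ?E = "\<lambda>w. {e \<in> {1..int n}. inv w e > 0}"
  have "inv w e > 0 \<longleftrightarrow> inv w' e > 0" if "e \<in> {1..int n}" for e
  proof -
    have "(\<exists>j. 1 \<le> j \<and> j \<le> n - k \<and> w (int (k + j)) = - e) \<longleftrightarrow> (\<exists>j. 1 \<le> j \<and> j \<le> n - k \<and> w' (int (k + j)) = - e)"
    proof -
      have "w (int (k + j)) = - e \<longleftrightarrow> w' (int (k + j)) = - e" if "1 \<le> j" "j \<le> n - k" for j
        using neg[OF that] sign[OF that] \<open>e \<in> {1..int n}\<close> by auto
      thus ?thesis by blast
    qed
    hence "inv w e < 0 \<longleftrightarrow> inv w' e < 0" using A.negative_value_iff[of e] B.negative_value_iff[of e] that by simp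
    moreover have "inv w e \<noteq> 0" "inv w' e \<noteq> 0" using A.inv_facts(5)[of e] B.inv_facts(5)[of e] that by auto
    ultimately show ?thesis by linarith
  qed
  hence E: "?E w = ?E w'" by blast
  have "w (int (k + j)) = w' (int (k + j))" if j: "1 \<le> j" "j \<le> n - k" for j
  proof (cases "w (int (k + j)) < 0")
    case False
    have nz: "w (int (k + j)) \<noteq> 0" "w' (int (k + j)) \<noteq> 0" using A.entry_nonzero B.entry_nonzero j by auto
    have pos: "w (int (k + j)) > 0" "w' (int (k + j)) > 0" using False nz sign[OF j] by auto
    have "w (int (k + a)) > 0 \<longleftrightarrow> w' (int (k + a)) > 0" if "a \<in> {1..j}" for a
      using sign[of a] A.entry_nonzero[of a] B.entry_nonzero[of a] that j
      by (metis atLeastAtMost_iff le_trans linorder_neqE_linordered_idom not_less_iff_gr_or_eq)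
    hence "{a \<in> {1..j}. w (int (k + a)) > 0} = {a \<in> {1..j}. w' (int (k + a)) > 0}" by blast
    hence "card {e \<in> ?E w. e \<le> w (int (k + j))} = card {e \<in> ?E w. e \<le> w' (int (k + j))}"
      using A.rank_formula[OF j pos(1)] B.rank_formula[OF j pos(2)] part[OF j] unfolding E by simp
    moreover have "w (int (k + j)) \<in> ?E w" "w' (int (k + j)) \<in> ?E w'"
      using A.w_bound[of "int (k + j)"] B.w_bound[of "int (k + j)"] pos j kn A.vw[of "int (k + j)"] B.vw[of "int (k + j)"]
      by (simp_all del: of_nat_add A.vw B.vw)
    moreover have "finite (?E w')" by (rule finite_subset[of _ "{1..int n}"]) auto
    ultimately show ?thesis using rank_inj[of "?E w'"] unfolding E by blast
  qed (use neg j in auto)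
  thus "w = w'" by (rule grassmannian_eqI[OF A.grassmannian_axioms B.grassmannian_axioms])
qed

text \<open>The left positions are filled, in any order, with the letters missing from the
  prescribed entries.\<close>

lemma window_extends:
  fixes X :: "nat \<Rightarrow> int"
  assumes kn: "k \<le> n"
    and X: "\<And>j. 1 \<le> j \<Longrightarrow> j \<le> n - k \<Longrightarrow> X j \<noteq> 0 \<and> \<bar>X j\<bar> \<le> int n"
      "\<And>a b. 1 \<le> a \<Longrightarrow> a \<le> n - k \<Longrightarrow> 1 \<le> b \<Longrightarrow> b \<le> n - k \<Longrightarrow> \<bar>X a\<bar> = \<bar>X b\<bar> \<Longrightarrow> a = b"
  shows "\<exists>w\<in>Winf. (\<forall>x > int n. w x = x) \<and> (\<forall>j. 1 \<le> j \<longrightarrow> j \<le> n - k \<longrightarrow> w (int (k + j)) = X j)"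
proof -
  let ?m = "n - k"
  define R where "R = (\<lambda>j. nat \<bar>X j\<bar>) ` {1..?m}"
  have "inj_on (\<lambda>j. nat \<bar>X j\<bar>) {1..?m}"
  proof (rule inj_onI)
    fix a b assume "a \<in> {1..?m}" "b \<in> {1..?m}" "nat \<bar>X a\<bar> = nat \<bar>X b\<bar>"
    thus "a = b" using X(2)[of a b] by simp
  qed
  hence "card R = ?m" unfolding R_def by (simp add: card_image)
  moreover have R: "R \<subseteq> {1..n}"
  proof
    fix y assume "y \<in> R"
    then obtain j where "j \<in> {1..?m}" "y = nat \<bar>X j\<bar>" by (auto simp: R_def)
    thus "y \<in> {1..n}" using X(1)[of j] by auto
  qed
  ultimately have "card {1..k} = card ({1..n} - R)" using kn by (simp add: card_Diff_subset finite_subset)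
  then obtain g where g: "bij_betw g {1..k} ({1..n} - R)"
    using finite_same_card_bij[of "{1..k}" "{1..n} - R"] by auto
  define f where "f = (\<lambda>p. if p \<le> k then int (g p) else X (p - k))"
  have gp: "g p \<in> {1..n} - R" if "p \<in> {1..k}" for p using bij_betwE[OF g] that by blast
  have f: "f p \<noteq> 0 \<and> \<bar>f p\<bar> \<le> int n" if "p \<in> {1..n}" for p
  proof (cases "p \<le> k")
    case True
    thus ?thesis using gp[of p] that by (auto simp: f_def)
  next
    case False
    thus ?thesis using X(1)[of "p - k"] that by (simp add: f_def)
  qed
  have finj: "p = q" if pq: "p \<in> {1..n}" "q \<in> {1..n}" "\<bar>f p\<bar> = \<bar>f q\<bar>" for p q
  proof -
    have mixed: False if "p \<in> {1..k}" "q \<in> {1..n}" "\<not> q \<le> k" "int (g p) = \<bar>X (q - k)\<bar>" for p q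
    proof -
      have "q - k \<in> {1..?m}" using that by auto
      moreover have "g p = nat \<bar>X (q - k)\<bar>" using that(4) by simp
      ultimately have "g p \<in> R" by (auto simp: R_def)
      thus False using gp[OF that(1)] by simp
    qed
    consider "p \<le> k" "q \<le> k" | "p \<le> k" "\<not> q \<le> k" | "\<not> p \<le> k" "q \<le> k" | "\<not> p \<le> k" "\<not> q \<le> k" by blast
    thus ?thesis
    proof cases
      case 1
      hence "g p = g q" using pq(3) by (simp add: f_def)
      moreover have "inj_on g {1..k}" using g by (rule bij_betw_imp_inj_on)
      ultimately show ?thesis using 1 pq(1,2) by (auto dest: inj_onD)
    next
      case 2 thus ?thesis using mixed[of p q] pq by (simp add: f_def)
    next
      case 3 thus ?thesis using mixed[of q p] pq by (simp add: f_def)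
    next
      case 4
      hence "\<bar>X (p - k)\<bar> = \<bar>X (q - k)\<bar>" using pq(3) by (simp add: f_def)
      moreover have "1 \<le> p - k" "p - k \<le> ?m" "1 \<le> q - k" "q - k \<le> ?m" using 4 pq(1,2) by auto
      ultimately have "p - k = q - k" using X(2) by blast
      thus ?thesis using 4 by simp
    qed
  qed
  define S where "S = {- int n..int n} - {0}"
  define w where "w = (\<lambda>x. if x \<in> S then sgn x * f (nat \<bar>x\<bar>) else x)"
  have S: "x \<in> S \<longleftrightarrow> x \<noteq> 0 \<and> \<bar>x\<bar> \<le> int n" for x by (auto simp: S_def)
  have nS: "nat \<bar>x\<bar> \<in> {1..n}" if "x \<in> S" for x using that by (auto simp: S)
  have wabs: "\<bar>w x\<bar> = \<bar>f (nat \<bar>x\<bar>)\<bar>" if "x \<in> S" for x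
    using that by (simp add: w_def abs_mult abs_sgn_eq) (simp add: S)
  have wS: "w x \<in> S" if "x \<in> S" for x
    using f[OF nS[OF that]] wabs[OF that] unfolding S by auto
  have "w permutes S"
  proof (rule inj_imp_permutes)
    show "inj_on w S"
    proof (rule inj_onI)
      fix x y assume xy: "x \<in> S" "y \<in> S" "w x = w y"
      have p: "nat \<bar>x\<bar> = nat \<bar>y\<bar>" using finj[OF nS[OF xy(1)] nS[OF xy(2)]] wabs[OF xy(1)] wabs[OF xy(2)] xy(3) by simp
      have "sgn x * f (nat \<bar>y\<bar>) = sgn y * f (nat \<bar>y\<bar>)" using xy p by (simp add: w_def)
      hence "sgn x = sgn y" using f[OF nS[OF xy(2)]] by simp
      moreover have "\<bar>x\<bar> = \<bar>y\<bar>" using p by simp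
      ultimately show "x = y" by (metis sgn_mult_abs)
    qed
    show "finite S" by (simp add: S_def)
    show "w x \<in> S" if "x \<in> S" for x using that by (rule wS)
    show "w x = x" if "x \<notin> S" for x using that by (simp add: w_def)
  qed
  hence "w permutes UNIV - {0}" by (rule permutes_subset) (auto simp: S_def)
  moreover have "w (- x) = - w x" for x by (simp add: w_def S sgn_minus)
  moreover have "{x. w x \<noteq> x} \<subseteq> S" by (auto simp: w_def)
  hence "finite {x. w x \<noteq> x}" by (rule finite_subset) (simp add: S_def)
  ultimately have "w \<in> Winf" by (simp add: Winf_def)
  moreover have "\<forall>x > int n. w x = x" by (simp add: w_def S)
  moreover have "w (int (k + j)) = X j" if "1 \<le> j" "j \<le> ?m" for j
  proof -
    have "int (k + j) \<in> S" "sgn (int (k + j)) = 1" "nat \<bar>int (k + j)\<bar> = k + j"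
      using that kn by (auto simp: S simp del: of_nat_add)
    thus ?thesis using that by (simp add: w_def f_def del: of_nat_add)
  qed
  ultimately show ?thesis by blast
qed

text \<open>The left part of the window is sorted by choosing an extension with the fewest inversions.\<close>

lemma window_exists:
  fixes X :: "nat \<Rightarrow> int"
  assumes kn: "k \<le> n"
    and X: "\<And>j. 1 \<le> j \<Longrightarrow> j \<le> n - k \<Longrightarrow> X j \<noteq> 0 \<and> \<bar>X j\<bar> \<le> int n"
      "\<And>a b. 1 \<le> a \<Longrightarrow> a \<le> n - k \<Longrightarrow> 1 \<le> b \<Longrightarrow> b \<le> n - k \<Longrightarrow> \<bar>X a\<bar> = \<bar>X b\<bar> \<Longrightarrow> a = b"
      "\<And>a b. 1 \<le> a \<Longrightarrow> a < b \<Longrightarrow> b \<le> n - k \<Longrightarrow> X a < X b"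
  shows "\<exists>w\<in>Wn_grass k n. \<forall>j. 1 \<le> j \<longrightarrow> j \<le> n - k \<longrightarrow> w (int (k + j)) = X j"
proof -
  define P where "P = (\<lambda>w. w \<in> Winf \<and> (\<forall>x > int n. w x = x) \<and> (\<forall>j. 1 \<le> j \<longrightarrow> j \<le> n - k \<longrightarrow> w (int (k + j)) = X j))"
  have "\<exists>w\<in>Winf. (\<forall>x > int n. w x = x) \<and> (\<forall>j. 1 \<le> j \<longrightarrow> j \<le> n - k \<longrightarrow> w (int (k + j)) = X j)"
    by (rule window_extends[OF kn]) (fact X(1), fact X(2))
  then obtain w0 where "P w0" unfolding P_def by blast
  from ex_has_least_nat[of P, OF this, of inv_count]
  obtain w where w: "P w" and min: "\<And>u. P u \<Longrightarrow> inv_count w \<le> inv_count u" by blast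
  have W: "w \<in> Winf" and fixed: "\<And>x. x > int n \<Longrightarrow> w x = x" and row: "\<And>j. 1 \<le> j \<Longrightarrow> j \<le> n - k \<Longrightarrow> w (int (k + j)) = X j"
    using w unfolding P_def by blast+
  have "\<not> descent w i" if "i \<noteq> k" for i
  proof (cases "i < k")
    case True
    show ?thesis
    proof
      assume d: "descent w i"
      have s: "sgen i x = x" if "x > int k" for x using that True by (simp add: sgen_apply)
      have "P (w \<circ> sgen i)"
        unfolding P_def
      proof (intro conjI allI impI)
        show "w \<circ> sgen i \<in> Winf" by (rule Winf_comp[OF W sgen_Winf])
        show "(w \<circ> sgen i) x = x" if "x > int n" for x using that s[of x] fixed[of x] kn by simp
        show "(w \<circ> sgen i) (int (k + j)) = X j" if "1 \<le> j" "j \<le> n - k" for j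
          using s[of "int (k + j)"] row[OF that] that by simp
      qed
      from min[OF this] show False using inv_count_descent[OF W d] by simp
    qed
  next
    case False
    define j where "j = i - k"
    have j: "1 \<le> j" "i = k + j" using False that by (auto simp: j_def)
    consider "j < n - k" | "j = n - k" | "i > n" using j kn by linarith
    hence "w (int i) < w (int i + 1)"
    proof cases
      case 1
      thus ?thesis using row[of j] row[of "Suc j"] X(3)[of j "Suc j"] j by (simp add: add.commute add.left_commute)
    next
      case 2
      have "w (int i) \<le> int n" using row[of j] X(1)[of j] 2 j by auto
      moreover have "w (int i + 1) = int i + 1" using 2 j kn by (intro fixed) auto
      moreover have "i = n" using 2 j kn by simp
      ultimately show ?thesis by simp
    next
      case 3 thus ?thesis using fixed by simp
    qed
    thus ?thesis using j by (simp add: descent_def)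
  qed
  hence "w \<in> Wn_grass k n"
    using W fixed cox_len_right(2)[OF W] by (auto simp: Wn_grass_def Wn_def W_grass_def)
  thus ?thesis using row by blast
qed

text \<open>The prescribed entries \<open>X\<close> are built from the partition: parts above k give
  the barred letters, distinct by k-strictness, and the other entries are chosen among the remaining
  letters by their rank.\<close>

lemma partition_of_surj:
  assumes kn: "k \<le> n" and lam: "lam \<in> kstrict_partitions k n"
  shows "\<exists>w\<in>Wn_grass k n. partition_of k n w = lam"
proof -
  let ?m = "n - k"
  define l where "l = (\<lambda>j. lam ! (j - 1))"
  have len: "length lam = ?m" and sorted: "sorted_wrt (\<ge>) lam" and bound: "\<And>p. p \<in> set lam \<Longrightarrow> p \<le> n + k"
    and strict: "\<And>p. p > k \<Longrightarrow> count_list lam p \<le> 1"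
    using lam by (auto simp: kstrict_partitions_def)
  have lmem: "l j \<in> set lam" if "1 \<le> j" "j \<le> ?m" for j using that len by (simp add: l_def)
  have dec: "l b \<le> l a" if "1 \<le> a" "a < b" "b \<le> ?m" for a b
    using sorted_wrt_nth_less[OF sorted, of "a - 1" "b - 1"] that len by (simp add: l_def)
  have sdec: "l b < l a" if ab: "1 \<le> a" "a < b" "b \<le> ?m" and gt: "l a > k" for a b
  proof (rule ccontr)
    assume "\<not> ?thesis"
    hence eq: "l a = l b" using dec[OF ab] by simp
    have "{a - 1, b - 1} \<subseteq> {i. i < length lam \<and> l a = lam ! i}" using ab eq len by (auto simp: l_def)
    hence "card {a - 1, b - 1} \<le> card {i. i < length lam \<and> l a = lam ! i}" by (intro card_mono) auto
    moreover have "card {a - 1, b - 1} = 2" using ab by auto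
    moreover have "count_list lam (l a) = card {i. i < length lam \<and> l a = lam ! i}"
      by (simp add: count_list_eq_length_filter length_filter_conv_card)
    ultimately show False using strict[OF gt] by simp
  qed
  define B where "B = {j \<in> {1..?m}. l j > k}"
  define Z where "Z = (\<lambda>j. int (l j) - int k) ` B"
  define E where "E = {1..int n} - Z"
  have ZE: "Z \<subseteq> {1..int n}"
  proof
    fix z assume "z \<in> Z"
    then obtain j where "j \<in> B" "z = int (l j) - int k" by (auto simp: Z_def)
    thus "z \<in> {1..int n}" using bound[OF lmem[of j]] by (auto simp: B_def)
  qed
  have "inj_on (\<lambda>j. int (l j) - int k) B"
  proof (rule inj_onI)
    fix a b assume "a \<in> B" "b \<in> B" "int (l a) - int k = int (l b) - int k"
    thus "a = b" using sdec[of a b] sdec[of b a] by (cases a b rule: linorder_cases) (auto simp: B_def)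
  qed
  hence cardE: "card E = n - card B"
    unfolding E_def using ZE by (simp add: card_Diff_subset finite_subset Z_def card_image)
  have finE: "finite E" by (simp add: E_def)
  define A where "A = (\<lambda>j. {a \<in> {1..j}. l a \<le> k})"
  \<comment> \<open>The rank that \<open>rank_formula\<close> forces on the entry of row j.\<close>
  define rk where "rk = (\<lambda>j. k - l j + card (A j))"
  have rk: "1 \<le> rk j \<and> rk j \<le> card E" if j: "1 \<le> j" "j \<le> ?m" "l j \<le> k" for j
  proof
    have "j \<in> A j" "finite (A j)" using j by (auto simp: A_def)
    hence "card (A j) \<noteq> 0" by auto
    thus "1 \<le> rk j" by (simp add: rk_def)
    \<comment> \<open>\<open>A j\<close> and \<open>B\<close> are disjoint sets of rows, so the rank
      is at most k + (n - k) - card B = card E.\<close>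
    have "A j \<union> B \<subseteq> {1..?m}" using j by (auto simp: A_def B_def)
    hence "card (A j \<union> B) \<le> ?m" using card_mono[of "{1..?m}"] by fastforce
    moreover have "card (A j \<union> B) = card (A j) + card B" by (rule card_Un_disjoint) (auto simp: A_def B_def)
    ultimately show "rk j \<le> card E" using kn by (simp add: rk_def cardE)
  qed
  define e where "e = (\<lambda>j. SOME x. x \<in> E \<and> card {y \<in> E. y \<le> x} = rk j)"
  have e: "e j \<in> E" "card {y \<in> E. y \<le> e j} = rk j" if "1 \<le> j" "j \<le> ?m" "l j \<le> k" for j
  proof -
    have "\<exists>x. x \<in> E \<and> card {y \<in> E. y \<le> x} = rk j" using rank_surj[OF finE, of "rk j"] rk[OF that] by blast
    from someI_ex[OF this] show "e j \<in> E" "card {y \<in> E. y \<le> e j} = rk j" by (auto simp: e_def)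
  qed
  have einc: "e a < e b" if ab: "1 \<le> a" "a < b" "b \<le> ?m" "l a \<le> k" "l b \<le> k" for a b
  proof (rule ccontr)
    assume "\<not> ?thesis"
    hence "card {y \<in> E. y \<le> e b} \<le> card {y \<in> E. y \<le> e a}" using finE by (intro card_mono) auto
    moreover have "card (A a) < card (A b)"
    proof (rule psubset_card_mono)
      have "b \<in> A b" "b \<notin> A a" "A a \<subseteq> A b" using ab by (auto simp: A_def)
      thus "A a \<subset> A b" by blast
    qed (simp add: A_def)
    ultimately show False using e(2)[of a] e(2)[of b] ab dec[of a b] by (simp add: rk_def)
  qed
  define X where "X = (\<lambda>j. if l j > k then - (int (l j) - int k) else e j)"
  have XZ: "- X j \<in> Z" if "1 \<le> j" "j \<le> ?m" "l j > k" for j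
    using that by (auto simp: X_def Z_def B_def)
  have XE: "X j \<in> E" if "1 \<le> j" "j \<le> ?m" "l j \<le> k" for j
    using e(1)[OF that] that by (simp add: X_def)
  have Xinc: "X a < X b" if ab: "1 \<le> a" "a < b" "b \<le> ?m" for a b
  proof -
    consider "l a > k" "l b > k" | "l a > k" "l b \<le> k" | "l a \<le> k" "l b \<le> k" using dec[OF ab] by linarith
    thus ?thesis
    proof cases
      case 1 thus ?thesis using sdec[OF ab] by (simp add: X_def)
    next
      case 2
      hence "X b \<ge> 1" using XE[of b] ab by (auto simp: E_def)
      thus ?thesis using 2 by (simp add: X_def)
    next
      case 3 thus ?thesis using einc[OF ab] by (simp add: X_def)
    qed
  qed
  have Xb: "X j \<noteq> 0 \<and> \<bar>X j\<bar> \<le> int n" if "1 \<le> j" "j \<le> ?m" for j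
    using XZ[OF that] XE[OF that] ZE by (cases "l j > k") (auto simp: E_def)
  have Xabs: "a = b" if ab: "1 \<le> a" "a \<le> ?m" "1 \<le> b" "b \<le> ?m" "\<bar>X a\<bar> = \<bar>X b\<bar>" for a b
  proof -
    have neq: "X a \<noteq> - X b"
    proof
      assume "X a = - X b"
      thus False using XZ[of a] XE[of a] XZ[of b] XE[of b] ab
        by (cases "l a > k"; cases "l b > k") (auto simp: E_def X_def)
    qed
    hence "X a = X b" using ab(5) by (simp add: abs_eq_iff)
    thus ?thesis using Xinc[of a b] Xinc[of b a] ab by (cases a b rule: linorder_cases) auto
  qed
  have "\<exists>w\<in>Wn_grass k n. \<forall>j. 1 \<le> j \<longrightarrow> j \<le> ?m \<longrightarrow> w (int (k + j)) = X j"
    by (rule window_exists[OF kn]) (fact Xb, fact Xabs, fact Xinc)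
  then obtain w where w: "w \<in> Wn_grass k n" and row: "\<And>j. 1 \<le> j \<Longrightarrow> j \<le> ?m \<Longrightarrow> w (int (k + j)) = X j"
    by blast
  interpret grassmannian k n w by unfold_locales (use kn w in auto)
  have vE: "positive_values = E"
  proof -
    have "v x > 0 \<longleftrightarrow> x \<notin> Z" if x: "x \<in> {1..int n}" for x
    proof -
      have "(\<exists>j. 1 \<le> j \<and> j \<le> ?m \<and> w (int (k + j)) = - x) \<longleftrightarrow> x \<in> Z"
      proof
        assume "\<exists>j. 1 \<le> j \<and> j \<le> ?m \<and> w (int (k + j)) = - x"
        then obtain j where j: "1 \<le> j" "j \<le> ?m" "X j = - x" using row by auto
        have "l j > k" using XE[OF j(1,2)] j(3) x by (cases "l j > k") (auto simp: E_def)
        thus "x \<in> Z" using XZ[OF j(1,2)] j(3) by simp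
      next
        assume "x \<in> Z"
        then obtain j where "j \<in> B" "x = int (l j) - int k" by (auto simp: Z_def)
        thus "\<exists>j. 1 \<le> j \<and> j \<le> ?m \<and> w (int (k + j)) = - x"
          using row[of j] by (intro exI[of _ j]) (auto simp: B_def X_def)
      qed
      hence "v x < 0 \<longleftrightarrow> x \<in> Z" using negative_value_iff[of x] x by simp
      moreover have "v x \<noteq> 0" using inv_facts(5)[of x] x by auto
      ultimately show ?thesis by linarith
    qed
    thus ?thesis by (auto simp: E_def)
  qed
  have "part_at k w j = int (l j)" if j: "1 \<le> j" "j \<le> ?m" for j
  proof (cases "l j > k")
    case True
    thus ?thesis unfolding part_at_def Let_def row[OF j] by (simp add: X_def)
  next
    case False
    hence le: "l j \<le> k" by simp
    have pos: "w (int (k + j)) > 0" using XE[OF j le] row[OF j] by (simp add: E_def)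
    have "w (int (k + a)) > 0 \<longleftrightarrow> l a \<le> k" if "a \<in> {1..j}" for a
      using row[of a] XE[of a] that j by (cases "l a > k") (auto simp: E_def X_def)
    hence "{a \<in> {1..j}. w (int (k + a)) > 0} = A j" by (auto simp: A_def)
    hence "int (rk j) + part_at k w j = int k + int (card (A j))"
      using rank_formula[OF j pos] e(2)[OF j le] False unfolding vE row[OF j] by (simp add: X_def)
    thus ?thesis using le by (simp add: rk_def)
  qed
  hence part: "int (partition_of k n w ! (j - 1)) = int (lam ! (j - 1))" if "1 \<le> j" "j \<le> ?m" for j
    using partition_of_nth[OF that, of w] that by (simp add: l_def)
  have "partition_of k n w = lam"
  proof (rule nth_equalityI)
    show "partition_of k n w ! i = lam ! i" if "i < length (partition_of k n w)" for i
      using part[of "Suc i"] that by (simp add: length_partition_of)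
  qed (simp add: length_partition_of len)
  thus ?thesis using w by blast
qed

lemma grass_elt:
  assumes "k \<le> n" "lam \<in> kstrict_partitions k n"
  shows "grass_elt k n lam \<in> Wn_grass k n" "partition_of k n (grass_elt k n lam) = lam"
proof -
  have "lam \<in> partition_of k n ` Wn_grass k n" using partition_of_surj[OF assms] by blast
  thus "grass_elt k n lam \<in> Wn_grass k n" "partition_of k n (grass_elt k n lam) = lam"
    unfolding grass_elt_def
    using the_inv_into_into[OF inj_on_partition_of[OF assms(1)], of lam "Wn_grass k n"]
      f_the_inv_into_f[OF inj_on_partition_of[OF assms(1)], of lam] by auto
qed

theorem theorem1p3:
  fixes k n :: nat and lam :: "nat list" and C :: "(int \<Rightarrow> int) \<Rightarrow> var mps"
  assumes "double_schubert C"
    and "k \<le> n" and "1 \<le> n" and "lam \<in> kstrict_partitions k n"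
  shows "C (grass_elt k n lam) =
    (\<Sum>I\<in>Pow (Dset k n lam).
      schur_pf (map (\<lambda>i. (theta k (char_index k n lam ! (i - 1)), int (lam ! (i - 1)) + shift_I I i))
        [1..<n - k + 1]))"
proof -
  define w where "w = grass_elt k n lam"
  note g = grass_elt[OF assms(2,4), folded w_def]
  have chi: "char_index k n lam ! (j - 1) = chi_at k w j" if "1 \<le> j" "j \<le> n - k" for j
    using that by (simp add: char_index_def chi_at_def Let_def w_def del: upt_Suc)
  have part: "int (lam ! (j - 1)) = part_at k w j" if "1 \<le> j" "j \<le> n - k" for j
    using partition_of_nth[OF that, of w] g(2) by simp
  have D: "Dset k n lam = pairs_at k n w"
    using chi by (auto simp: Dset_def pairs_at_def)
  have "C w = (\<Sum>I\<in>Pow (pairs_at k n w).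
      schur_pf (map (\<lambda>i. (theta k (chi_at k w i), part_at k w i + shift_I I i)) [1..<Suc (n - k)]))"
    using schubert_eq_theta_sum[OF assms(1,2) g(1)] by (simp add: theta_sum_def raise_sum_def row_pf_def del: upt_Suc)
  also have "\<dots> = (\<Sum>I\<in>Pow (Dset k n lam).
      schur_pf (map (\<lambda>i. (theta k (char_index k n lam ! (i - 1)), int (lam ! (i - 1)) + shift_I I i)) [1..<n - k + 1]))"
    unfolding D
  proof (intro sum.cong refl arg_cong[where f = schur_pf] map_cong)
    fix I i assume "i \<in> set [1..<n - k + 1]"
    hence i: "1 \<le> i" "i \<le> n - k" by auto
    show "(theta k (chi_at k w i), part_at k w i + shift_I I i) =
        (theta k (char_index k n lam ! (i - 1)), int (lam ! (i - 1)) + shift_I I i)"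
      unfolding chi[OF i] part[OF i] ..
  qed simp
  finally show ?thesis by (simp only: w_def)
qed

end
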